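(* Let $G=(V,E)$ be a bridgeless graph, let $\xi_G=|E|-|V|+\#\mathrm{components}(G)$ be its cyclomatic number, and let $\varphi_G$ be its multivariate flow counting function (a piecewise-defined polynomial). Then for every $\mathbf{k}\in\mathbb{Z}_{\ge0}^E$, the number $(-1)^{\xi_G}\varphi_G(-\mathbf{k})$ equals the number of $(\mathbf{k}+\mathbf{1})$-flows of $G$, each counted with multiplicity equal to the number of totally cyclic orientations of $G$ compatible with it. In particular, $(-1)^{\xi_G}\varphi_G(\mathbf{0})$ equals the number of totally cyclic orientations of $G$.
   Context: Graphs $G=(V,E)$ are finite and may have multiple edges. A bridge is an edge whose removal increases the number of connected components of $G$; $G$ is bridgeless if it has no bridge. Fix an initial orientation of $G$: for each edge $e=uv\in E$, one of $u,v$ is designated the head $h(e)$ and the other the tail $t(e)$. An integral flow on $G$ (with respect to this orientation) is a vector $\mathbf{x}=(x_e)_{e\in E}\in\mathbb{Z}^E$ such that for every node $v\in V$, $$\sum_{h(e)=v}x_e=\sum_{t(e)=v}x_e.$$ For $\mathbf{k}\in\mathbb{Z}_{>0}^E$, a $\mathbf{k}$-flow on $G$ is an integral flow $\mathbf{x}\in\mathbb{Z}^E$ with $|x_e|<k_e$ for every $e\in E$ (zero entries are allowed). It is nowhere-zero if $x_e\ne0$ for every $e\in E$. For $\mathbf{k}\in\mathbb{Z}_{>0}^E$, $\varphi_G(\mathbf{k})$ denotes the number of nowhere-zero $\mathbf{k}$-flows on $G$; this does not depend on the chosen orientation. The vectors $\mathbf{1},\mathbf{0}\in\mathbb{Z}^E$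 have all entries $1$, respectively $0$. A totally cyclic orientation of $G$ is an orientation for which every edge lies in a coherently oriented cycle. An orientation of $G$ is compatible with a flow $\mathbf{x}$ if it is obtained from the initial orientation by switching the direction of every edge $e$ with $x_e<0$, leaving the direction of every edge with $x_e>0$, and arbitrarily either switching or leaving the direction of each edge with $x_e=0$. Meaning of $\varphi_G(-\mathbf{k})$: for a bridgeless graph $G$, the function $\varphi_G$ is a piecewise-defined polynomial, i.e. there are finitely many full-dimensional closed convex rational polyhedral cones $C_1,\dots,C_m$ with union $\mathbb{R}_{\ge0}^E$ and polynomials $p_1,\dots,p_m\in\mathbb{Q}[k_e:e\in E]$ with $\varphi_G(\mathbf{k})=p_i(\mathbf{k})$ for all $\mathbf{k}\in C_i\cap\mathbb{Z}_{>0}^E$. For $\mathbf{k}\in\mathbb{Z}_{\ge0}^E$, $\varphi_G(-\mathbf{k})$ means $p_i(-\mathbf{k})$ for any $i$ with $\mathbf{k}\in C_i$ (the claim is asserted for every such $i$); in particular $\varphi_G(\mathbf{0})=p_i(\mathbf{0})$. *)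

theory Defs
  imports
    "Graph_Theory.Digraph_Component"
    "HOL-Library.Poly_Mapping"
    "HOL-Analysis.Function_Topology"
begin

text \<open>
  A finite graph (multiple edges and loops allowed) together with its initial orientation is
  a \<open>fin_digraph\<close>: the arcs are the edges, \<open>head\<close> and \<open>tail\<close> are the initial orientation.
  Bridges, components and the cyclomatic number do not depend on the directions.
  Vectors indexed by the edge set \<open>E\<close> are extensional functions in \<open>E \<rightarrow>\<^sub>E UNIV\<close>.
\<close>

definition num_components :: "('v, 'e) pre_digraph \<Rightarrow> nat" where
  "num_components G = card (pre_digraph.sccs_verts (with_proj (mk_symmetric G)))"

definition bridge :: "('v, 'e) pre_digraph \<Rightarrow> 'e \<Rightarrow> bool" where
  "bridge G e \<longleftrightarrow> e \<in> arcs G \<and> num_components G < num_components (pre_digraph.del_arc G e)"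

definition bridgeless :: "('v, 'e) pre_digraph \<Rightarrow> bool" where
  "bridgeless G \<longleftrightarrow> (\<forall>e\<in>arcs G. \<not> bridge G e)"

text \<open>
  The subtraction never truncates on a finite graph, because the number of vertices is at most
  the number of edges plus the number of components.
\<close>

definition cyclomatic_number :: "('v, 'e) pre_digraph \<Rightarrow> nat" where
  "cyclomatic_number G = card (arcs G) + num_components G - card (verts G)"

definition integral_flow :: "('v, 'e) pre_digraph \<Rightarrow> ('e \<Rightarrow> int) \<Rightarrow> bool" where
  "integral_flow G x \<longleftrightarrow> x \<in> arcs G \<rightarrow>\<^sub>E UNIV \<and>
     (\<forall>v\<in>verts G. (\<Sum>e\<in>in_arcs G v. x e) = (\<Sum>e\<in>out_arcs G v. x e))"

definition k_flows :: "('v, 'e) pre_digraph \<Rightarrow> ('e \<Rightarrow> int) \<Rightarrow> ('e \<Rightarrow> int) set" where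
  "k_flows G k = {x. integral_flow G x \<and> (\<forall>e\<in>arcs G. \<bar>x e\<bar> < k e)}"

definition nowhere_zero_k_flows :: "('v, 'e) pre_digraph \<Rightarrow> ('e \<Rightarrow> int) \<Rightarrow> ('e \<Rightarrow> int) set" where
  "nowhere_zero_k_flows G k = {x \<in> k_flows G k. \<forall>e\<in>arcs G. x e \<noteq> 0}"

definition flow_count :: "('v, 'e) pre_digraph \<Rightarrow> ('e \<Rightarrow> int) \<Rightarrow> nat" where
  "flow_count G k = card (nowhere_zero_k_flows G k)"

text \<open>
  An orientation is encoded by the set \<open>S\<close> of edges whose direction is switched relative to the
  initial one. In particular a loop has two orientations.
\<close>

definition reorient :: "('v, 'e) pre_digraph \<Rightarrow> 'e set \<Rightarrow> ('v, 'e) pre_digraph" where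
  "reorient G S = G\<lparr>tail := (\<lambda>e. if e \<in> S then head G e else tail G e),
                    head := (\<lambda>e. if e \<in> S then tail G e else head G e)\<rparr>"

definition totally_cyclic :: "('v, 'e) pre_digraph \<Rightarrow> bool" where
  "totally_cyclic D \<longleftrightarrow> (\<forall>e\<in>arcs D. \<exists>c. pre_digraph.cycle D c \<and> e \<in> set c)"

definition totally_cyclic_orientations :: "('v, 'e) pre_digraph \<Rightarrow> 'e set set" where
  "totally_cyclic_orientations G = {S. S \<subseteq> arcs G \<and> totally_cyclic (reorient G S)}"

definition compatible_orientation ::
    "('v, 'e) pre_digraph \<Rightarrow> ('e \<Rightarrow> int) \<Rightarrow> 'e set \<Rightarrow> bool" where
  "compatible_orientation G x S \<longleftrightarrow> S \<subseteq> arcs G \<and>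
     (\<forall>e\<in>arcs G. (x e < 0 \<longrightarrow> e \<in> S) \<and> (0 < x e \<longrightarrow> e \<notin> S))"

text \<open>
  Multivariate polynomials over \<open>\<rat>\<close> are finitely supported maps from monomials
  (finitely supported exponent vectors) to coefficients.
\<close>

type_synonym 'e rat_mpoly = "('e \<Rightarrow>\<^sub>0 nat) \<Rightarrow>\<^sub>0 rat"

definition mpoly_vars :: "'e rat_mpoly \<Rightarrow> 'e set" where
  "mpoly_vars p = (\<Union>m\<in>Poly_Mapping.keys p. Poly_Mapping.keys m)"

definition mpoly_eval :: "'e rat_mpoly \<Rightarrow> ('e \<Rightarrow> rat) \<Rightarrow> rat" where
  "mpoly_eval p x = (\<Sum>m\<in>Poly_Mapping.keys p. Poly_Mapping.lookup p m * (\<Prod>e\<in>Poly_Mapping.keys m. x e ^ Poly_Mapping.lookup m e))"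

text \<open>
  A finite intersection of rational half-spaces through the origin; it is automatically closed
  and convex.
\<close>

definition rational_polyhedral_cone :: "'e set \<Rightarrow> ('e \<Rightarrow> real) set \<Rightarrow> bool" where
  "rational_polyhedral_cone E C \<longleftrightarrow> (\<exists>A :: ('e \<Rightarrow> rat) set. finite A \<and>
     C = {x \<in> E \<rightarrow>\<^sub>E UNIV. \<forall>a\<in>A. 0 \<le> (\<Sum>e\<in>E. of_rat (a e) * x e)})"

definition full_dimensional :: "'e set \<Rightarrow> ('e \<Rightarrow> real) set \<Rightarrow> bool" where
  "full_dimensional E C \<longleftrightarrow> powertop_real E interior_of C \<noteq> {}"

text \<open>
  The cones \<open>C i\<close> and the polynomials \<open>p i\<close>, for \<open>i < m\<close>, exhibit \<open>f\<close>, a function on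
  positive integer vectors indexed by \<open>E\<close>, as a piecewise-defined polynomial.
\<close>

definition piecewise_polynomial ::
    "'e set \<Rightarrow> (('e \<Rightarrow> int) \<Rightarrow> nat) \<Rightarrow> nat \<Rightarrow> (nat \<Rightarrow> ('e \<Rightarrow> real) set) \<Rightarrow> (nat \<Rightarrow> 'e rat_mpoly) \<Rightarrow> bool"
  where
  "piecewise_polynomial E f m C p \<longleftrightarrow>
     (\<forall>i<m. rational_polyhedral_cone E (C i) \<and> full_dimensional E (C i)) \<and>
     (\<Union>i<m. C i) = E \<rightarrow>\<^sub>E {0..} \<and>
     (\<forall>i<m. mpoly_vars (p i) \<subseteq> E) \<and>
     (\<forall>i<m. \<forall>k \<in> E \<rightarrow>\<^sub>E {0<..}. (\<lambda>e\<in>E. real_of_int (k e)) \<in> C i \<longrightarrow>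
        of_nat (f k) = mpoly_eval (p i) (\<lambda>e. of_int (k e)))"

end

theory Submission
  imports
    Defs
    "HOL-Library.Function_Algebras"
    "HOL-Computational_Algebra.Polynomial"
begin

text \<open>
  A nowhere-zero flow is positive along exactly one orientation, and that orientation is totally cyclic.
  So the flow count is a sum over the totally cyclic orientations \<open>S\<close> of the number of circulations strictly
  inside a box, \<open>0 < x e < k e\<close> along \<open>S\<close> (\<open>flow_count_eq\<close>), and the weighted count of the theorem is the
  sum over the same orientations of the numbers for the closed boxes, \<open>0 \<le> x e \<le> k e\<close>
  (\<open>weighted_count_eq\<close>). For each orientation there is to show that the open count is a polynomial on
  each cone of a fan and that, up to the sign, this polynomial at \<open>- k\<close> is the closed count.

  Both are counts of points of the lattice \<open>L\<close> of circulations, \<open>z + n \<ge> 0\<close>, where the vector \<open>n\<close> has two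
  coordinates for each edge, one for each bound. They are values of the vector partition function of
  \<open>\<int>\<^sup>J / L\<close>, and the argument follows Dahmen and Micchelli. Let \<open>lattice_count B n\<close> be the count
  with the bounds in \<open>J - B\<close> turned into equations. Lowering \<open>n j\<close> by \<open>1\<close> loses precisely the points that
  lie on that bound, so the difference of \<open>lattice_count B\<close> in direction \<open>j\<close> is \<open>lattice_count (B - {j})\<close>.
  Unless \<open>B\<close> spans, the count is zero inside the chambers that the walls cut out. Hence
  sufficiently many differences vanish, and far inside a chamber the count is a polynomial. The function
  \<open>extrapolation B\<close> continues this polynomial to all \<open>n\<close> and satisfies the same recursion everywhere. The
  only use of unimodularity is that a spanning set of columns generates the whole lattice
  \<open>\<int>\<^sup>J / L\<close>; for graphs this holds because a circulation can be prescribed on the edges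
  outside of any connected spanning subgraph.

  Two facts carry the proof. First, count and extrapolation agree at the integral part of each real vector
  of the chamber (\<open>lattice_count_eq_extrapolation\<close>), as is seen by walking deep into the chamber along
  coordinate directions. Since a small perturbation leaves an integral part unchanged, or lowers it
  by \<open>1\<close>, this covers the closed boxes (\<open>lattice_count_boundary\<close>) and the open ones
  (\<open>lattice_count_interior\<close>), also for vectors on the walls. Second, \<open>extrapolation B n\<close> and
  \<open>extrapolation B (- n - indic B)\<close> agree up to the sign (\<open>extrapolation_reciprocity\<close>): they satisfy
  the same recursion, so their difference is constant, and they have a common zero.

  It remains to pass from one orientation to the graph and to arbitrary decompositions into cones. All walls, restricted
  to the box sizes \<open>k\<close>, form an arrangement whose closed chambers are the required fan
  (\<open>piecewise_polynomial_of_sign_cones\<close>). A full-dimensional cone of any other decomposition contains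
  enough integer points near the ray through \<open>k\<close> that lie in a single chamber of the arrangement, so that the
  polynomials take the same value at \<open>- k\<close> (\<open>piecewise_polynomial_reflection\<close>).
\<close>


section \<open>Polynomial extrapolation of sequences\<close>

lemma poly_gbinomial: "\<exists>q :: rat poly. \<forall>x. poly q x = x gchoose i"
proof
  show "\<forall>x. poly (smult (1 / fact i) (\<Prod>j<i. [:- of_nat j, 1:])) x = x gchoose i"
    by (simp add: gbinomial_prod_rev poly_prod atLeast0LessThan)
qed

lemma poly_eqI_eventually:
  fixes p q :: "rat poly"
  assumes "\<forall>\<^sub>F m in sequentially. poly p (of_nat m) = poly q (of_nat m)"
  shows "p = q"
proof (rule ccontr)
  assume "p \<noteq> q"
  then have fin: "finite {x. poly (p - q) x = 0}"
    by (intro poly_roots_finite) simp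
  obtain M where M: "poly p (of_nat m) = poly q (of_nat m)" if "m \<ge> M" for m
    using assms by (auto simp: eventually_sequentially)
  have "of_nat ` {M..} \<subseteq> {x. poly (p - q) x = 0}"
    using M by auto
  then have "finite (of_nat ` {M..} :: rat set)"
    using fin finite_subset by blast
  then have "finite {M..}"
    by (rule finite_imageD) (auto simp: inj_on_def)
  then show False
    using infinite_Ici by blast
qed

text \<open>
  A sequence that is eventually polynomial in its index is continued by that polynomial down to index
  \<open>0\<close>, whatever its own value there.
\<close>

definition extrapolates_to :: "(nat \<Rightarrow> rat) \<Rightarrow> rat \<Rightarrow> bool" where
  "extrapolates_to s x \<longleftrightarrow>
     (\<exists>q. (\<forall>\<^sub>F m in sequentially. s m = poly q (of_nat m)) \<and> poly q 0 = x)"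

lemma extrapolates_to_unique:
  assumes "extrapolates_to s x" "extrapolates_to s y"
  shows "x = y"
proof -
  obtain p q where p: "\<forall>\<^sub>F m in sequentially. s m = poly p (of_nat m)" "poly p 0 = x"
    and q: "\<forall>\<^sub>F m in sequentially. s m = poly q (of_nat m)" "poly q 0 = y"
    using assms by (auto simp: extrapolates_to_def)
  have "\<forall>\<^sub>F m in sequentially. poly p (of_nat m) = poly q (of_nat m)"
    using p(1) q(1) by eventually_elim simp
  then show ?thesis
    using p(2) q(2) poly_eqI_eventually by blast
qed

lemma extrapolates_to_add:
  assumes "extrapolates_to s x" "extrapolates_to t y"
  shows "extrapolates_to (\<lambda>m. s m + t m) (x + y)"
proof -
  obtain p q where p: "\<forall>\<^sub>F m in sequentially. s m = poly p (of_nat m)" "poly p 0 = x"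
    and q: "\<forall>\<^sub>F m in sequentially. t m = poly q (of_nat m)" "poly q 0 = y"
    using assms by (auto simp: extrapolates_to_def)
  have "\<forall>\<^sub>F m in sequentially. s m + t m = poly (p + q) (of_nat m)"
    using p(1) q(1) by eventually_elim simp
  then show ?thesis
    using p(2) q(2) by (auto simp: extrapolates_to_def intro!: exI[of _ "p + q"])
qed

lemma extrapolates_to_zero:
  assumes "\<forall>\<^sub>F m in sequentially. s m = 0"
  shows "extrapolates_to s 0"
  using assms by (auto simp: extrapolates_to_def intro!: exI[of _ 0])

text \<open>
  Newton interpolation on the whole of \<open>\<int>\<close>: both sides have the same first difference, by Pascal's
  rule and induction on \<open>D\<close>, and they agree at \<open>0\<close>.
\<close>

lemma newton_int:
  fixes F :: "int \<Rightarrow> rat"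
  assumes "\<And>x. ((\<lambda>g x. g (x + 1) - g x) ^^ D) F x = 0"
  shows "F x = (\<Sum>i<D. (of_int x gchoose i) * ((\<lambda>g x. g (x + 1) - g x) ^^ i) F 0)"
  using assms
proof (induction D arbitrary: F x)
  case 0
  then show ?case by simp
next
  case (Suc D)
  let ?\<Delta> = "\<lambda>(g :: int \<Rightarrow> rat) x. g (x + 1) - g x"
  define N where "N = (\<lambda>x :: int. \<Sum>i<Suc D. (of_int x gchoose i) * (?\<Delta> ^^ i) F 0)"
  have \<Delta>F: "F (y + 1) - F y = (\<Sum>i<D. (of_int y gchoose i) * (?\<Delta> ^^ Suc i) F 0)" for y
    using Suc.IH[of "?\<Delta> F" y] Suc.prems by (simp add: funpow_swap1 del: funpow.simps add: funpow_Suc_right)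
  have split: "N y = F 0 + (\<Sum>i<D. (of_int y gchoose Suc i) * (?\<Delta> ^^ Suc i) F 0)" for y
    unfolding N_def by (subst sum.lessThan_Suc_shift) simp
  have pascal: "(1 + a) gchoose Suc i = (a gchoose i) + (a gchoose Suc i)" for a :: rat and i
    using gbinomial_Suc_Suc[of a i] by (simp add: add.commute)
  have \<Delta>N: "N (y + 1) - N y = F (y + 1) - F y" for y
    unfolding split \<Delta>F by (simp add: pascal algebra_simps sum.distrib del: funpow.simps)
  have "F x - N x = 0"
  proof (induction x rule: int_induct[where k = 0])
    case base
    show ?case by (simp add: split)
  next
    case (step1 i)
    then show ?case using \<Delta>N[of i] by simp
  next
    case (step2 i)
    then show ?case using \<Delta>N[of "i - 1"] by simp
  qed
  then show ?case by (simp add: N_def)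
qed

section \<open>Functions with vanishing iterated differences\<close>

definition dot :: "'j set \<Rightarrow> ('j \<Rightarrow> int) \<Rightarrow> ('j \<Rightarrow> 'a::ring_1) \<Rightarrow> 'a" where
  "dot J l y = (\<Sum>j\<in>J. of_int (l j) * y j)"

lemma dot_add: "dot J l (\<lambda>j. x j + y j) = dot J l x + dot J l y"
  by (simp add: dot_def algebra_simps sum.distrib)

lemma dot_plus: "dot J l (x + y) = dot J l x + dot J l y"
  by (simp add: dot_def algebra_simps sum.distrib)

lemma dot_scale: "dot J l (\<lambda>j. c * y j) = c * dot J l (y :: _ \<Rightarrow> 'a::comm_ring_1)"
  by (simp add: dot_def algebra_simps sum_distrib_left)

lemma dot_of_int: "dot J l (\<lambda>j. of_int (n j)) = of_int (dot J l n)"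
  by (simp add: dot_def)

text \<open>
  The integer points far inside the cone on which all forms in \<open>\<L>\<close> are positive. With \<open>\<L> = {}\<close> every
  point is deep, so that the notions below specialise to statements about all integer points.
\<close>

definition deep :: "'j set \<Rightarrow> ('j \<Rightarrow> int) set \<Rightarrow> int \<Rightarrow> ('j \<Rightarrow> int) \<Rightarrow> bool" where
  "deep J \<L> \<rho> n \<longleftrightarrow> (\<forall>l\<in>\<L>. \<rho> \<le> dot J l n)"

text \<open>
  All \<open>D\<close>-fold differences of \<open>h\<close> vanish far inside the cone, where how far may depend on the
  directions in which the differences are taken. This is the discrete form of being a polynomial of
  degree less than \<open>D\<close> there.
\<close>

primrec vanishing :: "'j set \<Rightarrow> ('j \<Rightarrow> int) set \<Rightarrow> nat \<Rightarrow> (('j \<Rightarrow> int) \<Rightarrow> rat) \<Rightarrow> bool" where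
  "vanishing J \<L> 0 h \<longleftrightarrow> (\<exists>\<rho>. \<forall>n. deep J \<L> \<rho> n \<longrightarrow> h n = 0)"
| "vanishing J \<L> (Suc D) h \<longleftrightarrow> (\<forall>v. vanishing J \<L> D (\<lambda>n. h (n + v) - h n))"

lemma deep_mono: "deep J \<L> \<rho> n \<Longrightarrow> \<rho>' \<le> \<rho> \<Longrightarrow> deep J \<L> \<rho>' n"
  by (fastforce simp: deep_def)

lemma deep_shift:
  assumes "finite \<L>"
  obtains K where "\<And>\<rho> n. deep J \<L> (\<rho> + K) n \<Longrightarrow> deep J \<L> \<rho> (n + v)"
proof
  let ?K = "\<Sum>l\<in>\<L>. \<bar>dot J l v\<bar>"
  fix \<rho> n assume "deep J \<L> (\<rho> + ?K) n"
  moreover have "\<bar>dot J l v\<bar> \<le> ?K" if "l \<in> \<L>" for l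
    using that assms by (intro member_le_sum) auto
  ultimately show "deep J \<L> \<rho> (n + v)"
    by (fastforce simp: deep_def dot_plus)
qed

lemma vanishing_add:
  "vanishing J \<L> D g \<Longrightarrow> vanishing J \<L> D h \<Longrightarrow> vanishing J \<L> D (\<lambda>n. g n + h n)"
proof (induction D arbitrary: g h)
  case 0
  then obtain a b where "\<forall>n. deep J \<L> a n \<longrightarrow> g n = 0" "\<forall>n. deep J \<L> b n \<longrightarrow> h n = 0"
    by auto
  then have "deep J \<L> (max a b) n \<longrightarrow> g n + h n = 0" for n
    using deep_mono[of J \<L> "max a b" n a] deep_mono[of J \<L> "max a b" n b] by simp
  then show ?case unfolding vanishing.simps by blast
next
  case (Suc D)
  have "vanishing J \<L> D (\<lambda>n. (g (n + v) - g n) + (h (n + v) - h n))" for v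
    using Suc by simp
  then show ?case by (simp add: algebra_simps)
qed

lemma vanishing_uminus: "vanishing J \<L> D h \<Longrightarrow> vanishing J \<L> D (\<lambda>n. - h n)"
proof (induction D arbitrary: h)
  case (Suc D)
  have "vanishing J \<L> D (\<lambda>n. h n - h (n + v))" for v
    using Suc.IH[of "\<lambda>n. h (n + v) - h n"] Suc.prems by simp
  then show ?case by simp
qed auto

lemma vanishing_shift:
  assumes "finite \<L>"
  shows "vanishing J \<L> D h \<Longrightarrow> vanishing J \<L> D (\<lambda>n. h (n + v))"
proof (induction D arbitrary: h)
  case 0
  then obtain \<rho> where \<rho>: "\<forall>n. deep J \<L> \<rho> n \<longrightarrow> h n = 0" by auto
  obtain K where "\<And>\<rho> n. deep J \<L> (\<rho> + K) n \<Longrightarrow> deep J \<L> \<rho> (n + v)"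
    using deep_shift[OF assms] by metis
  with \<rho> show ?case unfolding vanishing.simps by blast
next
  case (Suc D)
  have "vanishing J \<L> D (\<lambda>n. h ((n + v) + u) - h (n + v))" for u
    using Suc.IH[of "\<lambda>n. h (n + u) - h n"] Suc.prems
    by (simp only: vanishing.simps add.assoc add.commute[of u v])
  then show ?case by (simp only: vanishing.simps add.assoc add.commute[of v] simp_thms)
qed

lemma vanishing_zero: "vanishing J \<L> D (\<lambda>n. 0)"
  by (induction D) auto

lemma vanishing_Suc:
  assumes "finite \<L>"
  shows "vanishing J \<L> D h \<Longrightarrow> vanishing J \<L> (Suc D) h"
  using vanishing_add[OF vanishing_shift[OF assms] vanishing_uminus] by simp

lemma vanishing_le:
  assumes "finite \<L>" "vanishing J \<L> D h" "D \<le> D'"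
  shows "vanishing J \<L> D' h"
  using assms(3,2) by (induction D' rule: dec_induct) (auto intro: vanishing_Suc[OF assms(1), unfolded vanishing.simps] simp del: vanishing.simps(2) intro!: vanishing_Suc[OF assms(1)])

abbreviation ray :: "('j \<Rightarrow> int) \<Rightarrow> ('j \<Rightarrow> int) \<Rightarrow> nat \<Rightarrow> 'j \<Rightarrow> int" where
  "ray n w m \<equiv> (\<lambda>j. n j + int m * w j)"

text \<open>
  Deep points stay deep along a ray into the cone, so Newton's formula holds along the ray from its
  very start.
\<close>

lemma vanishing_newton:
  assumes "\<And>l. l \<in> \<L> \<Longrightarrow> dot J l w \<ge> 0" "vanishing J \<L> D h"
  shows "\<exists>\<rho>. \<forall>n. deep J \<L> \<rho> n \<longrightarrow>
    (\<exists>q. \<forall>m :: nat. h (ray n w m) = poly q (of_nat m))"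
proof -
  have "\<exists>\<rho>. \<forall>n. deep J \<L> \<rho> n \<longrightarrow>
    (\<exists>a. \<forall>m :: nat. h (ray n w m) = (\<Sum>i<D. a i * (of_nat m gchoose i)))"
    using assms(2)
  proof (induction D arbitrary: h)
    case 0
    then obtain \<rho> where \<rho>: "\<forall>n. deep J \<L> \<rho> n \<longrightarrow> h n = 0" by auto
    have "deep J \<L> \<rho> (ray n w m)" if "deep J \<L> \<rho> n" for n m
      unfolding deep_def
    proof
      fix l assume l: "l \<in> \<L>"
      have "0 \<le> int m * dot J l w" using assms(1)[OF l] by simp
      then show "\<rho> \<le> dot J l (ray n w m)"
        using that l by (fastforce simp: deep_def dot_add dot_scale)
    qed
    with \<rho> show ?case by fastforce
  next
    case (Suc D)
    then have "vanishing J \<L> D (\<lambda>n. h (n + w) - h n)" by simp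
    note Suc.IH[OF this]
    then obtain \<rho> where \<rho>: "\<And>n. deep J \<L> \<rho> n \<Longrightarrow>
       \<exists>a. \<forall>m :: nat. h ((ray n w m) + w) - h (ray n w m) = (\<Sum>i<D. a i * (of_nat m gchoose i))"
      by blast
    have "\<exists>a. \<forall>m :: nat. h (ray n w m) = (\<Sum>i<Suc D. a i * (of_nat m gchoose i))"
      if n: "deep J \<L> \<rho> n" for n
    proof -
      obtain a where a: "\<And>m :: nat. h ((ray n w m) + w) - h (ray n w m) = (\<Sum>i<D. a i * (of_nat m gchoose i))"
        using \<rho>[OF n] by blast
      have step: "(ray n w m) + w = (\<lambda>j. n j + int (Suc m) * w j)" for m
        by (auto simp: algebra_simps)
      define b where "b = (\<lambda>i. case i of 0 \<Rightarrow> h n | Suc i \<Rightarrow> a i)"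
      have "h (ray n w m) = h n + (\<Sum>i<D. a i * (of_nat m gchoose Suc i))" for m
      proof (induction m)
        case 0
        then show ?case by simp
      next
        case (Suc m)
        have "h (\<lambda>j. n j + int (Suc m) * w j) = h (ray n w m) + (\<Sum>i<D. a i * (of_nat m gchoose i))"
          using a[of m] unfolding step by simp
        also have "\<dots> = h n + (\<Sum>i<D. a i * (of_nat (Suc m) gchoose Suc i))"
          using gbinomial_Suc_Suc[of "of_nat m :: rat"]
          by (simp add: Suc.IH algebra_simps sum.distrib)
        finally show ?case .
      qed
      then have "h (ray n w m) = (\<Sum>i<Suc D. b i * (of_nat m gchoose i))" for m
        by (subst sum.lessThan_Suc_shift) (simp add: b_def)
      then show ?thesis by blast
    qed
    then show ?case by blast
  qed
  then obtain \<rho> where \<rho>: "\<And>n. deep J \<L> \<rho> n \<Longrightarrow>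
    \<exists>a. \<forall>m :: nat. h (ray n w m) = (\<Sum>i<D. a i * (of_nat m gchoose i))"
    by blast
  obtain B :: "nat \<Rightarrow> rat poly" where B: "\<And>i x. poly (B i) x = x gchoose i"
    using poly_gbinomial by metis
  have "\<exists>q. \<forall>m :: nat. h (ray n w m) = poly q (of_nat m)" if n: "deep J \<L> \<rho> n" for n
  proof -
    obtain a where "\<And>m :: nat. h (ray n w m) = (\<Sum>i<D. a i * (of_nat m gchoose i))"
      using \<rho>[OF n] by blast
    then show ?thesis
      by (intro exI[of _ "\<Sum>i<D. smult (a i) (B i)"]) (simp add: poly_sum B)
  qed
  then show ?thesis by blast
qed


section \<open>Lattice points of unimodular configurations\<close>

definition unit_vec :: "'j \<Rightarrow> 'j \<Rightarrow> int" where
  "unit_vec j = (\<lambda>i. if i = j then 1 else 0)"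

definition indic :: "'j set \<Rightarrow> 'j \<Rightarrow> int" where
  "indic A = (\<lambda>i. if i \<in> A then 1 else 0)"

text \<open>
  In other words, the restriction \<open>L \<rightarrow> \<int>\<^bsup>J - B\<^esup>\<close> is onto, or, equivalently, the unit vectors of \<open>B\<close>
  generate \<open>\<int>\<^sup>J / L\<close>.
\<close>

definition spans :: "'j set \<Rightarrow> ('j \<Rightarrow> int) set \<Rightarrow> 'j set \<Rightarrow> bool" where
  "spans J L B \<longleftrightarrow> B \<subseteq> J \<and> (\<forall>j\<in>J - B. \<exists>z\<in>L. z j = 1 \<and> (\<forall>i\<in>J - B - {j}. z i = 0))"

text \<open>
  The quotient \<open>\<int>\<^sup>J / L\<close> with the images of the unit vectors is a vector configuration. Assumption
  \<open>exchange\<close> is its unimodularity: if \<open>B\<close> spans and an element of \<open>L\<close> supported in \<open>B\<close> is nonzero at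
  \<open>j\<close>, then \<open>B - {j}\<close> spans over the reals, and it is required to span over the integers as well. The
  number \<open>r\<close> is the rank of the configuration, and \<open>finite_bounded\<close> says that it is pointed.
\<close>

locale unimodular_lattice =
  fixes J :: "'j set" and L :: "('j \<Rightarrow> int) set" and r :: nat
  assumes finite_J: "finite J"
    and zero_mem: "0 \<in> L"
    and add_mem: "y \<in> L \<Longrightarrow> z \<in> L \<Longrightarrow> y + z \<in> L"
    and uminus_mem: "z \<in> L \<Longrightarrow> - z \<in> L"
    and outside: "z \<in> L \<Longrightarrow> j \<notin> J \<Longrightarrow> z j = 0"
    and finite_bounded: "finite {z \<in> L. \<forall>j\<in>J. 0 \<le> z j + n j}"
    and exchange: "spans J L B \<Longrightarrow> z \<in> L \<Longrightarrow> (\<And>i. i \<in> J - B \<Longrightarrow> z i = 0) \<Longrightarrow>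
        j \<in> B \<Longrightarrow> z j \<noteq> 0 \<Longrightarrow> spans J L (B - {j})"
    and card_minimal: "spans J L B \<Longrightarrow> (\<And>j. j \<in> B \<Longrightarrow> \<not> spans J L (B - {j})) \<Longrightarrow> card B = r"
begin

lemma scale_nat_mem: "z \<in> L \<Longrightarrow> (\<lambda>j. int m * z j) \<in> L"
proof (induction m)
  case 0
  then show ?case using zero_mem by (simp add: zero_fun_def)
next
  case (Suc m)
  have "(\<lambda>j. int (Suc m) * z j) = (\<lambda>j. int m * z j) + z"
    by (auto simp: algebra_simps)
  then show ?case using Suc add_mem by simp
qed

lemma scale_mem: "z \<in> L \<Longrightarrow> (\<lambda>j. c * z j) \<in> L"
proof (cases "0 \<le> c")
  case True
  then show "z \<in> L \<Longrightarrow> ?thesis" using scale_nat_mem[of z "nat c"] by simp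
next
  case False
  have "(\<lambda>j. c * z j) = - (\<lambda>j. int (nat (- c)) * z j)"
    using False by auto
  then show "z \<in> L \<Longrightarrow> ?thesis" using uminus_mem[OF scale_nat_mem[of z "nat (- c)"]] by simp
qed

lemma pointed:
  assumes z: "z \<in> L" and nonneg: "\<And>j. j \<in> J \<Longrightarrow> 0 \<le> z j"
  shows "z = 0"
proof (rule ccontr)
  assume "z \<noteq> 0"
  then obtain j where j: "z j \<noteq> 0" by (auto simp: fun_eq_iff)
  have "inj (\<lambda>m j. int m * z j)"
  proof (rule injI)
    fix m m' assume "(\<lambda>j. int m * z j) = (\<lambda>j. int m' * z j)"
    then have "int m * z j = int m' * z j" by (rule fun_cong)
    then show "m = m'" using j by simp
  qed
  moreover have "range (\<lambda>m j. int m * z j) \<subseteq> {z \<in> L. \<forall>j\<in>J. 0 \<le> z j + 0 j}"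
    using scale_nat_mem[OF z] nonneg by auto
  ultimately show False
    using finite_bounded[of 0] by (meson finite_subset finite_imageD infinite_UNIV_nat)
qed

text \<open>
  The points of the translated lattice \<open>n + L\<close> that are nonnegative on \<open>B\<close> and vanish on \<open>J - B\<close>. They are
  the ways of writing the class of \<open>n\<close> in \<open>\<int>\<^sup>J / L\<close> as a nonnegative combination of the vectors in \<open>B\<close>,
  so \<open>lattice_count\<close> is the vector partition function of \<open>B\<close>.
\<close>

abbreviation points :: "'j set \<Rightarrow> ('j \<Rightarrow> int) \<Rightarrow> ('j \<Rightarrow> int) set" where
  "points B n \<equiv> {z \<in> L. (\<forall>j\<in>B. 0 \<le> z j + n j) \<and> (\<forall>j\<in>J - B. z j + n j = 0)}"

definition lattice_count :: "'j set \<Rightarrow> ('j \<Rightarrow> int) \<Rightarrow> nat" where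
  "lattice_count B n = card (points B n)"

lemma finite_lattice_count:
  "B \<subseteq> J \<Longrightarrow> finite (points B n)"
  by (rule finite_subset[OF _ finite_bounded[of n]]) force

text \<open>
  The points lost by lowering the bound at \<open>j\<close> are exactly those that lie on that bound. This is the
  recursion on which everything below rests.
\<close>

lemma lattice_count_step:
  assumes "B \<subseteq> J" "j \<in> B"
  shows "lattice_count B n = lattice_count B (n - unit_vec j) + lattice_count (B - {j}) n"
proof -
  let ?S = "\<lambda>B n. (points B n)"
  have "?S B n = ?S B (n - unit_vec j) \<union> ?S (B - {j}) n"
  proof (intro equalityI subsetI)
    fix z assume z: "z \<in> ?S B n"
    show "z \<in> ?S B (n - unit_vec j) \<union> ?S (B - {j}) n"
    proof (cases "z j + n j = 0")
      case True
      then show ?thesis using z by auto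
    next
      case False
      then have "1 \<le> z j + n j" using z assms(2) by fastforce
      then show ?thesis using z assms by (auto simp: unit_vec_def)
    qed
  next
    fix z assume "z \<in> ?S B (n - unit_vec j) \<union> ?S (B - {j}) n"
    then show "z \<in> ?S B n"
    proof
      assume z: "z \<in> ?S B (n - unit_vec j)"
      have "0 \<le> z i + n i" if "i \<in> B" for i
      proof -
        have "0 \<le> z i + (n - unit_vec j) i" using z that by blast
        then show ?thesis by (auto simp: unit_vec_def split: if_splits)
      qed
      moreover have "z i + n i = 0" if "i \<in> J - B" for i
      proof -
        have "z i + (n - unit_vec j) i = 0" using z that by blast
        then show ?thesis using that assms by (auto simp: unit_vec_def split: if_splits)
      qed
      ultimately show ?thesis using z by blast
    next
      assume z: "z \<in> ?S (B - {j}) n"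
      then have "z j + n j = 0" using assms by blast
      then show ?thesis using z by force
    qed
  qed
  moreover have "?S B (n - unit_vec j) \<inter> ?S (B - {j}) n = {}"
    using assms by (force simp: unit_vec_def)
  moreover have "B - {j} \<subseteq> J" using assms(1) by blast
  ultimately show ?thesis
    unfolding lattice_count_def
    using card_Un_disjoint[OF finite_lattice_count[OF assms(1)] finite_lattice_count] by simp
qed

lemma lattice_count_translate:
  assumes "z \<in> L"
  shows "lattice_count B (n + z) = lattice_count B n"
  unfolding lattice_count_def
proof (rule bij_betw_same_card[of "\<lambda>x. x + z"], rule bij_betw_imageI)
  show "inj_on (\<lambda>x. x + z) {x \<in> L. (\<forall>j\<in>B. 0 \<le> x j + (n + z) j) \<and> (\<forall>j\<in>J - B. x j + (n + z) j = 0)}"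
    by (auto simp: inj_on_def fun_eq_iff)
  show "(\<lambda>x. x + z) ` {x \<in> L. (\<forall>j\<in>B. 0 \<le> x j + (n + z) j) \<and> (\<forall>j\<in>J - B. x j + (n + z) j = 0)}
      = (points B n)"
  proof (intro equalityI subsetI)
    fix x assume x: "x \<in> (points B n)"
    have "x = (x + - z) + z" by auto
    moreover have "x + - z \<in> {x \<in> L. (\<forall>j\<in>B. 0 \<le> x j + (n + z) j) \<and> (\<forall>j\<in>J - B. x j + (n + z) j = 0)}"
      using x add_mem[OF _ uminus_mem[OF assms]] by auto
    ultimately show "x \<in> (\<lambda>x. x + z) ` {x \<in> L. (\<forall>j\<in>B. 0 \<le> x j + (n + z) j) \<and> (\<forall>j\<in>J - B. x j + (n + z) j = 0)}"
      by blast
  qed (use add_mem assms in \<open>auto simp: algebra_simps\<close>)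
qed

lemma lattice_count_cong:
  "(\<And>j. j \<in> J \<Longrightarrow> n j = n' j) \<Longrightarrow> B \<subseteq> J \<Longrightarrow> lattice_count B n = lattice_count B n'"
  unfolding lattice_count_def by (rule arg_cong[where f = card]) (auto simp: subset_iff)

text \<open>
  The induction principle behind the definition of \<open>spans\<close>: a subgroup of \<open>\<int>\<^sup>J\<close> that contains \<open>L\<close> and the
  unit vectors of a spanning set is everything.
\<close>

lemma spans_generates:
  assumes "spans J L B"
    and add: "\<And>u v. u \<in> H \<Longrightarrow> v \<in> H \<Longrightarrow> u + v \<in> H"
    and uminus: "\<And>v. v \<in> H \<Longrightarrow> - v \<in> H"
    and outside_H: "\<And>v. (\<And>j. j \<in> J \<Longrightarrow> v j = 0) \<Longrightarrow> v \<in> H"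
    and unit_H: "\<And>j. j \<in> B \<Longrightarrow> unit_vec j \<in> H"
    and L_H: "L \<subseteq> H"
  shows "v \<in> H"
proof -
  have scale_nat: "(\<lambda>i. int m * u i) \<in> H" if "u \<in> H" for u m
  proof (induction m)
    case 0
    show ?case using outside_H by simp
  next
    case (Suc m)
    have "(\<lambda>i. int (Suc m) * u i) = (\<lambda>i. int m * u i) + u" by (auto simp: algebra_simps)
    then show ?case using add[OF Suc that] by simp
  qed
  have scale: "(\<lambda>i. c * u i) \<in> H" if "u \<in> H" for u c
  proof (cases "0 \<le> c")
    case True
    then show ?thesis using scale_nat[OF that, of "nat c"] by simp
  next
    case False
    then have "(\<lambda>i. c * u i) = - (\<lambda>i. int (nat (- c)) * u i)" by auto
    then show ?thesis using uminus[OF scale_nat[OF that, of "nat (- c)"]] by simp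
  qed
  have combine: "v \<in> H" if "finite A" "\<And>j. j \<in> A \<Longrightarrow> unit_vec j \<in> H" "\<And>j. j \<in> J - A \<Longrightarrow> v j = 0" for A v
    using that
  proof (induction A arbitrary: v rule: finite_induct)
    case empty
    then show ?case using outside_H by simp
  next
    case (insert a A)
    have "(\<lambda>i. if i = a then 0 else v i) \<in> H"
    proof (rule insert.IH)
      show "unit_vec j \<in> H" if "j \<in> A" for j
        using insert.prems(1)[of j] that by blast
      show "(if j = a then 0 else v j) = 0" if "j \<in> J - A" for j
        using insert.prems(2)[of j] that by auto
    qed
    moreover have "v = (\<lambda>i. if i = a then 0 else v i) + (\<lambda>i. v a * unit_vec a i)"
      by (auto simp: unit_vec_def)
    moreover have "(\<lambda>i. v a * unit_vec a i) \<in> H"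
      using insert.prems(1)[of a] by (intro scale) simp
    ultimately show ?case
      using add[of "\<lambda>i. if i = a then 0 else v i" "\<lambda>i. v a * unit_vec a i"] by simp
  qed
  have finB: "finite B" using assms(1) finite_J finite_subset by (auto simp: spans_def)
  have "unit_vec j \<in> H" if "j \<in> J" for j
  proof (cases "j \<in> B")
    case False
    then obtain z where z: "z \<in> L" "z j = 1" "\<forall>i\<in>J - B - {j}. z i = 0"
      using assms(1) \<open>j \<in> J\<close> unfolding spans_def by blast
    have "unit_vec j - z \<in> H"
      using z by (intro combine[OF finB unit_H]) (auto simp: unit_vec_def)
    then show ?thesis using add[of "unit_vec j - z" z] z(1) L_H by auto
  qed (use unit_H in auto)
  then show ?thesis using combine[OF finite_J, of v] by simp
qed

lemma decompose:
  assumes "spans J L B"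
  obtains u z where "z \<in> L" "v = u + z" "\<And>i. i \<in> J - B \<Longrightarrow> u i = 0"
proof -
  let ?H = "{v. \<exists>z\<in>L. \<forall>i\<in>J - B. v i = z i}"
  have "v \<in> ?H"
  proof (rule spans_generates[OF assms])
    fix u v assume "u \<in> ?H" "v \<in> ?H"
    then obtain y z where "y \<in> L" "z \<in> L" "\<forall>i\<in>J - B. u i = y i" "\<forall>i\<in>J - B. v i = z i" by auto
    then show "u + v \<in> ?H"
      using add_mem[of y z] by (intro CollectI bexI[of _ "y + z"]) simp_all
  next
    fix v assume "v \<in> ?H"
    then obtain z where "z \<in> L" "\<forall>i\<in>J - B. v i = z i" by auto
    then show "- v \<in> ?H"
      using uminus_mem[of z] by (intro CollectI bexI[of _ "- z"]) simp_all
  next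
    fix v assume "\<And>j. j \<in> J \<Longrightarrow> v j = (0::int)"
    then show "v \<in> ?H"
      using zero_mem by (intro CollectI bexI[of _ 0]) simp_all
  next
    fix j assume "j \<in> B"
    then have "\<forall>i\<in>J - B. unit_vec j i = 0" by (auto simp: unit_vec_def)
    then show "unit_vec j \<in> ?H"
      using zero_mem by (intro CollectI bexI[of _ 0]) simp_all
  next
    show "L \<subseteq> ?H" by blast
  qed
  then obtain z where "z \<in> L" "\<forall>i\<in>J - B. v i = z i" by auto
  then show thesis using that[of z "v - z"] by auto
qed

text \<open>
  The directions in which the difference of \<open>h\<close> has vanishing \<open>D\<close>-fold differences form a subgroup, and by
  invariance it contains \<open>L\<close>.
\<close>

lemma vanishing_Suc_spans:
  assumes "finite \<L>" "spans J L B"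
    and step: "\<And>j. j \<in> B \<Longrightarrow> vanishing J \<L> D (\<lambda>n. h (n + unit_vec j) - h n)"
    and transl: "\<And>n z. z \<in> L \<Longrightarrow> h (n + z) = h n"
    and cong: "\<And>n n'. (\<And>j. j \<in> J \<Longrightarrow> n j = n' j) \<Longrightarrow> h n = h n'"
  shows "vanishing J \<L> (Suc D) h"
proof -
  let ?H = "{v. vanishing J \<L> D (\<lambda>n. h (n + v) - h n)}"
  have "v \<in> ?H" for v
  proof (rule spans_generates[OF assms(2)])
    fix u v assume "u \<in> ?H"
      "v \<in> ?H"
    then have "vanishing J \<L> D (\<lambda>n. h (n + u) - h n)" "vanishing J \<L> D (\<lambda>n. h (n + v) - h n)"
      by auto
    then have "vanishing J \<L> D (\<lambda>n. (h (n + u + v) - h (n + u)) + (h (n + u) - h n))"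
      using vanishing_add vanishing_shift[OF assms(1), of J D "\<lambda>n. h (n + v) - h n" u] by blast
    moreover have "(\<lambda>n. (h (n + u + v) - h (n + u)) + (h (n + u) - h n)) = (\<lambda>n. h (n + (u + v)) - h n)"
      by (simp add: add.assoc)
    ultimately show "u + v \<in> ?H" by simp
  next
    fix v assume "v \<in> ?H"
    then have "vanishing J \<L> D (\<lambda>n. - (h (n + - v + v) - h (n + - v)))"
      using vanishing_shift[OF assms(1), of J D "\<lambda>n. h (n + v) - h n" "- v"] vanishing_uminus by blast
    moreover have "n + - v + v = n" for n by (rule ext) simp
    ultimately show "- v \<in> ?H" by simp
  next
    fix v :: "'j \<Rightarrow> int" assume "\<And>j. j \<in> J \<Longrightarrow> v j = 0"
    then have "h (n + v) = h n" for n by (intro cong) simp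
    then show "v \<in> ?H"
      by (simp add: vanishing_zero)
  qed (use step transl vanishing_zero in auto)
  then show ?thesis by simp
qed

end

section \<open>Chambers and extrapolated counts\<close>

text \<open>
  The forms in \<open>\<L>\<close> cut out an open cone of real vectors, invariant under \<open>L\<close>, that contains \<open>W\<close>.
  Assumption \<open>separates\<close> puts the real span of each nonspanning set on a wall, so the cone does not meet
  it.
\<close>

locale unimodular_chamber = unimodular_lattice J L r
  for J :: "'j set" and L r +
  fixes \<L> :: "('j \<Rightarrow> int) set" and W :: "'j \<Rightarrow> int"
  assumes finite_\<L>: "finite \<L>"
    and annihilates: "l \<in> \<L> \<Longrightarrow> z \<in> L \<Longrightarrow> dot J l z = 0"
    and separates: "B \<subseteq> J \<Longrightarrow> \<not> spans J L B \<Longrightarrow> \<exists>l\<in>\<L>. \<forall>j\<in>B. l j = 0"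
    and W_pos: "l \<in> \<L> \<Longrightarrow> 0 < dot J l W"
begin

definition chamber :: "('j \<Rightarrow> real) set" where
  "chamber = {y. \<forall>l\<in>\<L>. 0 < dot J l y}"

lemma annihilates_real: "l \<in> \<L> \<Longrightarrow> z \<in> L \<Longrightarrow> dot J l (\<lambda>j. real_of_int (z j)) = 0"
  using annihilates by (simp add: dot_of_int)

text \<open>
  A point counted by a nonspanning \<open>B\<close> would put \<open>y\<close> into the span of \<open>B\<close> and of \<open>L\<close>, where one of the
  forms vanishes.
\<close>

lemma lattice_count_nonspanning:
  assumes "B \<subseteq> J" "\<not> spans J L B" "y \<in> chamber" "\<And>j. j \<in> J - B \<Longrightarrow> y j \<in> \<int>"
  shows "lattice_count B (\<lambda>j. \<lfloor>y j\<rfloor>) = 0"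
proof -
  obtain l where l: "l \<in> \<L>" "\<forall>j\<in>B. l j = 0" using separates assms by blast
  have False if z: "z \<in> L" "\<forall>j\<in>J - B. z j + \<lfloor>y j\<rfloor> = 0" for z
  proof -
    have "real_of_int (l j) * y j = - (real_of_int (l j) * real_of_int (z j))" if "j \<in> J" for j
    proof (cases "j \<in> B")
      case False
      then have "y j = of_int \<lfloor>y j\<rfloor>" using assms(4) that by (metis DiffI Ints_cases floor_of_int)
      moreover have "\<lfloor>y j\<rfloor> = - z j" using z(2) False that by (metis DiffI add.commute eq_neg_iff_add_eq_0)
      ultimately show ?thesis by simp
    qed (use l in auto)
    then have "dot J l y = - dot J l (\<lambda>j. real_of_int (z j))"
      by (simp add: dot_def sum_negf)
    then show False using annihilates_real[OF l(1) z(1)] assms(3) l(1) by (fastforce simp: chamber_def)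
  qed
  then have "{z \<in> L. (\<forall>j\<in>B. 0 \<le> z j + \<lfloor>y j\<rfloor>) \<and> (\<forall>j\<in>J - B. z j + \<lfloor>y j\<rfloor> = 0)} = {}"
    by blast
  then show ?thesis unfolding lattice_count_def by (simp only: card.empty)
qed

lemma lattice_count_nonspanning_int:
  assumes "B \<subseteq> J" "\<not> spans J L B" "deep J \<L> 1 n"
  shows "lattice_count B n = 0"
  using lattice_count_nonspanning[of B "\<lambda>j. real_of_int (n j)"] assms
  by (fastforce simp: chamber_def deep_def dot_of_int)

text \<open>
  Each difference in the direction of an element of \<open>B\<close> removes that element, and once the remaining
  set no longer spans, the count is zero inside the chamber.
\<close>

lemma vanishing_lattice_count:
  "B \<subseteq> J \<Longrightarrow> vanishing J \<L> (Suc (card B)) (\<lambda>n. of_nat (lattice_count B n))"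
proof (induction "card B" arbitrary: B rule: less_induct)
  case less
  show ?case
  proof (cases "spans J L B")
    case True
    have "vanishing J \<L> (card B) (\<lambda>n. of_nat (lattice_count B (n + unit_vec j)) - of_nat (lattice_count B n))"
      if j: "j \<in> B" for j
    proof -
      have finB: "finite B" using finite_J finite_subset less.prems by blast
      have "vanishing J \<L> (card B) (\<lambda>n. of_nat (lattice_count (B - {j}) n))"
        using less.hyps[of "B - {j}"] less.prems card_Suc_Diff1[OF finB j] card_Diff1_less[OF finB j] by auto
      then have "vanishing J \<L> (card B) (\<lambda>n. of_nat (lattice_count (B - {j}) (n + unit_vec j)))"
        by (rule vanishing_shift[OF finite_\<L>])
      moreover have "of_nat (lattice_count B (n + unit_vec j)) - of_nat (lattice_count B n)
          = (of_nat (lattice_count (B - {j}) (n + unit_vec j)) :: rat)" for n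
        using lattice_count_step[OF less.prems j, of "n + unit_vec j"] by (simp add: algebra_simps)
      ultimately show ?thesis by simp
    qed
    then show ?thesis
      using less.prems by (intro vanishing_Suc_spans[OF finite_\<L> True])
        (auto intro: lattice_count_translate lattice_count_cong)
  next
    case False
    then have "vanishing J \<L> 0 (\<lambda>n. of_nat (lattice_count B n))"
      using lattice_count_nonspanning_int less.prems by auto
    then show ?thesis by (rule vanishing_le[OF finite_\<L>]) simp
  qed
qed

text \<open>
  The polynomial by which the count is given far inside the chamber, evaluated at an arbitrary \<open>n\<close>: the
  values at \<open>n + m W\<close> for large \<open>m\<close> are continued back to \<open>m = 0\<close>.
\<close>

definition extrapolation :: "'j set \<Rightarrow> ('j \<Rightarrow> int) \<Rightarrow> rat" where
  "extrapolation B n = (THE x. extrapolates_to (\<lambda>m. of_nat (lattice_count B (ray n W m))) x)"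

lemma ray_reaches_deep: "\<exists>m0 :: nat. \<forall>m\<ge>m0. deep J \<L> \<rho> (ray n W m)"
proof -
  define m0 where "m0 = nat (\<Sum>l\<in>\<L>. \<bar>\<rho> - dot J l n\<bar>)"
  have "\<rho> \<le> dot J l (ray n W m)" if "m0 \<le> m" "l \<in> \<L>" for m l
  proof -
    have "\<bar>\<rho> - dot J l n\<bar> \<le> (\<Sum>l\<in>\<L>. \<bar>\<rho> - dot J l n\<bar>)"
      using that finite_\<L> by (intro member_le_sum) auto
    then have "\<rho> - dot J l n \<le> int m" using that(1) by (simp add: m0_def)
    also have "\<dots> \<le> int m * dot J l W" using W_pos[OF that(2)] mult_left_mono[of 1 "dot J l W" "int m"] by simp
    finally show ?thesis by (simp add: dot_add dot_scale)
  qed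
  then show ?thesis by (auto simp: deep_def)
qed

lemma ray_polynomial:
  assumes "B \<subseteq> J"
  shows "\<exists>\<rho>. \<forall>n. deep J \<L> \<rho> n \<longrightarrow>
    (\<exists>q. \<forall>m :: nat. of_nat (lattice_count B (ray n W m)) = poly q (of_nat m :: rat))"
  using vanishing_newton[OF _ vanishing_lattice_count[OF assms], of W] W_pos by fastforce

lemma extrapolates_to_extrapolation:
  assumes "B \<subseteq> J"
  shows "extrapolates_to (\<lambda>m. of_nat (lattice_count B (ray n W m))) (extrapolation B n)"
proof -
  obtain \<rho> where \<rho>: "\<And>n. deep J \<L> \<rho> n \<Longrightarrow>
    \<exists>q. \<forall>m :: nat. of_nat (lattice_count B (ray n W m)) = poly q (of_nat m :: rat)"
    using ray_polynomial[OF assms] by blast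
  obtain m0 where "deep J \<L> \<rho> (\<lambda>j. n j + int m0 * W j)"
    using ray_reaches_deep by blast
  from \<rho>[OF this] obtain q where q: "\<And>m :: nat.
      of_nat (lattice_count B (\<lambda>j. (n j + int m0 * W j) + int m * W j)) = poly q (of_nat m :: rat)" by blast
  have "of_nat (lattice_count B (ray n W m)) = poly (pcompose q [:- of_nat m0, 1:]) (of_nat m :: rat)"
    if "m0 \<le> m" for m
    proof -
    have "(\<lambda>j. (n j + int m0 * W j) + int (m - m0) * W j) = (ray n W m)"
      using that by (simp add: of_nat_diff left_diff_distrib)
    then show ?thesis
      using q[of "m - m0"] that by (simp add: poly_pcompose of_nat_diff)
  qed
  then have "extrapolates_to (\<lambda>m. of_nat (lattice_count B (ray n W m))) (poly (pcompose q [:- of_nat m0, 1:]) 0)"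
    unfolding extrapolates_to_def eventually_sequentially by blast
  note ext = this
  show ?thesis
    unfolding extrapolation_def by (rule theI, rule ext) (rule extrapolates_to_unique[OF _ ext])
qed

lemma extrapolation_eqI:
  "B \<subseteq> J \<Longrightarrow> extrapolates_to (\<lambda>m. of_nat (lattice_count B (ray n W m))) x \<Longrightarrow> extrapolation B n = x"
  using extrapolates_to_extrapolation extrapolates_to_unique by blast

text \<open>
  Extrapolation is additive, so it inherits the recursion of the count, now without any exception near
  the walls.
\<close>

lemma extrapolation_step:
  assumes "B \<subseteq> J" "j \<in> B"
  shows "extrapolation B n = extrapolation B (n - unit_vec j) + extrapolation (B - {j}) n"
proof (rule extrapolation_eqI[OF assms(1)])
  have "B - {j} \<subseteq> J" using assms(1) by blast
  note sum = extrapolates_to_add[OF extrapolates_to_extrapolation[OF assms(1), of "n - unit_vec j"] extrapolates_to_extrapolation[OF this, of n]]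
  have ray: "(\<lambda>i. n i + int m * W i) - unit_vec j = (\<lambda>i. (n - unit_vec j) i + int m * W i)" for m
    by auto
  have "rat_of_nat (lattice_count B (\<lambda>i. n i + int m * W i)) =
      of_nat (lattice_count B (\<lambda>i. (n - unit_vec j) i + int m * W i)) +
      of_nat (lattice_count (B - {j}) (\<lambda>i. n i + int m * W i))" for m
    using lattice_count_step[OF assms, of "\<lambda>i. n i + int m * W i"] unfolding ray by (simp only: of_nat_add)
  with sum show "extrapolates_to (\<lambda>m. of_nat (lattice_count B (ray n W m)))
     (extrapolation B (n - unit_vec j) + extrapolation (B - {j}) n)"
    by (simp only:)
qed

lemma extrapolation_translate:
  assumes "B \<subseteq> J" "z \<in> L"
  shows "extrapolation B (n + z) = extrapolation B n"
proof -
  have "(\<lambda>j. (n + z) j + int m * W j) = (ray n W m) + z" for m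
    by auto
  then have "lattice_count B (\<lambda>j. (n + z) j + int m * W j) = lattice_count B (ray n W m)" for m
    using lattice_count_translate[OF assms(2)] by metis
  then show ?thesis by (simp add: extrapolation_def)
qed

lemma extrapolation_cong:
  assumes "B \<subseteq> J" "\<And>j. j \<in> J \<Longrightarrow> n j = n' j"
  shows "extrapolation B n = extrapolation B n'"
proof -
  have "lattice_count B (ray n W m) = lattice_count B (\<lambda>j. n' j + int m * W j)" for m
    using assms by (intro lattice_count_cong) auto
  then show ?thesis by (simp add: extrapolation_def)
qed

lemma extrapolation_eq_0:
  assumes "B \<subseteq> J" "\<And>n. deep J \<L> 1 n \<Longrightarrow> lattice_count B n = 0"
  shows "extrapolation B n = 0"
proof (rule extrapolation_eqI[OF assms(1)], rule extrapolates_to_zero)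
  obtain m0 where "\<forall>m\<ge>m0. deep J \<L> 1 (ray n W m)"
    using ray_reaches_deep by blast
  then show "\<forall>\<^sub>F m in sequentially. rat_of_nat (lattice_count B (ray n W m)) = 0"
    using assms(2) by (auto simp: eventually_sequentially)
qed

lemma extrapolation_nonspanning:
  "B \<subseteq> J \<Longrightarrow> \<not> spans J L B \<Longrightarrow> extrapolation B n = 0"
  using extrapolation_eq_0 lattice_count_nonspanning_int by blast

lemma extrapolation_deep:
  assumes "B \<subseteq> J"
  shows "\<exists>\<rho>. \<forall>n. deep J \<L> \<rho> n \<longrightarrow> extrapolation B n = of_nat (lattice_count B n)"
proof -
  obtain \<rho> where \<rho>: "\<And>n. deep J \<L> \<rho> n \<Longrightarrow>
    \<exists>q. \<forall>m :: nat. of_nat (lattice_count B (ray n W m)) = poly q (of_nat m :: rat)"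
    using ray_polynomial[OF assms] by blast
  have "extrapolation B n = of_nat (lattice_count B n)" if n: "deep J \<L> \<rho> n" for n
  proof (rule extrapolation_eqI[OF assms])
    obtain q where q: "\<And>m :: nat. of_nat (lattice_count B (ray n W m)) = poly q (of_nat m :: rat)"
      using \<rho>[OF n] by blast
    then show "extrapolates_to (\<lambda>m. of_nat (lattice_count B (ray n W m))) (of_nat (lattice_count B n))"
      using q[of 0] by (auto simp: extrapolates_to_def intro!: exI[of _ q])
  qed
  then show ?thesis by blast
qed

end


section \<open>Agreement of count and extrapolation around a chamber\<close>

lemma dot_fun_upd:
  assumes "finite J" "j \<in> J"
  shows "dot J l (y(j := s)) = dot J l y + of_int (l j) * (s - y j)"
proof -
  have "dot J l (y(j := s)) - dot J l y = (\<Sum>i\<in>J. if i = j then of_int (l j) * (s - y j) else 0)"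
    unfolding dot_def sum_subtractf[symmetric] by (intro sum.cong) (auto simp: algebra_simps)
  then show ?thesis using assms by (simp add: algebra_simps)
qed

context unimodular_chamber
begin

text \<open>
  The argument is a real vector. A lattice point satisfies the inequalities for its integral part if and
  only if it satisfies them for the vector itself. So a degenerate integer vector may be perturbed
  inside its unit cube without changing the count.
\<close>

definition discrepancy :: "'j set \<Rightarrow> ('j \<Rightarrow> real) \<Rightarrow> rat" where
  "discrepancy B y = of_nat (lattice_count B (\<lambda>j. \<lfloor>y j\<rfloor>)) - extrapolation B (\<lambda>j. \<lfloor>y j\<rfloor>)"

text \<open>
  When coordinate \<open>j\<close> passes an integer, the count and its extrapolation change by the corresponding
  values for \<open>B - {j}\<close>, taken at a vector of the chamber that is integral at \<open>j\<close>. Those values agree by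
  the hypothesis.
\<close>

lemma discrepancy_raise_coordinate:
  assumes B: "B \<subseteq> J" "j \<in> B"
    and IH: "\<And>y. y \<in> chamber \<Longrightarrow> (\<And>i. i \<in> J - (B - {j}) \<Longrightarrow> y i \<in> \<int>) \<Longrightarrow> discrepancy (B - {j}) y = 0"
    and y: "y \<in> chamber" "y(j := t) \<in> chamber" "\<And>i. i \<in> J - B \<Longrightarrow> y i \<in> \<int>"
    and t: "y j \<le> t" "t - y j < 1"
  shows "discrepancy B (y(j := t)) = discrepancy B y"
proof (cases "\<lfloor>t\<rfloor> = \<lfloor>y j\<rfloor>")
  case True
  then have "(\<lambda>i. \<lfloor>(y(j := t)) i\<rfloor>) = (\<lambda>i. \<lfloor>y i\<rfloor>)" by auto
  then show ?thesis by (simp add: discrepancy_def)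
next
  case False
  have fl: "\<lfloor>t\<rfloor> = \<lfloor>y j\<rfloor> + 1" using t False by linarith
  define y' where "y' = y(j := of_int \<lfloor>t\<rfloor>)"
  define n where "n = (\<lambda>i. \<lfloor>y' i\<rfloor>)"
  have jJ: "j \<in> J" using B by blast
  have between: "y j \<le> of_int \<lfloor>t\<rfloor>" "of_int \<lfloor>t\<rfloor> \<le> t" using fl by linarith+
  have "0 < dot J l y'" if l: "l \<in> \<L>" for l
  proof (cases "0 \<le> l j")
    case True
    then have "0 \<le> real_of_int (l j) * (of_int \<lfloor>t\<rfloor> - y j)" using between by simp
    then show ?thesis using y(1) l by (auto simp: chamber_def y'_def dot_fun_upd[OF finite_J jJ])
  next
    case False
    then have "real_of_int (l j) * (t - y j) \<le> real_of_int (l j) * (of_int \<lfloor>t\<rfloor> - y j)"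
      using between by (intro mult_left_mono_neg) auto
    then show ?thesis using y(2) l
      by (fastforce simp: chamber_def y'_def dot_fun_upd[OF finite_J jJ])
  qed
  then have "y' \<in> chamber" by (simp add: chamber_def)
  then have "discrepancy (B - {j}) y' = 0"
    using y(3) by (intro IH) (auto simp: y'_def)
  then have zero: "of_nat (lattice_count (B - {j}) n) = extrapolation (B - {j}) n"
    by (simp add: discrepancy_def n_def)
  have n: "n = (\<lambda>i. \<lfloor>(y(j := t)) i\<rfloor>)" "n - unit_vec j = (\<lambda>i. \<lfloor>y i\<rfloor>)"
    using fl by (auto simp: n_def y'_def unit_vec_def)
  show ?thesis
    unfolding discrepancy_def n[symmetric]
    using lattice_count_step[OF B, of n] extrapolation_step[OF B, of n] zero by simp
qed

lemma discrepancy_move_coordinate: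
  assumes B: "B \<subseteq> J" "j \<in> B"
    and IH: "\<And>y. y \<in> chamber \<Longrightarrow> (\<And>i. i \<in> J - (B - {j}) \<Longrightarrow> y i \<in> \<int>) \<Longrightarrow> discrepancy (B - {j}) y = 0"
    and y: "y \<in> chamber" "y(j := t) \<in> chamber" "\<And>i. i \<in> J - B \<Longrightarrow> y i \<in> \<int>"
    and t: "\<bar>t - y j\<bar> < 1"
  shows "discrepancy B (y(j := t)) = discrepancy B y"
proof (cases "y j \<le> t")
  case True
  then show ?thesis using discrepancy_raise_coordinate[OF B IH y] t by auto
next
  case False
  have "discrepancy B ((y(j := t))(j := y j)) = discrepancy B (y(j := t))"
    using False t B y by (intro discrepancy_raise_coordinate[OF B IH]) auto
  then show ?thesis by simp
qed

lemma chamber_perturb: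
  assumes "\<And>l. l \<in> \<L> \<Longrightarrow> (\<Sum>j\<in>J. \<bar>of_int (l j) * d j\<bar>) < dot J l y"
  shows "(\<lambda>i. if i \<in> A then y i + d i else y i) \<in> chamber"
proof -
  have "0 < dot J l (\<lambda>i. if i \<in> A then y i + d i else y i)" if l: "l \<in> \<L>" for l
  proof -
    have "dot J l y - (\<Sum>j\<in>J. \<bar>of_int (l j) * d j\<bar>) \<le> dot J l (\<lambda>i. if i \<in> A then y i + d i else y i)"
      unfolding dot_def sum_subtractf[symmetric] by (intro sum_mono) (auto simp: algebra_simps)
    then show ?thesis using assms[OF l] by linarith
  qed
  then show ?thesis by (simp add: chamber_def)
qed

lemma discrepancy_move:
  assumes B: "B \<subseteq> J"
    and IH: "\<And>j y. j \<in> B \<Longrightarrow> y \<in> chamber \<Longrightarrow> (\<And>i. i \<in> J - (B - {j}) \<Longrightarrow> y i \<in> \<int>) \<Longrightarrow> discrepancy (B - {j}) y = 0"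
    and y: "\<And>i. i \<in> J - B \<Longrightarrow> y i \<in> \<int>"
    and d: "\<And>l. l \<in> \<L> \<Longrightarrow> (\<Sum>j\<in>J. \<bar>of_int (l j) * d j\<bar>) < dot J l y" "\<And>j. j \<in> B \<Longrightarrow> \<bar>d j\<bar> < 1"
    and A: "finite A" "A \<subseteq> B"
  shows "discrepancy B (\<lambda>i. if i \<in> A then y i + d i else y i) = discrepancy B y"
  using A
proof (induction A rule: finite_induct)
  case (insert a A)
  let ?y = "\<lambda>A i. if i \<in> A then y i + d i else y i"
  have a: "a \<in> B" using insert.prems by blast
  have upd: "?y (insert a A) = (?y A)(a := y a + d a)" by auto
  have "discrepancy B ((?y A)(a := y a + d a)) = discrepancy B (?y A)"
  proof (rule discrepancy_move_coordinate[OF B a IH[OF a]])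
    show "?y A \<in> chamber" by (rule chamber_perturb[OF d(1)])
    show "(?y A)(a := y a + d a) \<in> chamber" unfolding upd[symmetric] by (rule chamber_perturb[OF d(1)])
    show "\<bar>y a + d a - ?y A a\<bar> < 1" using insert.hyps d(2)[OF a] by simp
    show "?y A i \<in> \<int>" if "i \<in> J - B" for i using that y insert.prems by auto
  qed
  then show ?case using insert upd by simp
qed simp

text \<open>
  Walk from \<open>y\<close> deep into the chamber, where the discrepancy is zero, changing one coordinate at a time
  by less than \<open>1\<close>. By the previous lemmas the discrepancy never changes. Only coordinates in \<open>B\<close> may be
  moved; this suffices because \<open>B\<close> spans, so that \<open>W\<close> is congruent modulo \<open>L\<close> to a vector supported in
  \<open>B\<close>.
\<close>

theorem lattice_count_eq_extrapolation:
  assumes "B \<subseteq> J" "y \<in> chamber" "\<And>i. i \<in> J - B \<Longrightarrow> y i \<in> \<int>"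
  shows "of_nat (lattice_count B (\<lambda>j. \<lfloor>y j\<rfloor>)) = extrapolation B (\<lambda>j. \<lfloor>y j\<rfloor>)"
proof -
  have "discrepancy B y = 0" using assms
  proof (induction "card B" arbitrary: B y rule: less_induct)
    case less
    note B = \<open>B \<subseteq> J\<close>
    have finB: "finite B" using B finite_J finite_subset by blast
    show ?case
    proof (cases "spans J L B")
      case False
      then show ?thesis
        using lattice_count_nonspanning[OF B False less.prems(2,3)] extrapolation_nonspanning[OF B False]
        by (simp add: discrepancy_def)
    next
      case True
      obtain v z where vz: "z \<in> L" "W = v + z" "\<And>i. i \<in> J - B \<Longrightarrow> v i = 0"
        using decompose[OF True] by metis
      have dot_v: "dot J l v = dot J l W" if "l \<in> \<L>" for l
        using annihilates[OF that vz(1)] by (simp add: vz(2) dot_plus)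
      \<comment> \<open>The walk moves each coordinate by \<open>v j / N\<close> in turn. With \<open>N > S\<close>, no partial move leaves the chamber and no coordinate moves by \<open>1\<close> or more.\<close>
      define S where "S = (\<Sum>l\<in>\<L>. (\<Sum>j\<in>J. \<bar>real_of_int (l j * v j)\<bar>) / dot J l y) + (\<Sum>j\<in>J. \<bar>real_of_int (v j)\<bar>)"
      obtain N :: nat where N: "S < N" using reals_Archimedean2 by blast
      have y_pos: "0 < dot J l y" if "l \<in> \<L>" for l using less.prems(2) that by (simp add: chamber_def)
      have "0 \<le> S" unfolding S_def
        by (intro add_nonneg_nonneg sum_nonneg divide_nonneg_nonneg) (auto intro: less_imp_le y_pos)
      then have N0: "0 < real N" using N by simp
      define d where "d = (\<lambda>i. if i \<in> B then real_of_int (v i) / N else 0)"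
      have d_eq: "d i = real_of_int (v i) / N" if "i \<in> J" for i using vz(3) that by (auto simp: d_def)
      have d_small: "\<bar>d j\<bar> < 1" if "j \<in> B" for j
      proof -
        have "\<bar>real_of_int (v j)\<bar> \<le> (\<Sum>j\<in>J. \<bar>real_of_int (v j)\<bar>)"
          using that B finite_J by (intro member_le_sum) auto
        also have "\<dots> \<le> S" unfolding S_def
          by (simp, intro sum_nonneg divide_nonneg_nonneg) (auto intro: less_imp_le y_pos)
        finally show ?thesis using N N0 that by (simp add: d_def)
      qed
      have d_chamber: "(\<Sum>j\<in>J. \<bar>of_int (l j) * d j\<bar>) < dot J l y" if l: "l \<in> \<L>" for l
      proof -
        have "(\<Sum>j\<in>J. \<bar>real_of_int (l j * v j)\<bar>) / dot J l y \<le> (\<Sum>l\<in>\<L>. (\<Sum>j\<in>J. \<bar>real_of_int (l j * v j)\<bar>) / dot J l y)"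
          using l finite_\<L> by (intro member_le_sum[where f = "\<lambda>l. (\<Sum>j\<in>J. \<bar>real_of_int (l j * v j)\<bar>) / dot J l y"] divide_nonneg_nonneg sum_nonneg)
            (auto intro: less_imp_le y_pos)
        also have "\<dots> \<le> S" by (simp add: S_def sum_nonneg)
        also have "\<dots> < N" by (rule N)
        finally have "(\<Sum>j\<in>J. \<bar>real_of_int (l j * v j)\<bar>) < N * dot J l y"
          using y_pos[OF l] by (simp add: field_simps)
        moreover have "(\<Sum>j\<in>J. \<bar>of_int (l j) * d j\<bar>) = (\<Sum>j\<in>J. \<bar>real_of_int (l j * v j)\<bar>) / N"
          unfolding sum_divide_distrib by (intro sum.cong) (auto simp: d_eq abs_mult)
        ultimately have "N * (\<Sum>j\<in>J. \<bar>of_int (l j) * d j\<bar>) < N * dot J l y" using N0 by simp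
        then show ?thesis using N0 by simp
      qed
      have dot_d: "dot J l d = dot J l W / N" if l: "l \<in> \<L>" for l
      proof -
        have "dot J l d = dot J l (\<lambda>j. real_of_int (v j)) / N"
          unfolding dot_def sum_divide_distrib by (intro sum.cong) (auto simp: d_eq)
        then show ?thesis using dot_v[OF l] by (simp add: dot_of_int)
      qed
      have dot_ym: "dot J l (\<lambda>i. y i + real m * d i) = dot J l y + real m / N * dot J l W" if "l \<in> \<L>" for l m
        using dot_d[OF that] by (simp add: dot_add dot_scale)
      have move: "discrepancy B (\<lambda>i. y i + real m * d i) = discrepancy B y" for m
      proof (induction m)
        case (Suc m)
        let ?y = "\<lambda>i. y i + real m * d i"
        have "discrepancy B (\<lambda>i. if i \<in> B then ?y i + d i else ?y i) = discrepancy B ?y"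
        proof (rule discrepancy_move[OF B])
          fix j y' assume "j \<in> B" "y' \<in> chamber" "\<And>i. i \<in> J - (B - {j}) \<Longrightarrow> y' i \<in> \<int>"
          then show "discrepancy (B - {j}) y' = 0"
            using B card_Diff1_less[OF finB \<open>j \<in> B\<close>] by (intro less.hyps) auto
        next
          fix l assume l: "l \<in> \<L>"
          have "0 \<le> real m / N * dot J l W" using W_pos[OF l] by simp
          then show "(\<Sum>j\<in>J. \<bar>of_int (l j) * d j\<bar>) < dot J l ?y"
            using d_chamber[OF l] dot_ym[OF l, of m] by linarith
        qed (use finB less.prems(3) d_small in \<open>auto simp: d_def\<close>)
        moreover have "(\<lambda>i. if i \<in> B then ?y i + d i else ?y i) = (\<lambda>i. y i + real (Suc m) * d i)"
          by (auto simp: d_def algebra_simps)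
        ultimately show ?case using Suc by simp
      qed simp
      obtain \<rho> where \<rho>: "\<And>n. deep J \<L> \<rho> n \<Longrightarrow> extrapolation B n = of_nat (lattice_count B n)"
        using extrapolation_deep[OF B] by blast
      \<comment> \<open>Rounding down lowers the value of a form by at most \<open>K\<close>.\<close>
      define K where "K = (\<Sum>l\<in>\<L>. \<Sum>j\<in>J. \<bar>l j\<bar>)"
      define m where "m = N * nat (\<bar>\<rho>\<bar> + K)"
      let ?n = "\<lambda>i. \<lfloor>y i + real m * d i\<rfloor>"
      have "deep J \<L> \<rho> ?n"
        unfolding deep_def
      proof
        fix l assume l: "l \<in> \<L>"
        have K0: "0 \<le> K" by (simp add: K_def sum_nonneg)
        have lK: "(\<Sum>j\<in>J. \<bar>l j\<bar>) \<le> K"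
          unfolding K_def using l finite_\<L> by (intro member_le_sum) (auto simp: sum_nonneg)
        have "real m / N = of_int (\<bar>\<rho>\<bar> + K)"
          using N0 K0 by (simp add: m_def)
        moreover have "of_int (\<bar>\<rho>\<bar> + K) * 1 \<le> of_int (\<bar>\<rho>\<bar> + K) * real_of_int (dot J l W)"
          using W_pos[OF l] K0 by (intro mult_left_mono) auto
        ultimately have "of_int (\<bar>\<rho>\<bar> + K) \<le> real m / N * dot J l W" by simp
        then have "of_int (\<bar>\<rho>\<bar> + K) \<le> dot J l (\<lambda>i. y i + real m * d i)"
          using dot_ym[OF l, of m] y_pos[OF l] by linarith
        also have "\<dots> \<le> dot J l (\<lambda>i. real_of_int (?n i)) + (\<Sum>j\<in>J. \<bar>of_int (l j)\<bar>)"
          unfolding dot_def sum.distrib[symmetric]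
        proof (rule sum_mono)
          fix j
          have "real_of_int (l j) * (y j + real m * d j - of_int (?n j)) \<le> \<bar>of_int (l j)\<bar> * 1"
            by (rule order.trans[OF abs_ge_self]) (unfold abs_mult, intro mult_left_mono, linarith+)
          then show "real_of_int (l j) * (y j + real m * d j) \<le> real_of_int (l j) * of_int (?n j) + \<bar>of_int (l j)\<bar>"
            by (simp add: algebra_simps)
        qed
        also have "\<dots> = of_int (dot J l ?n + (\<Sum>j\<in>J. \<bar>l j\<bar>))" by (simp add: dot_of_int)
        finally have "\<bar>\<rho>\<bar> + K \<le> dot J l ?n + (\<Sum>j\<in>J. \<bar>l j\<bar>)" by linarith
        then show "\<rho> \<le> dot J l ?n" using lK by linarith
      qed
      then have "discrepancy B (\<lambda>i. y i + real m * d i) = 0"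
        using \<rho> by (simp add: discrepancy_def)
      then show ?thesis using move by simp
    qed
  qed
  then show ?thesis by (simp add: discrepancy_def)
qed

section \<open>Reciprocity\<close>

text \<open>
  The recursion of the count is now available at all integer vectors, so the differences vanish
  everywhere: the extrapolation is a polynomial.
\<close>

lemma vanishing_extrapolation:
  "B \<subseteq> J \<Longrightarrow> vanishing J {} (Suc (card B)) (extrapolation B)"
proof (induction "card B" arbitrary: B rule: less_induct)
  case less
  show ?case
  proof (cases "spans J L B")
    case True
    have "vanishing J {} (card B) (\<lambda>n. extrapolation B (n + unit_vec j) - extrapolation B n)"
      if j: "j \<in> B" for j
    proof -
      have finB: "finite B" using finite_J finite_subset less.prems by blast
      have "vanishing J {} (card B) (extrapolation (B - {j}))"
        using less.hyps[of "B - {j}"] less.prems card_Suc_Diff1[OF finB j] card_Diff1_less[OF finB j] by auto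
      then have "vanishing J {} (card B) (\<lambda>n. extrapolation (B - {j}) (n + unit_vec j))"
        by (rule vanishing_shift[OF finite.emptyI])
      moreover have "extrapolation B (n + unit_vec j) - extrapolation B n = extrapolation (B - {j}) (n + unit_vec j)" for n
        using extrapolation_step[OF less.prems j, of "n + unit_vec j"] by (simp add: algebra_simps)
      ultimately show ?thesis by simp
    qed
    then show ?thesis
      using less.prems by (intro vanishing_Suc_spans[OF finite.emptyI True])
        (auto intro: extrapolation_translate extrapolation_cong)
  next
    case False
    then have "vanishing J {} 0 (extrapolation B)"
      using extrapolation_nonspanning less.prems by auto
    then show ?thesis by (rule vanishing_le[OF finite.emptyI]) simp
  qed
qed

lemma spans_constant:
  assumes "spans J L B"
    and "\<And>j n. j \<in> B \<Longrightarrow> h (n + unit_vec j) = h n"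
    and "\<And>z n. z \<in> L \<Longrightarrow> h (n + z) = h n"
    and "\<And>n n'. (\<And>j. j \<in> J \<Longrightarrow> n j = n' j) \<Longrightarrow> h n = h n'"
  shows "h n = h n'"
proof -
  let ?H = "{v. \<forall>m. h (m + v) = h m}"
  have "n - n' \<in> ?H"
  proof (rule spans_generates[OF assms(1)])
    fix u v assume "u \<in> ?H" "v \<in> ?H"
    then show "u + v \<in> ?H" by (simp add: add.assoc[symmetric])
  next
    fix v assume v: "v \<in> ?H"
    have "h (m + - v) = h m" for m
    proof -
      have "h (m + - v + v) = h (m + - v)" using v by blast
      moreover have "m + - v + v = m" by (rule ext) simp
      ultimately show ?thesis by simp
    qed
    then show "- v \<in> ?H" by simp
  next
    fix v :: "'j \<Rightarrow> int" assume "\<And>j. j \<in> J \<Longrightarrow> v j = 0"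
    then have "h (m + v) = h m" for m by (intro assms(4)) simp
    then show "v \<in> ?H" by simp
  qed (use assms(2,3) in auto)
  then have "h (n' + (n - n')) = h n'" by blast
  moreover have "n' + (n - n') = n" by (rule ext) simp
  ultimately show ?thesis by simp
qed

text \<open>
  Every redundant \<open>j\<close> lies in the support of some relation among the vectors of \<open>B\<close>, and a general integer
  combination of these relations vanishes at none of them.
\<close>

lemma relation_nonzero_on_redundant:
  assumes "spans J L B"
  obtains z where "z \<in> L" "\<And>i. i \<in> J - B \<Longrightarrow> z i = 0" "\<And>j. j \<in> B \<Longrightarrow> spans J L (B - {j}) \<Longrightarrow> z j \<noteq> 0"
proof -
  have BJ: "B \<subseteq> J" and finB: "finite B" using assms finite_J finite_subset by (auto simp: spans_def)
  have "\<exists>z\<in>L. (\<forall>i\<in>J - B. z i = 0) \<and> (\<forall>j\<in>A. z j \<noteq> 0)"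
    if "finite A" "A \<subseteq> {j \<in> B. spans J L (B - {j})}" for A
    using that
  proof (induction A rule: finite_induct)
    case empty
    then show ?case using zero_mem by (intro bexI[of _ 0]) auto
  next
    case (insert a A)
    then obtain z where z: "z \<in> L" "\<And>i. i \<in> J - B \<Longrightarrow> z i = 0" "\<And>j. j \<in> A \<Longrightarrow> z j \<noteq> 0" by auto
    have a: "a \<in> B" "spans J L (B - {a})" using insert.prems by auto
    then have "a \<in> J - (B - {a})" using BJ by blast
    then obtain x where x: "x \<in> L" "x a = 1" "\<And>i. i \<in> J - (B - {a}) - {a} \<Longrightarrow> x i = 0"
      using a(2) unfolding spans_def by blast
    have "finite {t. z j + t * x j = 0}" if "j \<in> insert a A" for j
    proof (cases "x j = 0")
      case True
      then have "{t. z j + t * x j = 0} = {}" using that x(2) z(3) by auto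
      then show ?thesis by simp
    next
      case False
      then have "{t. z j + t * x j = 0} \<subseteq> {- (z j) div x j}"
        by (auto simp: eq_neg_iff_add_eq_0[symmetric])
      then show ?thesis using finite_subset by blast
    qed
    then have "finite (\<Union>j\<in>insert a A. {t. z j + t * x j = 0})"
      using insert.hyps by (intro finite_UN_I) auto
    then obtain t where t: "t \<notin> (\<Union>j\<in>insert a A. {t. z j + t * x j = 0})"
      using ex_new_if_finite[OF infinite_UNIV_int] by blast
    have "z + (\<lambda>j. t * x j) \<in> L" using z(1) x(1) add_mem scale_mem by blast
    moreover have "\<forall>i\<in>J - B. (z + (\<lambda>j. t * x j)) i = 0" using z(2) x(3) a by auto
    moreover have "\<forall>j\<in>insert a A. (z + (\<lambda>j. t * x j)) j \<noteq> 0" using t by auto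
    ultimately show ?case by blast
  qed
  from this[of "{j \<in> B. spans J L (B - {j})}"] finB that show thesis by auto
qed

text \<open>
  For small \<open>\<epsilon>\<close> the vector \<open>\<epsilon> z\<close> has integral part \<open>- indic {j. z j < 0}\<close> and lies in \<open>L\<close> over the reals, so a
  small step from it into the chamber shows that the extrapolation is the count there. By pointedness
  that count is zero. The step must not make an irredundant coordinate negative; if every step does, then
  the chamber is disjoint from the cone of \<open>B\<close> and the extrapolation vanishes identically.
\<close>

lemma extrapolation_zero:
  assumes B: "spans J L B" and z: "z \<in> L" "\<And>i. i \<in> J - B \<Longrightarrow> z i = 0"
    and supp: "\<And>j. j \<in> B \<Longrightarrow> z j \<noteq> 0 \<longleftrightarrow> spans J L (B - {j})" and "z \<noteq> 0"
  shows "extrapolation B (- indic {j \<in> J. z j < 0}) = 0"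
proof -
  have BJ: "B \<subseteq> J" using B by (simp add: spans_def)
  obtain v z0 where v: "z0 \<in> L" "W = v + z0" "\<And>i. i \<in> J - B \<Longrightarrow> v i = 0"
    using decompose[OF B] by metis
  have dot_v: "dot J l v = dot J l W" if "l \<in> \<L>" for l
    using annihilates[OF that v(1)] by (simp add: v(2) dot_plus)
  show ?thesis
  proof (cases "\<exists>j\<in>B. \<not> spans J L (B - {j}) \<and> v j < 0")
    case True
    then obtain j where j: "j \<in> B" "\<not> spans J L (B - {j})" "v j < 0" by blast
    have jJ: "j \<in> J" using j BJ by blast
    obtain l where l: "l \<in> \<L>" "\<And>i. i \<in> B - {j} \<Longrightarrow> l i = 0"
      using separates[of "B - {j}"] j BJ by blast
    have only_j: "dot J l x = l j * x j" if "\<And>i. i \<in> J - B \<Longrightarrow> x i = 0" for x :: "'j \<Rightarrow> int"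
    proof -
      have "dot J l x = (\<Sum>i\<in>J. if i = j then l j * x j else 0)"
        unfolding dot_def using that l(2) by (intro sum.cong) auto
      then show ?thesis using jJ finite_J by simp
    qed
    have "0 < l j * v j" using only_j[OF v(3)] dot_v[OF l(1)] W_pos[OF l(1)] by simp
    then have lj: "l j < 0" using j(3) by (simp add: zero_less_mult_iff)
    have "lattice_count B n = 0" if n: "deep J \<L> 1 n" for n
    proof -
      have False if x: "x \<in> L" "\<forall>i\<in>B. 0 \<le> x i + n i" "\<forall>i\<in>J - B. x i + n i = 0" for x
      proof -
        have "dot J l (x + n) = l j * (x j + n j)" using only_j[of "x + n"] x(3) by simp
        also have "\<dots> \<le> 0" using lj x(2) j(1) by (simp add: mult_nonpos_nonneg)
        finally have "dot J l n \<le> 0" using annihilates[OF l(1) x(1)] by (simp add: dot_plus)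
        then show False using n l(1) by (fastforce simp: deep_def)
      qed
      then have "(points B n) = {}" by blast
      then show ?thesis unfolding lattice_count_def by (simp only: card.empty)
    qed
    then show ?thesis using extrapolation_eq_0[OF BJ] by blast
  next
    case False
    define M where "M = 1 + (\<Sum>j\<in>J. \<bar>real_of_int (z j)\<bar>) + (\<Sum>j\<in>J. \<bar>real_of_int (v j)\<bar>)"
    have zM: "\<bar>real_of_int (z j)\<bar> < M" if "j \<in> J" for j
    proof -
      have "\<bar>real_of_int (z j)\<bar> \<le> (\<Sum>j\<in>J. \<bar>real_of_int (z j)\<bar>)"
        using that finite_J by (intro member_le_sum) auto
      moreover have "0 \<le> (\<Sum>j\<in>J. \<bar>real_of_int (v j)\<bar>)" by (simp add: sum_nonneg)
      ultimately show ?thesis unfolding M_def by linarith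
    qed
    have vM: "\<bar>real_of_int (v j)\<bar> < M" if "j \<in> J" for j
    proof -
      have "\<bar>real_of_int (v j)\<bar> \<le> (\<Sum>j\<in>J. \<bar>real_of_int (v j)\<bar>)"
        using that finite_J by (intro member_le_sum) auto
      moreover have "0 \<le> (\<Sum>j\<in>J. \<bar>real_of_int (z j)\<bar>)" by (simp add: sum_nonneg)
      ultimately show ?thesis unfolding M_def by linarith
    qed
    have M1: "1 \<le> M" by (simp add: M_def sum_nonneg)
    \<comment> \<open>The vector \<open>v\<close> is the part of \<open>W\<close> that is supported in \<open>B\<close>; its contribution is too small to change the sign of a nonzero \<open>z j\<close>.\<close>
    define y where "y = (\<lambda>j. if j \<in> J then real_of_int (z j) / (2 * M) + real_of_int (v j) / (2 * M * M) else 0)"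
    have "0 < dot J l y" if l: "l \<in> \<L>" for l
    proof -
      have "dot J l y = dot J l (\<lambda>j. real_of_int (z j)) / (2 * M) + dot J l (\<lambda>j. real_of_int (v j)) / (2 * M * M)"
        unfolding dot_def sum_divide_distrib sum.distrib[symmetric]
        by (intro sum.cong) (auto simp: y_def algebra_simps)
      also have "\<dots> = dot J l W / (2 * M * M)"
        using annihilates_real[OF l z(1)] dot_v[OF l] by (simp add: dot_of_int)
      finally show ?thesis using W_pos[OF l] M1 by simp
    qed
    then have y_chamber: "y \<in> chamber" by (simp add: chamber_def)
    have floor_y: "\<lfloor>y j\<rfloor> = - indic {j \<in> J. z j < 0} j" for j
    proof (cases "j \<in> J")
      case j: True
      have small: "\<bar>real_of_int (v j) / (2 * M * M)\<bar> < 1 / (2 * M)"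
        using vM[OF j] M1 by (simp add: abs_div field_simps)
      consider "z j = 0" | "0 < z j" | "z j < 0" by linarith
      then show ?thesis
      proof cases
        case 1
        then have "0 \<le> v j" using False supp[of j] v(3)[of j] j by (cases "j \<in> B") force+
        then have "0 \<le> y j" using 1 j M1 by (simp add: y_def)
        moreover have "y j < 1"
        proof -
          have "1 / (2 * M) \<le> 1" using M1 by simp
          moreover have "y j = real_of_int (v j) / (2 * M * M)" using 1 j by (simp add: y_def)
          ultimately show ?thesis using small by linarith
        qed
        ultimately have "\<lfloor>y j\<rfloor> = 0" by linarith
        then show ?thesis using 1 by (simp add: indic_def)
      next
        case 2
        then have "1 / (2 * M) \<le> real_of_int (z j) / (2 * M)" using M1 by (intro divide_right_mono) auto
        moreover have "real_of_int (z j) / (2 * M) < 1 / 2" using zM[OF j] M1 2 by (simp add: field_simps)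
        moreover have "1 / (2 * M) \<le> 1 / 2" using M1 by (simp add: field_simps)
        moreover have "y j = real_of_int (z j) / (2 * M) + real_of_int (v j) / (2 * M * M)"
          using j by (simp add: y_def)
        ultimately have "0 \<le> y j" "y j < 1" using small by linarith+
        then have "\<lfloor>y j\<rfloor> = 0" by linarith
        then show ?thesis using 2 by (simp add: indic_def)
      next
        case 3
        then have "real_of_int (z j) / (2 * M) \<le> - 1 / (2 * M)" using M1 by (intro divide_right_mono) auto
        moreover have "- (1 / 2) < real_of_int (z j) / (2 * M)" using zM[OF j] M1 3 by (simp add: field_simps)
        moreover have "1 / (2 * M) \<le> 1 / 2" using M1 by (simp add: field_simps)
        moreover have "y j = real_of_int (z j) / (2 * M) + real_of_int (v j) / (2 * M * M)"
          using j by (simp add: y_def)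
        ultimately have "- 1 \<le> y j" "y j < 0" using small by linarith+
        then have "\<lfloor>y j\<rfloor> = - 1" by linarith
        then show ?thesis using 3 j by (simp add: indic_def)
      qed
    qed (simp add: y_def indic_def)
    have "of_nat (lattice_count B (\<lambda>j. \<lfloor>y j\<rfloor>)) = extrapolation B (\<lambda>j. \<lfloor>y j\<rfloor>)"
      using y_chamber z(2) v(3) by (intro lattice_count_eq_extrapolation[OF BJ]) (auto simp: y_def)
    moreover have "(\<lambda>j. \<lfloor>y j\<rfloor>) = - indic {j \<in> J. z j < 0}"
      using floor_y by (auto simp: fun_eq_iff)
    moreover have "lattice_count B (- indic {j \<in> J. z j < 0}) = 0"
    proof -
      have False if x: "x \<in> L" "\<forall>i\<in>B. 0 \<le> x i + (- indic {j \<in> J. z j < 0}) i"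
        "\<forall>i\<in>J - B. x i + (- indic {j \<in> J. z j < 0}) i = 0" for x
      proof -
        have lower: "(if z i < 0 then 1 else 0) \<le> x i" if "i \<in> J" for i
        proof (cases "i \<in> B")
          case True
          then show ?thesis using x(2) that by (auto simp: indic_def)
        next
          case False
          then have "x i + (- indic {j \<in> J. z j < 0}) i = 0" using x(3) that by blast
          then show ?thesis using that by (auto simp: indic_def)
        qed
        have "0 \<le> x i" if "i \<in> J" for i using lower[OF that] by (cases "z i < 0") auto
        then have "x = 0" using pointed[OF x(1)] by blast
        then have "0 \<le> z i" if "i \<in> J" for i using lower[OF that] by (auto split: if_splits)
        then have "z = 0" using pointed[OF z(1)] by blast
        then show False using \<open>z \<noteq> 0\<close> by simp
      qed
      then have "{x \<in> L. (\<forall>i\<in>B. 0 \<le> x i + (- indic {j \<in> J. z j < 0}) i) \<and>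
          (\<forall>i\<in>J - B. x i + (- indic {j \<in> J. z j < 0}) i = 0)} = {}" by blast
      then show ?thesis unfolding lattice_count_def by (simp only: card.empty)
    qed
    ultimately show ?thesis by simp
  qed
qed

lemma extrapolation_remove_irredundant:
  assumes "B \<subseteq> J" "finite C" "C \<subseteq> {j \<in> B. \<not> spans J L (B - {j})}"
  shows "extrapolation B (n - indic C) = extrapolation B n"
  using assms(2,3)
proof (induction C arbitrary: n rule: finite_induct)
  case empty
  have "n - indic {} = n" by (rule ext) (simp add: indic_def)
  then show ?case by simp
next
  case (insert c C)
  have c: "c \<in> B" "\<not> spans J L (B - {c})" "B - {c} \<subseteq> J" using insert.prems assms(1) by auto
  have "n - indic (insert c C) = (n - indic C) - unit_vec c"
    using insert.hyps by (auto simp: indic_def unit_vec_def)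
  then have "extrapolation B (n - indic (insert c C)) = extrapolation B ((n - indic C) - unit_vec c)"
    by (rule arg_cong)
  also have "\<dots> = extrapolation B (n - indic C)"
    using extrapolation_step[OF assms(1) c(1), of "n - indic C"] extrapolation_nonspanning[OF c(3,2)] by simp
  also have "\<dots> = extrapolation B n"
    using insert.prems by (intro insert.IH) blast
  finally show ?case .
qed

text \<open>
  Both sides satisfy the same recursion, so by induction they differ by a constant. A relation \<open>z\<close> that is
  nonzero exactly at the redundant elements shows that the constant is zero: the two sides vanish at
  \<open>- indic {j. z j < 0}\<close>, the right one because its argument there is, up to irredundant coordinates, the
  point that belongs to \<open>- z\<close>. If nothing is redundant, the extrapolation is constant and the sign is
  \<open>+1\<close>.
\<close>

theorem extrapolation_reciprocity:
  assumes "B \<subseteq> J"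
  shows "extrapolation B n = (- 1) ^ (card B + r) * extrapolation B (- n - indic B)"
  using assms
proof (induction "card B" arbitrary: B n rule: less_induct)
  case less
  note BJ = \<open>B \<subseteq> J\<close>
  have finB: "finite B" using BJ finite_J finite_subset by blast
  define s :: rat where "s = (- 1) ^ (card B + r)"
  define h where "h = (\<lambda>n. extrapolation B n - s * extrapolation B (- n - indic B))"
  show ?case
  proof (cases "spans J L B")
    case False
    then show ?thesis using extrapolation_nonspanning[OF BJ] by simp
  next
    case True
    have const: "h n = h n'" for n n'
    proof (rule spans_constant[OF True])
      fix j n assume j: "j \<in> B"
      have BjJ: "B - {j} \<subseteq> J" using BJ by blast
      have card: "card B = Suc (card (B - {j}))" using card_Suc_Diff1[OF finB j] by simp
      let ?m = "- n - indic B"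
      have 1: "extrapolation B (n + unit_vec j) = extrapolation B n + extrapolation (B - {j}) (n + unit_vec j)"
        using extrapolation_step[OF BJ j, of "n + unit_vec j"] by simp
      have shift: "- (n + unit_vec j) - indic B = ?m - unit_vec j" by (rule ext) simp
      have 2: "extrapolation B ?m = extrapolation B (- (n + unit_vec j) - indic B) + extrapolation (B - {j}) ?m"
        unfolding shift by (rule extrapolation_step[OF BJ j])
      have "?m = - (n + unit_vec j) - indic (B - {j})"
        using j by (auto simp: unit_vec_def indic_def)
      moreover have "extrapolation (B - {j}) (n + unit_vec j) =
          (- 1) ^ (card (B - {j}) + r) * extrapolation (B - {j}) (- (n + unit_vec j) - indic (B - {j}))"
        by (rule less.hyps) (use BjJ card in auto)
      ultimately have 3: "extrapolation (B - {j}) (n + unit_vec j) = - s * extrapolation (B - {j}) ?m"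
        by (simp only: s_def card) simp
      show "h (n + unit_vec j) = h n"
        unfolding h_def 1 2 3 by (simp add: algebra_simps)
    next
      fix z n assume z: "z \<in> L"
      have flip: "- (n + z) - indic B = (- n - indic B) + - z" by (rule ext) simp
      show "h (n + z) = h n"
        unfolding h_def flip extrapolation_translate[OF BJ z] extrapolation_translate[OF BJ uminus_mem[OF z]] ..
    next
      fix n n' :: "'j \<Rightarrow> int" assume eq: "\<And>j. j \<in> J \<Longrightarrow> n j = n' j"
      have "extrapolation B n = extrapolation B n'"
        by (rule extrapolation_cong[OF BJ eq])
      moreover have "extrapolation B (- n - indic B) = extrapolation B (- n' - indic B)"
        using eq by (intro extrapolation_cong[OF BJ]) simp
      ultimately show "h n = h n'" by (simp add: h_def)
    qed
    have "\<exists>n. h n = 0"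
    proof (cases "\<exists>j\<in>B. spans J L (B - {j})")
      case False
      then have "card B = r" using card_minimal[OF True] by blast
      then have s: "s = 1" by (simp add: s_def flip: mult_2)
      have "extrapolation B n = extrapolation B n'" for n n'
      proof (rule spans_constant[OF True])
        fix j n assume j: "j \<in> B"
        have "B - {j} \<subseteq> J" using BJ by blast
        then have "extrapolation (B - {j}) m = 0" for m
          using extrapolation_nonspanning False j by blast
        then show "extrapolation B (n + unit_vec j) = extrapolation B n"
          using extrapolation_step[OF BJ j, of "n + unit_vec j"] by simp
      next
        fix z n assume "z \<in> L"
        then show "extrapolation B (n + z) = extrapolation B n" by (rule extrapolation_translate[OF BJ])
      next
        fix n n' :: "'j \<Rightarrow> int" assume "\<And>j. j \<in> J \<Longrightarrow> n j = n' j"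
        then show "extrapolation B n = extrapolation B n'" by (rule extrapolation_cong[OF BJ])
      qed
      then show ?thesis by (simp add: h_def s)
    next
      case ex: True
      obtain z where z: "z \<in> L" "\<And>i. i \<in> J - B \<Longrightarrow> z i = 0"
          "\<And>j. j \<in> B \<Longrightarrow> spans J L (B - {j}) \<Longrightarrow> z j \<noteq> 0"
        using relation_nonzero_on_redundant[OF True] by blast
      have supp: "z j \<noteq> 0 \<longleftrightarrow> spans J L (B - {j})" if "j \<in> B" for j
        using exchange[OF True z(1,2) that] z(3)[OF that] by blast
      have "z \<noteq> 0" using ex z(3) by (auto simp: fun_eq_iff)
      define n0 where "n0 = - indic {j \<in> J. z j < 0}"
      define C where "C = {j \<in> B. \<not> spans J L (B - {j})}"
      have "extrapolation B n0 = 0"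
        unfolding n0_def using extrapolation_zero[OF True z(1,2) supp \<open>z \<noteq> 0\<close>] by blast
      moreover have "extrapolation B (- indic {j \<in> J. (- z) j < 0}) = 0"
      proof (rule extrapolation_zero[OF True uminus_mem[OF z(1)]])
        show "- z \<noteq> 0" using \<open>z \<noteq> 0\<close> by simp
      qed (use z(2) supp in auto)
      moreover have "- n0 - indic B = - indic {j \<in> J. (- z) j < 0} - indic C"
      proof
        fix j
        show "(- n0 - indic B) j = (- indic {j \<in> J. (- z) j < 0} - indic C) j"
        proof (cases "j \<in> B")
          case True
          then show ?thesis using supp[of j] BJ by (auto simp: n0_def indic_def C_def)
        next
          case False
          then show ?thesis using z(2)[of j] BJ by (auto simp: n0_def indic_def C_def)
        qed
      qed
      moreover have "extrapolation B (m - indic C) = extrapolation B m" for m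
        using extrapolation_remove_irredundant[OF BJ, of C m] finB by (simp add: C_def)
      ultimately have "h n0 = 0" by (simp add: h_def)
      then show ?thesis by blast
    qed
    then have "h n = 0" using const by metis
    then show ?thesis by (simp add: h_def s_def)
  qed
qed

end


section \<open>Circulations, cuts and connectivity\<close>

definition cut_vector :: "('v, 'e) pre_digraph \<Rightarrow> 'v set \<Rightarrow> 'e \<Rightarrow> int" where
  "cut_vector G X e = of_bool (head G e \<in> X) - of_bool (tail G e \<in> X)"

definition excess :: "('v, 'e) pre_digraph \<Rightarrow> ('e \<Rightarrow> int) \<Rightarrow> 'v \<Rightarrow> int" where
  "excess G x v = (\<Sum>e\<in>arcs G. cut_vector G {v} e * x e)"

definition circulations :: "('v, 'e) pre_digraph \<Rightarrow> ('e \<Rightarrow> int) set" where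
  "circulations G = {x. (\<forall>e. e \<notin> arcs G \<longrightarrow> x e = 0) \<and> (\<forall>v\<in>verts G. excess G x v = 0)}"

text \<open>
  Being joined by a path of edges in \<open>F\<close>, regardless of direction.
\<close>

definition linked :: "('v, 'e) pre_digraph \<Rightarrow> 'e set \<Rightarrow> 'v rel" where
  "linked G F = (\<Union>e\<in>F. {(tail G e, head G e), (head G e, tail G e)})\<^sup>*"

definition link_classes :: "('v, 'e) pre_digraph \<Rightarrow> 'e set \<Rightarrow> 'v set set" where
  "link_classes G F = (\<lambda>v. linked G F `` {v}) ` verts G"

text \<open>
  Each edge \<open>e\<close> gives two coordinates. A lower bound for the flow on \<open>e\<close> is a bound for the coordinate
  \<open>(e, True)\<close>, and an upper bound is one for \<open>(e, False)\<close>.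
\<close>

definition signed_pair :: "('e \<Rightarrow> int) \<Rightarrow> 'e \<times> bool \<Rightarrow> int" where
  "signed_pair x = (\<lambda>(e, b). if b then x e else - x e)"

text \<open>
  The edges on which neither bound is attained by force; on any other edge the flow is prescribed.
\<close>

definition free_arcs :: "('e \<times> bool) set \<Rightarrow> 'e set" where
  "free_arcs B = {e. (e, True) \<in> B \<and> (e, False) \<in> B}"

lemma excess_add: "excess G (x + y) v = excess G x v + excess G y v"
  by (simp add: excess_def algebra_simps sum.distrib)

lemma excess_uminus: "excess G (- x) v = - excess G x v"
  by (simp add: excess_def sum_negf)

lemma sym_linked: "sym (linked G F)"
  unfolding linked_def by (rule sym_rtrancl) (auto simp: sym_def)

lemma linked_symD: "(u, v) \<in> linked G F \<Longrightarrow> (v, u) \<in> linked G F"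
  using sym_linked by (rule symD)

lemma linked_refl [simp]: "(v, v) \<in> linked G F"
  by (simp add: linked_def)

lemma linked_trans: "(u, v) \<in> linked G F \<Longrightarrow> (v, w) \<in> linked G F \<Longrightarrow> (u, w) \<in> linked G F"
  unfolding linked_def by (rule rtrancl_trans)

lemma linked_mono: "F \<subseteq> F' \<Longrightarrow> linked G F \<subseteq> linked G F'"
  unfolding linked_def by (rule rtrancl_mono) blast

lemma linked_edge: "e \<in> F \<Longrightarrow> (tail G e, head G e) \<in> linked G F"
  unfolding linked_def by (rule r_into_rtrancl) blast

lemma linked_least:
  assumes "\<And>e. e \<in> F' \<Longrightarrow> (tail G e, head G e) \<in> linked G F"
  shows "linked G F' \<subseteq> linked G F"
proof -
  have "(\<Union>e\<in>F'. {(tail G e, head G e), (head G e, tail G e)}) \<subseteq> linked G F"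
    using assms linked_symD by fastforce
  then have "linked G F' \<subseteq> (linked G F)\<^sup>*"
    unfolding linked_def[of G F'] by (rule rtrancl_mono)
  then show ?thesis by (simp add: linked_def)
qed

lemma linked_insert:
  "linked G (insert e F) = linked G F \<union>
     {(u, v). (u, tail G e) \<in> linked G F \<and> (head G e, v) \<in> linked G F} \<union>
     {(u, v). (u, head G e) \<in> linked G F \<and> (tail G e, v) \<in> linked G F}" (is "?l = ?r")
proof
  have sub: "linked G F \<subseteq> ?l" by (rule linked_mono) blast
  have e: "(tail G e, head G e) \<in> ?l" by (rule linked_edge) blast
  show "?r \<subseteq> ?l"
    using sub e linked_symD[OF e] by (blast intro: linked_trans)
next
  show "?l \<subseteq> ?r"
  proof (rule subrelI)
    fix u v assume "(u, v) \<in> ?l"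
    then show "(u, v) \<in> ?r"
      unfolding linked_def[of G "insert e F"]
    proof (induction rule: rtrancl_induct)
      case base
      then show ?case by simp
    next
      case (step y z)
      then have "(y, z) \<in> linked G F \<or> (y, z) = (tail G e, head G e) \<or> (y, z) = (head G e, tail G e)"
        by (auto dest: linked_edge[of _ _ G] linked_symD)
      then show ?case
        using step.IH linked_trans[of _ _ G F] linked_symD[of _ _ G F] linked_refl[of _ G F] by blast
    qed
  qed
qed

lemma linked_class_eq: "linked G F `` {u} = linked G F `` {v} \<longleftrightarrow> (u, v) \<in> linked G F"
  using linked_trans[of _ _ G F] linked_symD[of _ _ G F] linked_refl[of _ G F] by blast

lemma cut_vector_class:
  assumes "e \<in> F"
  shows "cut_vector G (linked G F `` {u}) e = 0"
proof -
  have e: "(tail G e, head G e) \<in> linked G F" using assms by (rule linked_edge)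
  have "(u, head G e) \<in> linked G F \<longleftrightarrow> (u, tail G e) \<in> linked G F"
    using linked_trans[OF _ e] linked_trans[OF _ linked_symD[OF e]] by blast
  then show ?thesis by (simp add: cut_vector_def)
qed

context fin_digraph
begin

lemma finite_link_classes: "finite (link_classes G F)"
  by (simp add: link_classes_def)

lemma linked_in_verts:
  assumes "F \<subseteq> arcs G" "(u, v) \<in> linked G F" "u \<in> verts G"
  shows "v \<in> verts G"
  using assms(2,3) unfolding linked_def
  by (induction rule: rtrancl_induct) (use assms(1) in \<open>auto dest: subsetD\<close>)

lemma linked_insert_redundant:
  assumes "(tail G e, head G e) \<in> linked G F"
  shows "linked G (insert e F) = linked G F"
proof
  show "linked G (insert e F) \<subseteq> linked G F"
    using assms by (intro linked_least) (auto intro: linked_edge)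
  show "linked G F \<subseteq> linked G (insert e F)"
    by (rule linked_mono) blast
qed

lemma card_link_classes_insert:
  assumes e: "e \<in> arcs G" and sep: "(tail G e, head G e) \<notin> linked G F"
  shows "card (link_classes G F) = Suc (card (link_classes G (insert e F)))"
proof -
  define A where "A = linked G F `` {tail G e}"
  define B where "B = linked G F `` {head G e}"
  have AB: "A \<noteq> B" "A \<in> link_classes G F" "B \<in> link_classes G F"
    using sep e unfolding A_def B_def link_classes_def linked_class_eq by auto
  have img: "linked G (insert e F) `` {v} = (if v \<in> A \<union> B then A \<union> B else linked G F `` {v})" for v
  proof (cases "v \<in> A \<union> B")
    case True
    have "(v, w) \<in> linked G (insert e F) \<longleftrightarrow> w \<in> A \<union> B" for w
      using True linked_trans[of v _ G F] linked_symD[of _ v G F] linked_trans[of _ v G F w]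
      unfolding linked_insert A_def B_def by blast
    then show ?thesis using True by auto
  next
    case False
    then have "(v, tail G e) \<notin> linked G F" "(v, head G e) \<notin> linked G F"
      using linked_symD[of v _ G F] by (auto simp: A_def B_def)
    then show ?thesis using False unfolding linked_insert by auto
  qed
  have "link_classes G (insert e F) = insert (A \<union> B) (link_classes G F - {A, B})"
  proof (intro equalityI subsetI)
    fix X assume "X \<in> link_classes G (insert e F)"
    then obtain v where v: "v \<in> verts G" "X = linked G (insert e F) `` {v}" by (auto simp: link_classes_def)
    show "X \<in> insert (A \<union> B) (link_classes G F - {A, B})"
    proof (cases "v \<in> A \<union> B")
      case True
      then show ?thesis using v img by simp
    next
      case False
      then have X: "X = linked G F `` {v}" using v img by simp
      then have "v \<in> X" by simp
      then have "X \<noteq> A" "X \<noteq> B" using False by auto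
      moreover have "X \<in> link_classes G F" using X v(1) by (simp add: link_classes_def)
      ultimately show ?thesis by simp
    qed
  next
    fix X assume "X \<in> insert (A \<union> B) (link_classes G F - {A, B})"
    then consider "X = A \<union> B" | v where "v \<in> verts G" "X = linked G F `` {v}" "X \<noteq> A" "X \<noteq> B"
      by (auto simp: link_classes_def)
    then show "X \<in> link_classes G (insert e F)"
    proof cases
      case 1
      have "tail G e \<in> A" by (simp add: A_def)
      then have "X = linked G (insert e F) `` {tail G e}" using 1 img by simp
      then show ?thesis using e by (simp add: link_classes_def)
    next
      case 2
      then have "v \<notin> A \<union> B"
        using linked_class_eq[of G F v "tail G e"] linked_class_eq[of G F v "head G e"]
        by (auto simp: A_def B_def dest: linked_symD)
      then have "X = linked G (insert e F) `` {v}" using 2 img by simp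
      then show ?thesis using 2 by (simp add: link_classes_def)
    qed
  qed
  moreover have "A \<union> B \<notin> link_classes G F - {A, B}"
  proof
    assume "A \<union> B \<in> link_classes G F - {A, B}"
    then obtain v where v: "A \<union> B = linked G F `` {v}" by (auto simp: link_classes_def)
    have "tail G e \<in> A \<union> B" "head G e \<in> A \<union> B" by (auto simp: A_def B_def)
    then have "(v, tail G e) \<in> linked G F" "(v, head G e) \<in> linked G F" using v by auto
    then show False using sep linked_trans linked_symD by metis
  qed
  moreover have "card (link_classes G F - {A, B}) = card (link_classes G F) - 2"
    using AB by (subst card_Diff_subset) auto
  moreover have "2 \<le> card (link_classes G F)"
    using AB card_mono[OF finite_link_classes, of "{A, B}" F] by simp
  ultimately show ?thesis using finite_link_classes by simp
qed

lemma card_link_classes_empty: "card (link_classes G {}) = card (verts G)"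
proof -
  have "link_classes G {} = (\<lambda>v. {v}) ` verts G" by (simp add: link_classes_def linked_def)
  then show ?thesis by (simp add: card_image)
qed

lemma card_link_classes_le: "card (link_classes G F) \<le> card (verts G)"
  unfolding link_classes_def by (rule card_image_le) simp

lemma card_verts_le:
  assumes "F \<subseteq> arcs G"
  shows "card (verts G) \<le> card (link_classes G F) + card F"
proof -
  have "finite F" using assms finite_arcs by (rule finite_subset)
  then show ?thesis using assms
  proof (induction F rule: finite_induct)
    case empty
    then show ?case by (simp add: card_link_classes_empty)
  next
    case (insert e F)
    then show ?case
      using card_link_classes_insert[of e F] linked_insert_redundant[of e F]
      by (cases "(tail G e, head G e) \<in> linked G F") (auto simp: link_classes_def)
  qed
qed

lemma card_link_classes_forest:
  assumes "F \<subseteq> arcs G" "\<And>e. e \<in> F \<Longrightarrow> (tail G e, head G e) \<notin> linked G (F - {e})"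
  shows "card (link_classes G F) + card F = card (verts G)"
proof -
  have "finite F" using assms(1) finite_arcs by (rule finite_subset)
  then show ?thesis using assms
  proof (induction F rule: finite_induct)
    case empty
    then show ?case by (simp add: card_link_classes_empty)
  next
    case (insert e F)
    have "(tail G e', head G e') \<notin> linked G (F - {e'})" if "e' \<in> F" for e'
      using insert.prems(2)[of e'] that linked_mono[of "F - {e'}" "insert e F - {e'}" G] by blast
    moreover have "(tail G e, head G e) \<notin> linked G F"
      using insert.prems(2)[of e] insert.hyps by simp
    ultimately show ?case
      using insert card_link_classes_insert[of e F] by auto
  qed
qed

lemma reachable_symmetric_iff:
  "reachable (with_proj (mk_symmetric G)) u v \<longleftrightarrow> u \<in> verts G \<and> (u, v) \<in> linked G (arcs G)"
proof -
  interpret S: pair_fin_digraph "mk_symmetric G" by (rule pair_fin_digraph_mk_symmetric)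
  have ends: "arcs_ends (with_proj (mk_symmetric G)) = (\<Union>e\<in>arcs G. {(tail G e, head G e), (head G e, tail G e)})"
    by (auto simp: arcs_ends_conv parcs_mk_symmetric)
  show ?thesis
  proof
    assume r: "reachable (with_proj (mk_symmetric G)) u v"
    then have "u \<in> verts G" by (auto elim: reachable_in_vertsE)
    with reachable_rtranclI[OF r] show "u \<in> verts G \<and> (u, v) \<in> linked G (arcs G)"
      unfolding linked_def ends by blast
  next
    assume "u \<in> verts G \<and> (u, v) \<in> linked G (arcs G)"
    then have u: "u \<in> verts G" and "(u, v) \<in> (arcs_ends (with_proj (mk_symmetric G)))\<^sup>*"
      unfolding linked_def ends by auto
    from this(2) show "reachable (with_proj (mk_symmetric G)) u v"
    proof (induction rule: rtrancl_induct)
      case base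
      then show ?case using u by (intro S.reachable_refl) simp
    next
      case (step y z)
      show ?case by (rule S.reachable_adj_trans[OF step.IH]) (use step.hyps(2) in simp)
    qed
  qed
qed

lemma num_components_eq: "num_components G = card (link_classes G (arcs G))"
proof -
  let ?sccs = "{S. S \<noteq> {} \<and> (\<forall>u\<in>S. \<forall>v\<in>S. u \<in> verts G \<and> (u, v) \<in> linked G (arcs G)) \<and>
      (\<forall>u\<in>S. \<forall>v. v \<notin> S \<longrightarrow> \<not> (u \<in> verts G \<and> (u, v) \<in> linked G (arcs G)) \<or> \<not> (v \<in> verts G \<and> (v, u) \<in> linked G (arcs G)))}"
  have "pre_digraph.sccs_verts (with_proj (mk_symmetric G)) = link_classes G (arcs G)"
    unfolding pre_digraph.sccs_verts_def reachable_symmetric_iff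
  proof (intro equalityI subsetI)
    fix S assume "S \<in> ?sccs"
    then have ne: "S \<noteq> {}"
      and inside: "\<And>u v. u \<in> S \<Longrightarrow> v \<in> S \<Longrightarrow> u \<in> verts G \<and> (u, v) \<in> linked G (arcs G)"
      and maximal: "\<And>u v. u \<in> S \<Longrightarrow> v \<notin> S \<Longrightarrow> u \<in> verts G \<Longrightarrow> v \<in> verts G \<Longrightarrow>
        (u, v) \<in> linked G (arcs G) \<Longrightarrow> (v, u) \<notin> linked G (arcs G)"
      by simp_all
    obtain u where u: "u \<in> S" using ne by blast
    have uG: "u \<in> verts G" using inside[OF u u] by simp
    have "S = linked G (arcs G) `` {u}"
    proof (intro equalityI subsetI)
      fix w assume "w \<in> S"
      then show "w \<in> linked G (arcs G) `` {u}" using inside[OF u] by simp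
    next
      fix w assume "w \<in> linked G (arcs G) `` {u}"
      then have w: "(u, w) \<in> linked G (arcs G)" by simp
      then have "w \<in> verts G" using linked_in_verts uG by blast
      then show "w \<in> S" using maximal[OF u _ uG _ w] linked_symD[OF w] by blast
    qed
    then show "S \<in> link_classes G (arcs G)" using uG by (simp add: link_classes_def)
  next
    fix S assume "S \<in> link_classes G (arcs G)"
    then obtain w where w: "w \<in> verts G" and S: "S = linked G (arcs G) `` {w}" by (auto simp: link_classes_def)
    have "w \<in> S" using S by simp
    moreover have "u \<in> verts G \<and> (u, v) \<in> linked G (arcs G)" if "u \<in> S" "v \<in> S" for u v
    proof
      have u: "(w, u) \<in> linked G (arcs G)" and v: "(w, v) \<in> linked G (arcs G)" using that S by auto
      show "u \<in> verts G" using linked_in_verts[OF order.refl u w] .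
      show "(u, v) \<in> linked G (arcs G)" by (rule linked_trans[OF linked_symD[OF u] v])
    qed
    moreover have "(u, v) \<notin> linked G (arcs G)" if "u \<in> S" "v \<notin> S" for u v
      using that S linked_trans[of w u G "arcs G" v] by auto
    ultimately show "S \<in> ?sccs"
      by (intro CollectI conjI) auto
  qed
  then show ?thesis by (simp add: num_components_def)
qed

lemma excess_unit:
  assumes "e \<in> arcs G"
  shows "excess G (unit_vec e) v = cut_vector G {v} e"
proof -
  have "excess G (unit_vec e) v = (\<Sum>i\<in>arcs G. if i = e then cut_vector G {v} e else 0)"
    unfolding excess_def by (intro sum.cong) (auto simp: unit_vec_def)
  then show ?thesis using assms by simp
qed

lemma path_flow:
  assumes "(u, v) \<in> linked G F" "F \<subseteq> arcs G"
  shows "\<exists>x. (\<forall>e. e \<notin> F \<longrightarrow> x e = 0) \<and> (\<forall>w. excess G x w = of_bool (w = v) - of_bool (w = u))"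
  using assms(1) unfolding linked_def
proof (induction rule: rtrancl_induct)
  case base
  show ?case by (intro exI[of _ 0]) (simp add: excess_def)
next
  case (step y z)
  then obtain x where x: "\<And>e. e \<notin> F \<Longrightarrow> x e = 0"
    "\<And>w. excess G x w = of_bool (w = y) - of_bool (w = u)" by blast
  obtain e where e: "e \<in> F" "(y, z) = (tail G e, head G e) \<or> (y, z) = (head G e, tail G e)"
    using step.hyps(2) by blast
  have eG: "e \<in> arcs G" using e assms(2) by blast
  from e(2) show ?case
  proof
    assume yz: "(y, z) = (tail G e, head G e)"
    have "\<forall>e'. e' \<notin> F \<longrightarrow> (x + unit_vec e) e' = 0" using x(1) e(1) by (auto simp: unit_vec_def)
    moreover have "\<forall>w. excess G (x + unit_vec e) w = of_bool (w = z) - of_bool (w = u)"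
      using yz unfolding excess_add x(2) excess_unit[OF eG] by (auto simp: cut_vector_def)
    ultimately show ?thesis by blast
  next
    assume yz: "(y, z) = (head G e, tail G e)"
    have "\<forall>e'. e' \<notin> F \<longrightarrow> (x + - unit_vec e) e' = 0" using x(1) e(1) by (auto simp: unit_vec_def)
    moreover have "\<forall>w. excess G (x + - unit_vec e) w = of_bool (w = z) - of_bool (w = u)"
      using yz unfolding excess_add x(2) excess_uminus excess_unit[OF eG] by (auto simp: cut_vector_def)
    ultimately show ?thesis by blast
  qed
qed

text \<open>
  The net flow into a vertex set is the sum of the excesses of its vertices.
\<close>

lemma cut_zero:
  assumes "x \<in> circulations G" "X \<subseteq> verts G"
  shows "(\<Sum>e\<in>arcs G. cut_vector G X e * x e) = 0"
proof -
  have finX: "finite X" using assms(2) finite_verts by (rule finite_subset)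
  have cut: "cut_vector G X e = (\<Sum>v\<in>X. cut_vector G {v} e)" for e
    using finX by (simp add: cut_vector_def sum_subtractf of_bool_def eq_commute)
  have "(\<Sum>e\<in>arcs G. cut_vector G X e * x e) = (\<Sum>v\<in>X. excess G x v)"
    unfolding cut excess_def sum_distrib_right by (rule sum.swap)
  also have "\<dots> = 0" using assms by (intro sum.neutral) (auto simp: circulations_def)
  finally show ?thesis .
qed

lemma circulation_zero: "0 \<in> circulations G"
  by (simp add: circulations_def excess_def)

lemma circulation_add: "x \<in> circulations G \<Longrightarrow> y \<in> circulations G \<Longrightarrow> x + y \<in> circulations G"
  by (simp add: circulations_def excess_add)

lemma circulation_uminus: "x \<in> circulations G \<Longrightarrow> - x \<in> circulations G"
  by (simp add: circulations_def excess_uminus)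

section \<open>The unimodular lattice of circulations\<close>

abbreviation sides :: "('b \<times> bool) set" where
  "sides \<equiv> arcs G \<times> UNIV"

definition flow_lattice :: "('b \<times> bool \<Rightarrow> int) set" where
  "flow_lattice = signed_pair ` circulations G"

lemma dot_signed_pair: "dot sides l (signed_pair x) = (\<Sum>e\<in>arcs G. (l (e, True) - l (e, False)) * x e)"
proof -
  have "dot sides l (signed_pair x) = (\<Sum>e\<in>arcs G. \<Sum>b\<in>UNIV. l (e, b) * signed_pair x (e, b))"
    unfolding dot_def by (subst sum.cartesian_product) (simp add: case_prod_unfold)
  also have "\<dots> = (\<Sum>e\<in>arcs G. (l (e, True) - l (e, False)) * x e)"
    by (intro sum.cong) (auto simp: UNIV_bool signed_pair_def algebra_simps)
  finally show ?thesis .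
qed

text \<open>
  The graphic meaning of \<open>spans\<close>: the prescribed values on edges that are not free can be chosen
  independently, because each can be completed to a circulation through free edges.
\<close>

definition connecting :: "('b \<times> bool) set \<Rightarrow> bool" where
  "connecting B \<longleftrightarrow> (\<forall>e\<in>arcs G. ((e, True) \<in> B \<or> (e, False) \<in> B) \<and> (tail G e, head G e) \<in> linked G (free_arcs B))"

lemma free_arcs_subset: "B \<subseteq> sides \<Longrightarrow> free_arcs B \<subseteq> arcs G"
  by (auto simp: free_arcs_def)

text \<open>
  If both bounds of an edge are missing from \<open>B\<close>, the sum of its two coordinates is such a form.
  Otherwise the free edges leave the ends of some edge in different classes, and the flow through the
  cut around one class involves only prescribed values.
\<close>

lemma separating_functional:
  assumes B: "B \<subseteq> sides" and "\<not> connecting B"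
  shows "\<exists>l. (\<forall>j\<in>B. l j = 0) \<and> (\<forall>z\<in>flow_lattice. dot sides l z = 0) \<and> (\<exists>j\<in>sides. l j \<noteq> 0)"
proof (cases "\<forall>e\<in>arcs G. (e, True) \<in> B \<or> (e, False) \<in> B")
  case False
  then obtain e where e: "e \<in> arcs G" "(e, True) \<notin> B" "(e, False) \<notin> B" by blast
  define l :: "'b \<times> bool \<Rightarrow> int" where "l = (\<lambda>(e', b). if e' = e then 1 else 0)"
  have "l (e', True) - l (e', False) = 0" for e' by (simp add: l_def)
  then have "dot sides l z = 0" if "z \<in> flow_lattice" for z
    using that by (auto simp: flow_lattice_def dot_signed_pair)
  moreover have "l j = 0" if "j \<in> B" for j
    using that e by (cases j; cases "snd j") (auto simp: l_def)
  moreover have "(e, True) \<in> sides" "l (e, True) \<noteq> 0" using e by (auto simp: l_def)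
  ultimately show ?thesis by (intro exI[of _ l]) blast
next
  case True
  then obtain e where e: "e \<in> arcs G" "(tail G e, head G e) \<notin> linked G (free_arcs B)"
    using assms(2) by (auto simp: connecting_def)
  define X where "X = linked G (free_arcs B) `` {tail G e}"
  have "X \<subseteq> verts G" using linked_in_verts[OF free_arcs_subset[OF B]] e(1) by (auto simp: X_def)
  have cut_free: "cut_vector G X e' = 0" if "e' \<in> free_arcs B" for e'
    unfolding X_def using that by (rule cut_vector_class)
  define l :: "'b \<times> bool \<Rightarrow> int" where
    "l = (\<lambda>(e', b). if (e', b) \<in> B then 0 else if b then cut_vector G X e' else - cut_vector G X e')"
  have l: "l (e', True) - l (e', False) = cut_vector G X e'" if "e' \<in> arcs G" for e'
    using that True cut_free[of e'] by (auto simp: l_def free_arcs_def)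
  have "dot sides l z = 0" if "z \<in> flow_lattice" for z
  proof -
    obtain x where x: "x \<in> circulations G" "z = signed_pair x" using \<open>z \<in> flow_lattice\<close> by (auto simp: flow_lattice_def)
    have "dot sides l z = (\<Sum>e\<in>arcs G. cut_vector G X e * x e)"
      unfolding x(2) dot_signed_pair by (intro sum.cong) (auto simp: l)
    then show ?thesis using cut_zero[OF x(1) \<open>X \<subseteq> verts G\<close>] by simp
  qed
  moreover have "l j = 0" if "j \<in> B" for j using that by (cases j) (auto simp: l_def)
  moreover have "\<exists>j\<in>sides. l j \<noteq> 0"
  proof -
    have "cut_vector G X e = - 1" using e by (simp add: cut_vector_def X_def)
    then have "l (e, True) \<noteq> 0 \<or> l (e, False) \<noteq> 0" using l[OF e(1)] by auto
    then show ?thesis using e(1) by blast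
  qed
  ultimately show ?thesis by blast
qed

lemma spans_iff_connecting:
  assumes B: "B \<subseteq> sides"
  shows "spans sides flow_lattice B \<longleftrightarrow> connecting B"
proof
  assume spans: "spans sides flow_lattice B"
  show "connecting B"
  proof (rule ccontr)
    assume "\<not> connecting B"
    then obtain l j where l: "\<forall>j\<in>B. l j = 0" "\<forall>z\<in>flow_lattice. dot sides l z = 0"
      and j: "j \<in> sides" "l j \<noteq> 0" using separating_functional[OF B] by blast
    have "j \<in> sides - B" using l j by blast
    then obtain z where z: "z \<in> flow_lattice" "z j = 1" "\<forall>i\<in>sides - B - {j}. z i = 0"
      using spans unfolding spans_def by blast
    have "dot sides l z = (\<Sum>i\<in>sides. if i = j then l j else 0)"
      unfolding dot_def using z l(1) by (intro sum.cong) auto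
    then have "dot sides l z = l j" using j(1) by simp
    then show False using l(2) z(1) j(2) by simp
  qed
next
  assume linked: "connecting B"
  show "spans sides flow_lattice B"
    unfolding spans_def
  proof (intro conjI ballI)
    fix j assume j: "j \<in> sides - B"
    obtain e b where eb: "j = (e, b)" by (cases j)
    have e: "e \<in> arcs G" "e \<notin> free_arcs B" using j eb by (auto simp: free_arcs_def) (metis (full_types))+
    obtain p where p: "\<And>e. e \<notin> free_arcs B \<Longrightarrow> p e = 0"
      "\<And>w. excess G p w = of_bool (w = tail G e) - of_bool (w = head G e)"
      using path_flow[OF linked_symD free_arcs_subset[OF B]] linked e(1) by (auto simp: connecting_def) blast
    define x where "x = p + unit_vec e"
    have x: "x \<in> circulations G"
      unfolding circulations_def
    proof (intro CollectI conjI allI impI ballI)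
      show "x e' = 0" if "e' \<notin> arcs G" for e'
        using that p(1)[of e'] free_arcs_subset[OF B] e(1) by (auto simp: x_def unit_vec_def)
      show "excess G x v = 0" for v
        unfolding x_def excess_add p(2) excess_unit[OF e(1)] by (auto simp: cut_vector_def)
    qed
    define y where "y = (if b then x else - x)"
    have "signed_pair y \<in> flow_lattice" using x circulation_uminus by (auto simp: flow_lattice_def y_def)
    moreover have "signed_pair y j = 1" using p(1)[OF e(2)] by (simp add: eb y_def x_def signed_pair_def unit_vec_def)
    moreover have "signed_pair y i = 0" if i: "i \<in> sides - B - {j}" for i
    proof -
      obtain e' b' where i': "i = (e', b')" by (cases i)
      have "e' \<notin> free_arcs B" using i i' by (auto simp: free_arcs_def) (metis (full_types))+
      moreover have "e' \<noteq> e"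
      proof
        assume "e' = e"
        then have "b' = (\<not> b)" using i i' eb by auto
        then show False using linked e(1) i j i' eb \<open>e' = e\<close> by (cases b) (auto simp: connecting_def)
      qed
      ultimately show ?thesis using p(1) by (simp add: i' y_def x_def signed_pair_def unit_vec_def)
    qed
    ultimately show "\<exists>z\<in>flow_lattice. z j = 1 \<and> (\<forall>i\<in>sides - B - {j}. z i = 0)" by blast
  qed (rule B)
qed

lemma connecting_linked:
  assumes "B \<subseteq> sides" "connecting B"
  shows "linked G (free_arcs B) = linked G (arcs G)"
proof
  show "linked G (free_arcs B) \<subseteq> linked G (arcs G)" by (rule linked_mono[OF free_arcs_subset[OF assms(1)]])
  show "linked G (arcs G) \<subseteq> linked G (free_arcs B)"
    using assms(2) by (intro linked_least) (auto simp: connecting_def)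
qed

lemma connecting_remove:
  assumes B: "B \<subseteq> sides" "connecting B" and e: "e \<in> free_arcs B"
    and "(tail G e, head G e) \<in> linked G (free_arcs B - {e})"
  shows "connecting (B - {(e, b)})"
proof -
  have free_arcs: "free_arcs (B - {(e, b)}) = free_arcs B - {e}" by (cases b) (auto simp: free_arcs_def)
  have "linked G (free_arcs B - {e}) = linked G (free_arcs B)"
    using linked_insert_redundant[OF assms(4)] e by (simp add: insert_absorb)
  then show ?thesis
    unfolding connecting_def free_arcs using B(2) e by (auto simp: connecting_def free_arcs_def)
qed

lemma signed_pair_add: "signed_pair (x + y) = signed_pair x + signed_pair y"
  by (auto simp: signed_pair_def)

lemma signed_pair_uminus: "signed_pair (- x) = - signed_pair x"
  by (auto simp: signed_pair_def)

lemma inj_signed_pair: "inj signed_pair"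
proof (rule injI, rule ext)
  fix x y :: "'e \<Rightarrow> int" and e assume "signed_pair x = signed_pair y"
  then have "signed_pair x (e, True) = signed_pair y (e, True)" by simp
  then show "x e = y e" by (simp add: signed_pair_def)
qed

lemma finite_circulations_bounded:
  "finite {x \<in> circulations G. \<forall>e\<in>arcs G. - n (e, True) \<le> x e \<and> x e \<le> n (e, False)}"
proof (rule finite_subset)
  let ?R = "\<Union>e\<in>arcs G. {- n (e, True)..n (e, False)}"
  show "finite {x. \<forall>e. (e \<in> arcs G \<longrightarrow> x e \<in> ?R) \<and> (e \<notin> arcs G \<longrightarrow> x e = 0)}"
    by (rule finite_set_of_finite_funs) auto
qed (auto simp: circulations_def)

lemma flow_lattice_bounded:
  "{z \<in> flow_lattice. \<forall>j\<in>sides. 0 \<le> z j + n j} =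
    signed_pair ` {x \<in> circulations G. \<forall>e\<in>arcs G. - n (e, True) \<le> x e \<and> x e \<le> n (e, False)}"
proof -
  have "(\<forall>j\<in>sides. 0 \<le> signed_pair x j + n j) \<longleftrightarrow> (\<forall>e\<in>arcs G. - n (e, True) \<le> x e \<and> x e \<le> n (e, False))" for x
    by (auto simp: signed_pair_def all_bool_eq)
  then show ?thesis by (auto simp: flow_lattice_def)
qed

lemma card_connecting:
  assumes "B \<subseteq> sides" "connecting B"
  shows "card B = card (arcs G) + card (free_arcs B)"
proof -
  let ?T = "{e. (e, True) \<in> B}" and ?F = "{e. (e, False) \<in> B}"
  have T: "?T \<subseteq> arcs G" "?F \<subseteq> arcs G" using assms(1) by auto
  have fin: "finite ?T" "finite ?F" using T finite_arcs by (auto intro: finite_subset)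
  have "B = (\<lambda>e. (e, True)) ` ?T \<union> (\<lambda>e. (e, False)) ` ?F"
  proof (intro equalityI subsetI)
    fix j assume "j \<in> B"
    then show "j \<in> (\<lambda>e. (e, True)) ` ?T \<union> (\<lambda>e. (e, False)) ` ?F"
      by (cases j; cases "snd j") auto
  qed auto
  also have "card \<dots> = card ?T + card ?F"
    using fin by (subst card_Un_disjoint) (auto simp: card_image inj_on_def)
  also have "\<dots> = card (?T \<union> ?F) + card (?T \<inter> ?F)" using fin by (rule card_Un_Int)
  also have "?T \<union> ?F = arcs G" using T assms(2) by (auto simp: connecting_def)
  also have "?T \<inter> ?F = free_arcs B" by (auto simp: free_arcs_def)
  finally show ?thesis .
qed

definition lattice_rank :: nat where
  "lattice_rank = card (arcs G) + card (verts G) - card (link_classes G (arcs G))"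

text \<open>
  For \<open>exchange\<close>: if removing a free edge \<open>e\<close> disconnected its ends, then \<open>e\<close> would be the only free edge in
  a cut, and a circulation supported on free edges would vanish on it. A minimal connecting set has a
  spanning forest as its set of free edges, which determines its size.
\<close>

lemma unimodular_flow_lattice: "unimodular_lattice sides flow_lattice lattice_rank"
proof
  show "finite sides" by simp
  show "0 \<in> flow_lattice"
    using circulation_zero by (auto simp: flow_lattice_def signed_pair_def image_iff fun_eq_iff intro!: bexI[of _ 0])
  show "y + z \<in> flow_lattice" if "y \<in> flow_lattice" "z \<in> flow_lattice" for y z
    using that circulation_add unfolding flow_lattice_def by (metis (no_types, lifting) imageE imageI signed_pair_add)
  show "- z \<in> flow_lattice" if "z \<in> flow_lattice" for z
    using that circulation_uminus unfolding flow_lattice_def by (metis (no_types, lifting) imageE imageI signed_pair_uminus)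
  show "z j = 0" if "z \<in> flow_lattice" "j \<notin> sides" for z j
    using that by (cases j) (auto simp: flow_lattice_def signed_pair_def circulations_def)
  show "finite {z \<in> flow_lattice. \<forall>j\<in>sides. 0 \<le> z j + n j}" for n
    unfolding flow_lattice_bounded by (rule finite_imageI[OF finite_circulations_bounded])
next
  fix B z j
  assume spans: "spans sides flow_lattice B" and z: "z \<in> flow_lattice" "\<And>i. i \<in> sides - B \<Longrightarrow> z i = 0"
    and j: "j \<in> B" "z j \<noteq> 0"
  have B: "B \<subseteq> sides" using spans by (simp add: spans_def)
  have linked: "connecting B" using spans spans_iff_connecting[OF B] by simp
  obtain x where x: "x \<in> circulations G" "z = signed_pair x" using z(1) by (auto simp: flow_lattice_def)
  obtain e b where eb: "j = (e, b)" by (cases j)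
  have xe: "x e \<noteq> 0" using j(2) eb x(2) by (auto simp: signed_pair_def split: if_splits)
  have x0: "x e' = 0" if nf: "e' \<notin> free_arcs B" for e'
  proof (cases "e' \<in> arcs G")
    case True
    have "(e', True) \<notin> B \<or> (e', False) \<notin> B" using nf by (simp add: free_arcs_def)
    then obtain b' where "(e', b') \<in> sides - B" using True by blast
    then show ?thesis using z(2)[of "(e', b')"] x(2) by (auto simp: signed_pair_def split: if_splits)
  next
    case False
    then show ?thesis using x(1) by (simp add: circulations_def)
  qed
  have e: "e \<in> free_arcs B" "e \<in> arcs G" using x0 xe free_arcs_subset[OF B] by blast+
  have "(tail G e, head G e) \<in> linked G (free_arcs B - {e})"
  proof (rule ccontr)
    assume sep: "(tail G e, head G e) \<notin> linked G (free_arcs B - {e})"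
    define X where "X = linked G (free_arcs B - {e}) `` {tail G e}"
    have sub: "free_arcs B - {e} \<subseteq> arcs G" using free_arcs_subset[OF B] by blast
    have "X \<subseteq> verts G" using linked_in_verts[OF sub] e(2) by (auto simp: X_def)
    have "cut_vector G X e' * x e' = (if e' = e then - x e else 0)" for e'
    proof (cases "e' \<in> free_arcs B - {e}")
      case True
      then have "cut_vector G X e' = 0" unfolding X_def by (rule cut_vector_class)
      then show ?thesis using True by simp
    next
      case False
      then show ?thesis using x0[of e'] sep by (auto simp: cut_vector_def X_def)
    qed
    then have "(\<Sum>e'\<in>arcs G. cut_vector G X e' * x e') = - x e" using e(2) by simp
    then show False using cut_zero[OF x(1) \<open>X \<subseteq> verts G\<close>] xe by simp
  qed
  then have "connecting (B - {j})" unfolding eb by (rule connecting_remove[OF B linked e(1)])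
  moreover have "B - {j} \<subseteq> sides" using B by blast
  ultimately show "spans sides flow_lattice (B - {j})" using spans_iff_connecting by blast
next
  fix B assume spans: "spans sides flow_lattice B"
    and minimal: "\<And>j. j \<in> B \<Longrightarrow> \<not> spans sides flow_lattice (B - {j})"
  have B: "B \<subseteq> sides" using spans by (simp add: spans_def)
  have linked: "connecting B" using spans spans_iff_connecting[OF B] by simp
  have "(tail G e, head G e) \<notin> linked G (free_arcs B - {e})" if "e \<in> free_arcs B" for e
  proof
    assume "(tail G e, head G e) \<in> linked G (free_arcs B - {e})"
    then have "connecting (B - {(e, True)})" by (rule connecting_remove[OF B linked that])
    moreover have "B - {(e, True)} \<subseteq> sides" using B by blast
    ultimately have "spans sides flow_lattice (B - {(e, True)})" using spans_iff_connecting by blast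
    then show False using minimal[of "(e, True)"] that by (simp add: free_arcs_def)
  qed
  then have "card (link_classes G (free_arcs B)) + card (free_arcs B) = card (verts G)"
    by (rule card_link_classes_forest[OF free_arcs_subset[OF B]])
  moreover have "link_classes G (free_arcs B) = link_classes G (arcs G)"
    using connecting_linked[OF B linked] by (simp add: link_classes_def)
  ultimately show "card B = lattice_rank"
    using card_connecting[OF B linked] by (simp add: lattice_rank_def)
qed

end


section \<open>Multivariate polynomial functions\<close>

lemma monomial_superset:
  fixes m :: "'e \<Rightarrow>\<^sub>0 nat" and x :: "'e \<Rightarrow> rat"
  assumes "finite A" "Poly_Mapping.keys m \<subseteq> A"
  shows "(\<Prod>e\<in>Poly_Mapping.keys m. x e ^ Poly_Mapping.lookup m e) = (\<Prod>e\<in>A. x e ^ Poly_Mapping.lookup m e)"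
  using assms by (intro prod.mono_neutral_left) (auto simp: in_keys_iff)

lemma mpoly_eval_superset:
  assumes "finite A" "Poly_Mapping.keys p \<subseteq> A"
  shows "mpoly_eval p x = (\<Sum>m\<in>A. Poly_Mapping.lookup p m * (\<Prod>e\<in>Poly_Mapping.keys m. x e ^ Poly_Mapping.lookup m e))"
  unfolding mpoly_eval_def using assms by (intro sum.mono_neutral_left) (auto simp: in_keys_iff)

lemma mpoly_eval_add: "mpoly_eval (p + q) x = mpoly_eval p x + mpoly_eval q x"
proof -
  let ?A = "Poly_Mapping.keys p \<union> Poly_Mapping.keys q"
  have "Poly_Mapping.keys (p + q) \<subseteq> ?A" by (rule Poly_Mapping.keys_add)
  then show ?thesis
    using mpoly_eval_superset[of ?A "p + q" x] mpoly_eval_superset[of ?A p x] mpoly_eval_superset[of ?A q x]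
    by (simp add: lookup_add algebra_simps sum.distrib)
qed

lemma mpoly_eval_zero: "mpoly_eval 0 x = 0"
  by (simp add: mpoly_eval_def)

lemma mpoly_eval_sum: "finite I \<Longrightarrow> mpoly_eval (\<Sum>i\<in>I. p i) x = (\<Sum>i\<in>I. mpoly_eval (p i) x)"
  by (induction I rule: finite_induct) (simp_all add: mpoly_eval_zero mpoly_eval_add)

lemma mpoly_eval_single:
  "mpoly_eval (Poly_Mapping.single m c) x = c * (\<Prod>e\<in>Poly_Mapping.keys m. x e ^ Poly_Mapping.lookup m e)"
  by (simp add: mpoly_eval_def)

lemma mpoly_eval_cong: "(\<And>e. e \<in> mpoly_vars p \<Longrightarrow> x e = y e) \<Longrightarrow> mpoly_eval p x = mpoly_eval p y"
  unfolding mpoly_eval_def mpoly_vars_def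
  by (intro sum.cong arg_cong2[where f = "(*)"] prod.cong refl arg_cong2[where f = "(^)"]) blast

lemma mpoly_eval_line: "\<exists>q. \<forall>t. mpoly_eval p (\<lambda>e. x e + t * y e) = poly q t"
proof
  show "\<forall>t. mpoly_eval p (\<lambda>e. x e + t * y e) =
    poly (\<Sum>m\<in>Poly_Mapping.keys p. smult (Poly_Mapping.lookup p m) (\<Prod>e\<in>Poly_Mapping.keys m. [:x e, y e:] ^ Poly_Mapping.lookup m e)) t"
    by (simp add: mpoly_eval_def poly_sum poly_prod)
qed

definition polynomial_function :: "'e set \<Rightarrow> (('e \<Rightarrow> int) \<Rightarrow> rat) \<Rightarrow> bool" where
  "polynomial_function E F \<longleftrightarrow> (\<exists>p. mpoly_vars p \<subseteq> E \<and> (\<forall>k. F k = mpoly_eval p (\<lambda>e. of_int (k e))))"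

lemma polynomial_function_const: "polynomial_function E (\<lambda>k. c)"
  unfolding polynomial_function_def
  by (intro exI[of _ "Poly_Mapping.single 0 c"]) (auto simp: mpoly_eval_single mpoly_vars_def)

lemma polynomial_function_add:
  assumes "polynomial_function E F" "polynomial_function E H"
  shows "polynomial_function E (\<lambda>k. F k + H k)"
proof -
  obtain p q where "mpoly_vars p \<subseteq> E" "\<And>k. F k = mpoly_eval p (\<lambda>e. of_int (k e))"
    "mpoly_vars q \<subseteq> E" "\<And>k. H k = mpoly_eval q (\<lambda>e. of_int (k e))"
    using assms unfolding polynomial_function_def by blast
  moreover have "mpoly_vars (p + q) \<subseteq> mpoly_vars p \<union> mpoly_vars q"
    unfolding mpoly_vars_def using Poly_Mapping.keys_add[of p q] by blast
  ultimately show ?thesis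
    unfolding polynomial_function_def by (intro exI[of _ "p + q"]) (auto simp: mpoly_eval_add)
qed

lemma polynomial_function_sum:
  "finite I \<Longrightarrow> (\<And>i. i \<in> I \<Longrightarrow> polynomial_function E (F i)) \<Longrightarrow> polynomial_function E (\<lambda>k. \<Sum>i\<in>I. F i k)"
  by (induction I rule: finite_induct) (simp_all add: polynomial_function_const polynomial_function_add)

lemma polynomial_function_scale:
  assumes "polynomial_function E F"
  shows "polynomial_function E (\<lambda>k. c * F k)"
proof -
  obtain p where p: "mpoly_vars p \<subseteq> E" "\<And>k. F k = mpoly_eval p (\<lambda>e. of_int (k e))"
    using assms unfolding polynomial_function_def by blast
  define q where "q = (\<Sum>m\<in>Poly_Mapping.keys p. Poly_Mapping.single m (c * Poly_Mapping.lookup p m))"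
  have "c * F k = mpoly_eval q (\<lambda>e. of_int (k e))" for k
    unfolding q_def p(2) mpoly_eval_sum[OF finite_keys] mpoly_eval_single
    by (simp add: mpoly_eval_def sum_distrib_left mult.assoc)
  moreover have "Poly_Mapping.keys q \<subseteq> Poly_Mapping.keys p"
    unfolding q_def by (rule order.trans[OF keys_sum]) (auto split: if_splits)
  then have "mpoly_vars q \<subseteq> E" using p(1) by (auto simp: mpoly_vars_def)
  ultimately show ?thesis unfolding polynomial_function_def by blast
qed

lemma polynomial_function_times_coordinate:
  assumes "e \<in> E" "polynomial_function E F"
  shows "polynomial_function E (\<lambda>k. of_int (k e) * F k)"
proof -
  obtain p where p: "mpoly_vars p \<subseteq> E" "\<And>k. F k = mpoly_eval p (\<lambda>e. of_int (k e))"
    using assms(2) unfolding polynomial_function_def by blast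
  define s :: "'a \<Rightarrow>\<^sub>0 nat" where "s = Poly_Mapping.single e 1"
  define q where "q = (\<Sum>m\<in>Poly_Mapping.keys p. Poly_Mapping.single (m + s) (Poly_Mapping.lookup p m))"
  have mono: "(\<Prod>i\<in>Poly_Mapping.keys (m + s). x i ^ Poly_Mapping.lookup (m + s) i) =
      x e * (\<Prod>i\<in>Poly_Mapping.keys m. x i ^ Poly_Mapping.lookup m i)" for m and x :: "'a \<Rightarrow> rat"
  proof -
    let ?A = "insert e (Poly_Mapping.keys m)"
    have "Poly_Mapping.keys (m + s) \<subseteq> ?A"
      using Poly_Mapping.keys_add[of m s] by (auto simp: s_def)
    then have "(\<Prod>i\<in>Poly_Mapping.keys (m + s). x i ^ Poly_Mapping.lookup (m + s) i)
        = (\<Prod>i\<in>?A. x i ^ Poly_Mapping.lookup (m + s) i)"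
      by (intro monomial_superset) auto
    also have "\<dots> = (\<Prod>i\<in>?A. x i ^ Poly_Mapping.lookup m i * (if i = e then x e else 1))"
      by (intro prod.cong) (auto simp: lookup_add s_def lookup_single when_def)
    also have "\<dots> = (\<Prod>i\<in>?A. x i ^ Poly_Mapping.lookup m i) * (\<Prod>i\<in>?A. if i = e then x e else 1)"
      by (rule prod.distrib)
    also have "(\<Prod>i\<in>?A. if i = e then x e else 1) = x e"
      by (subst prod.delta) auto
    also have "(\<Prod>i\<in>?A. x i ^ Poly_Mapping.lookup m i) =
        (\<Prod>i\<in>Poly_Mapping.keys m. x i ^ Poly_Mapping.lookup m i)"
      by (intro monomial_superset[symmetric]) auto
    finally show ?thesis by (simp only: mult.commute[of _ "x e"])
  qed
  have "of_int (k e) * F k = mpoly_eval q (\<lambda>e. of_int (k e))" for k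
    unfolding q_def p(2) mpoly_eval_sum[OF finite_keys] mpoly_eval_single mono
    by (simp add: mpoly_eval_def sum_distrib_left mult.left_commute)
  moreover have "mpoly_vars q \<subseteq> E"
  proof -
    have keys_q: "Poly_Mapping.keys q \<subseteq> (\<lambda>m. m + s) ` Poly_Mapping.keys p"
      unfolding q_def by (rule order.trans[OF keys_sum]) (auto split: if_splits)
    show ?thesis
    proof
      fix i assume "i \<in> mpoly_vars q"
      then obtain m where m: "m \<in> Poly_Mapping.keys p" "i \<in> Poly_Mapping.keys (m + s)"
        using keys_q by (auto simp: mpoly_vars_def)
      then have "i = e \<or> i \<in> Poly_Mapping.keys m"
        using Poly_Mapping.keys_add[of m s] by (auto simp: s_def)
      then show "i \<in> E" using assms(1) p(1) m(1) by (auto simp: mpoly_vars_def)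
    qed
  qed
  ultimately show ?thesis unfolding polynomial_function_def by blast
qed

lemma gbinomial_times_recursion:
  "((x :: rat) gchoose Suc i) * c =
    (1 / of_nat (Suc i)) * (x * ((x gchoose i) * c) + (- of_nat i) * ((x gchoose i) * c))"
proof -
  have "x * (a * c) + (- m) * (a * c) = s * (b * c)" if "x * a = m * a + s * b" for a b m s :: rat
    using that by algebra
  note this[OF gbinomial_mult_1[of x i]]
  then show ?thesis by (metis nonzero_eq_divide_eq of_nat_neq_0 mult.commute mult_1 times_divide_eq_left)
qed

lemma polynomial_function_times_gbinomial:
  assumes "e \<in> E" "polynomial_function E F"
  shows "polynomial_function E (\<lambda>k. (of_int (k e) gchoose i) * F k)"
proof (induction i)
  case (Suc i)
  have "polynomial_function E (\<lambda>k. (1 / of_nat (Suc i)) *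
      (of_int (k e) * ((of_int (k e) gchoose i) * F k) + (- of_nat i) * ((of_int (k e) gchoose i) * F k)))"
    by (intro polynomial_function_scale polynomial_function_add polynomial_function_times_coordinate assms(1) Suc)
  then show ?case unfolding gbinomial_times_recursion .
qed (use assms in simp)

lemma vanishing_difference:
  "vanishing J {} D h \<Longrightarrow> vanishing J {} D (\<lambda>n. h (n + v) - h n)"
  using vanishing_add[OF vanishing_shift[OF finite.emptyI] vanishing_uminus] by simp

lemma vanishing_compose:
  assumes "\<And>u v. \<phi> (u + v) = \<phi> u + \<phi> v"
  shows "vanishing J {} D h \<Longrightarrow> vanishing J' {} D (\<lambda>n. h (\<phi> n))"
proof (induction D arbitrary: h)
  case (Suc D)
  have "vanishing J' {} D (\<lambda>n. h (\<phi> n + \<phi> v) - h (\<phi> n))" for v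
    using Suc.IH[of "\<lambda>n. h (n + \<phi> v) - h n"] Suc.prems by simp
  then show ?case by (simp add: assms)
qed (simp add: deep_def)

lemma vanishing_funpow:
  "vanishing J {} D h \<Longrightarrow> ((\<lambda>g n. g (n + v) - g n) ^^ D) h n = 0"
proof (induction D arbitrary: h)
  case (Suc D)
  show ?case
    unfolding funpow_Suc_right comp_apply by (rule Suc.IH) (use Suc.prems[unfolded vanishing.simps] in blast)
qed (simp add: deep_def)

text \<open>
  Newton interpolation in one coordinate after the other.
\<close>

lemma polynomial_function_of_vanishing:
  assumes "finite E"
  shows "vanishing J {} D F \<Longrightarrow> (\<And>k k'. (\<And>e. e \<in> E \<Longrightarrow> k e = k' e) \<Longrightarrow> F k = F k') \<Longrightarrow> polynomial_function E F"
  using assms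
proof (induction E arbitrary: F rule: finite_induct)
  case empty
  have const: "F k = F 0" for k by (rule empty.prems(2)) simp
  obtain p :: "'a rat_mpoly" where p: "mpoly_vars p \<subseteq> {} \<and> (\<forall>k. F 0 = mpoly_eval p (\<lambda>e. of_int (k e)))"
    using polynomial_function_const[of "{} :: 'a set" "F 0"] unfolding polynomial_function_def by (rule exE)
  show ?case
    unfolding polynomial_function_def
  proof (intro exI[of _ p] conjI allI)
    show "F k = mpoly_eval p (\<lambda>e. of_int (k e))" for k
      using p const[of k] by (auto intro: trans)
  qed (use p in blast)
next
  case (insert e E)
  let ?\<Delta> = "\<lambda>g n. g (n + unit_vec e) - g n"
  define \<phi> where "\<phi> = (\<lambda>k :: 'a \<Rightarrow> int. k(e := 0))"
  have \<phi>_add: "\<phi> (u + v) = \<phi> u + \<phi> v" for u v by (auto simp: \<phi>_def)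
  have iter: "vanishing J {} D ((?\<Delta> ^^ i) F)" for i
  proof (induction i)
    case 0
    show ?case unfolding funpow.simps id_apply by (rule insert.prems(1))
  next
    case (Suc i)
    show ?case unfolding funpow.simps comp_apply by (rule vanishing_difference[OF Suc])
  qed
  have cong: "(?\<Delta> ^^ i) F k = (?\<Delta> ^^ i) F k'" if "\<And>e'. e' \<in> insert e E \<Longrightarrow> k e' = k' e'" for i k k'
    using that
  proof (induction i arbitrary: k k')
    case 0
    show ?case unfolding funpow.simps id_apply by (rule insert.prems(2)) (rule 0)
  next
    case (Suc i)
    have a: "(?\<Delta> ^^ i) F k = (?\<Delta> ^^ i) F k'"
      by (rule Suc.IH) (rule Suc.prems)
    have b: "(?\<Delta> ^^ i) F (k + unit_vec e) = (?\<Delta> ^^ i) F (k' + unit_vec e)"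
      by (rule Suc.IH) (simp add: Suc.prems)
    show ?case unfolding funpow.simps comp_apply by (simp only: a b)
  qed
  have G: "polynomial_function E (\<lambda>k. (?\<Delta> ^^ i) F (\<phi> k))" for i
  proof (rule insert.IH)
    show "vanishing J {} D (\<lambda>k. (?\<Delta> ^^ i) F (\<phi> k))"
      by (rule vanishing_compose[OF \<phi>_add iter])
    show "(?\<Delta> ^^ i) F (\<phi> k) = (?\<Delta> ^^ i) F (\<phi> k')" if "\<And>e. e \<in> E \<Longrightarrow> k e = k' e" for k k'
      using that by (intro cong) (auto simp: \<phi>_def)
  qed
  have mono: "polynomial_function (insert e E) H" if "polynomial_function E H" for H
    using that unfolding polynomial_function_def by blast
  have expand: "F k = (\<Sum>i<D. (of_int (k e) gchoose i) * (?\<Delta> ^^ i) F (\<phi> k))" for k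
  proof -
    define H where "H = (\<lambda>t. F (k(e := t)))"
    have line: "((\<lambda>g x. g (x + 1) - g x) ^^ i) H t = (?\<Delta> ^^ i) F (k(e := t))" for i t
    proof (induction i arbitrary: t)
      case (Suc i)
      have upd: "k(e := t) + unit_vec e = k(e := t + 1)" by (auto simp: unit_vec_def)
      show ?case unfolding funpow.simps comp_apply Suc.IH by (simp only: upd)
    qed (simp add: H_def)
    have "H (k e) = (\<Sum>i<D. (of_int (k e) gchoose i) * ((\<lambda>g x. g (x + 1) - g x) ^^ i) H 0)"
      by (rule newton_int) (simp add: line vanishing_funpow[OF insert.prems(1)])
    then show ?thesis unfolding line by (simp add: H_def \<phi>_def)
  qed
  have F_eq: "F = (\<lambda>k. \<Sum>i<D. (of_int (k e) gchoose i) * (?\<Delta> ^^ i) F (\<phi> k))"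
    using expand by (rule ext)
  show ?case
    by (subst F_eq) (intro polynomial_function_sum polynomial_function_times_gbinomial mono G finite_lessThan insertI1)
qed

section \<open>Counts at vectors on the walls of a chamber\<close>

context unimodular_chamber
begin

text \<open>
  Moving \<open>n\<close> a little in the direction of the nonnegative vector \<open>W\<close> enters the chamber without changing the
  integral part.
\<close>

lemma lattice_count_boundary:
  assumes "\<And>l. l \<in> \<L> \<Longrightarrow> 0 \<le> dot J l n" "\<And>j. j \<in> J \<Longrightarrow> 0 \<le> W j"
  shows "of_nat (lattice_count J n) = extrapolation J n"
proof -
  define N where "N = 1 + (\<Sum>j\<in>J. \<bar>real_of_int (W j)\<bar>)"
  have N1: "1 \<le> N" by (simp add: N_def sum_nonneg)
  have WN: "real_of_int (W j) < N" if "j \<in> J" for j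
    using member_le_sum[of j J "\<lambda>j. \<bar>real_of_int (W j)\<bar>"] finite_J that by (simp add: N_def)
  define y where "y = (\<lambda>j. real_of_int (n j) + (1 / N) * real_of_int (W j))"
  have "0 < dot J l y" if l: "l \<in> \<L>" for l
  proof -
    have "dot J l y = of_int (dot J l n) + 1 / N * of_int (dot J l W)"
      unfolding y_def dot_add dot_scale dot_of_int ..
    moreover have "0 < 1 / N * real_of_int (dot J l W)" using W_pos[OF l] N1 by simp
    ultimately show ?thesis using assms(1)[OF l] by linarith
  qed
  then have "y \<in> chamber" by (simp add: chamber_def)
  then have "of_nat (lattice_count J (\<lambda>j. \<lfloor>y j\<rfloor>)) = extrapolation J (\<lambda>j. \<lfloor>y j\<rfloor>)"
    by (intro lattice_count_eq_extrapolation) auto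
  moreover have floor: "\<lfloor>y j\<rfloor> = n j" if j: "j \<in> J" for j
  proof -
    have "0 \<le> (1 / N) * real_of_int (W j)" "(1 / N) * real_of_int (W j) < 1"
      using assms(2)[OF j] WN[OF j] N1 by (auto simp: field_simps)
    then show ?thesis unfolding y_def by linarith
  qed
  moreover have "lattice_count J (\<lambda>j. \<lfloor>y j\<rfloor>) = lattice_count J n"
    using floor by (intro lattice_count_cong) auto
  moreover have "extrapolation J (\<lambda>j. \<lfloor>y j\<rfloor>) = extrapolation J n"
    using floor by (intro extrapolation_cong) auto
  ultimately show ?thesis by simp
qed

text \<open>
  The vector \<open>n - indic J\<close> is the integral part of \<open>n - \<theta>\<close> for each \<open>\<theta>\<close> with coordinates in the interval
  from \<open>0\<close>, excluded, to \<open>1\<close>. Take \<open>\<theta> = a n - c W + b z\<close> with \<open>c\<close> much smaller than \<open>b\<close> and \<open>b\<close> much smaller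
  than \<open>a\<close>: modulo \<open>L\<close>, the vector \<open>n - \<theta>\<close> is \<open>(1 - a) n + c W\<close>, which lies in the chamber.
\<close>

lemma lattice_count_interior:
  assumes n: "\<And>l. l \<in> \<L> \<Longrightarrow> 0 \<le> dot J l n" "\<And>j. j \<in> J \<Longrightarrow> 0 \<le> n j"
    and z: "z \<in> L" "\<And>j. j \<in> J \<Longrightarrow> n j = 0 \<Longrightarrow> 0 < z j"
  shows "of_nat (lattice_count J (n - indic J)) = extrapolation J (n - indic J)"
proof -
  define M where "M = 1 + (\<Sum>j\<in>J. \<bar>real_of_int (n j)\<bar> + \<bar>real_of_int (z j)\<bar> + \<bar>real_of_int (W j)\<bar>)"
  have M1: "1 \<le> M" by (simp add: M_def sum_nonneg)
  have M: "\<bar>real_of_int (n j)\<bar> + \<bar>real_of_int (z j)\<bar> + \<bar>real_of_int (W j)\<bar> < M" if "j \<in> J" for j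
    using member_le_sum[of j J "\<lambda>j. \<bar>real_of_int (n j)\<bar> + \<bar>real_of_int (z j)\<bar> + \<bar>real_of_int (W j)\<bar>"] finite_J that
    by (simp add: M_def)
  define a b c where "a = 1 / (2 * M)" and "b = 1 / (8 * M * M)" and "c = 1 / (16 * M * M * M)"
  have pos: "0 < a" "0 < b" "0 < c" using M1 by (auto simp: a_def b_def c_def)
  have a1: "a \<le> 1 / 2" using M1 by (simp add: a_def field_simps)
  have aM: "a * M = 1 / 2" "b * M = a / 4" "c * M = b / 2" using M1 by (auto simp: a_def b_def c_def field_simps)
  have ba: "b \<le> a / 4"
    using M1 pos(2) aM(2) mult_left_mono[of 1 M b] by linarith
  define y where "y = (\<lambda>j. (1 - a) * real_of_int (n j) + (c * real_of_int (W j) + (- b) * real_of_int (z j)))"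
  have "0 < dot J l y" if l: "l \<in> \<L>" for l
  proof -
    have "dot J l y = (1 - a) * of_int (dot J l n) + c * of_int (dot J l W)"
      unfolding y_def dot_add dot_scale dot_of_int using annihilates[OF l z(1)] by simp
    moreover have "0 \<le> (1 - a) * real_of_int (dot J l n)" using n(1)[OF l] a1 by simp
    moreover have "0 < c * real_of_int (dot J l W)" using W_pos[OF l] pos by simp
    ultimately show ?thesis by linarith
  qed
  then have "y \<in> chamber" by (simp add: chamber_def)
  then have "of_nat (lattice_count J (\<lambda>j. \<lfloor>y j\<rfloor>)) = extrapolation J (\<lambda>j. \<lfloor>y j\<rfloor>)"
    by (intro lattice_count_eq_extrapolation) auto
  moreover have floor: "\<lfloor>y j\<rfloor> = (n - indic J) j" if j: "j \<in> J" for j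
  proof -
    define t where "t = a * real_of_int (n j) - c * real_of_int (W j) + b * real_of_int (z j)"
    have cW: "\<bar>c * real_of_int (W j)\<bar> < b / 2"
      using mult_strict_left_mono[of "\<bar>real_of_int (W j)\<bar>" M c] M[OF j] pos aM by (simp add: abs_mult)
    have bz: "\<bar>b * real_of_int (z j)\<bar> < a / 4"
      using mult_strict_left_mono[of "\<bar>real_of_int (z j)\<bar>" M b] M[OF j] pos aM by (simp add: abs_mult)
    have an: "a * real_of_int (n j) < 1 / 2"
      using mult_strict_left_mono[of "real_of_int (n j)" M a] M[OF j] pos aM by simp
    have "0 < t"
    proof (cases "n j = 0")
      case True
      then have "b * 1 \<le> b * real_of_int (z j)"
        using z(2)[OF j] pos by (intro mult_left_mono) auto
      moreover have "a * real_of_int (n j) = 0" using True by simp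
      ultimately show ?thesis unfolding t_def using cW pos by linarith
    next
      case False
      then have "a * 1 \<le> a * real_of_int (n j)"
        using n(2)[OF j] pos by (intro mult_left_mono) auto
      then show ?thesis unfolding t_def using cW bz ba pos by linarith
    qed
    moreover have "t \<le> 1" using an cW bz ba a1 by (simp add: t_def abs_less_iff)
    moreover have "y j = real_of_int (n j) - t" by (simp add: y_def t_def algebra_simps)
    ultimately have "\<lfloor>y j\<rfloor> = n j - 1" by linarith
    then show ?thesis using j by (simp add: indic_def)
  qed
  moreover have "lattice_count J (\<lambda>j. \<lfloor>y j\<rfloor>) = lattice_count J (n - indic J)"
    using floor by (intro lattice_count_cong) auto
  moreover have "extrapolation J (\<lambda>j. \<lfloor>y j\<rfloor>) = extrapolation J (n - indic J)"
    using floor by (intro extrapolation_cong) auto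
  ultimately show ?thesis by simp
qed

end


section \<open>Orientations and flows\<close>

text \<open>
  Add vectors one at a time: a large multiple of a vector that is generic so far, plus a unit vector that
  detects the new form.
\<close>

lemma ex_generic_vector:
  assumes "finite \<A>" "finite I" "\<And>a. a \<in> \<A> \<Longrightarrow> \<exists>i\<in>I. a i \<noteq> 0"
  shows "\<exists>h :: 'i \<Rightarrow> int. (\<forall>i. 0 < h i) \<and> (\<forall>a\<in>\<A>. dot I a h \<noteq> 0)"
  using assms(1,3)
proof (induction \<A> rule: finite_induct)
  case empty
  show ?case by (intro exI[of _ "\<lambda>i. 1"]) simp
next
  case (insert a \<A>)
  then obtain h :: "'i \<Rightarrow> int" where h: "\<And>i. 0 < h i" "\<And>b. b \<in> \<A> \<Longrightarrow> dot I b h \<noteq> 0" by auto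
  show ?case
  proof (cases "dot I a h = 0")
    case False
    then show ?thesis using h by (intro exI[of _ h]) auto
  next
    case True
    obtain i where i: "i \<in> I" "a i \<noteq> 0" using insert.prems by blast
    define M where "M = 1 + (\<Sum>b\<in>\<A>. \<bar>b i\<bar>)"
    have M1: "1 \<le> M" by (simp add: M_def sum_nonneg)
    have M: "\<bar>b i\<bar> < M" if "b \<in> \<A>" for b
      using member_le_sum[of b \<A> "\<lambda>b. \<bar>b i\<bar>"] that insert.hyps(1) by (simp add: M_def)
    \<comment> \<open>Since \<open>\<bar>b i\<bar> < M\<close>, adding the unit vector cannot cancel a nonzero multiple of \<open>M\<close>.\<close>
    define h' where "h' = (\<lambda>j. M * h j + unit_vec i j)"
    have unit_vec: "dot I b (unit_vec i) = b i" for b :: "'i \<Rightarrow> int"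
    proof -
      have "dot I b (unit_vec i) = (\<Sum>j\<in>I. if j = i then b i else 0)"
        unfolding dot_def by (intro sum.cong) (auto simp: unit_vec_def)
      then show ?thesis using i(1) assms(2) by simp
    qed
    have dot_h': "dot I b h' = M * dot I b h + b i" for b
      unfolding h'_def dot_add dot_scale unit_vec ..
    have "0 < M * h j" for j using h(1)[of j] M1 by simp
    then have "0 < h' j" for j
      by (auto simp: h'_def unit_vec_def intro: add_pos_nonneg less_imp_le)
    moreover have "dot I b h' \<noteq> 0" if "b \<in> insert a \<A>" for b
    proof (cases "b = a")
      case True
      then show ?thesis using dot_h'[of a] \<open>dot I a h = 0\<close> i(2) by simp
    next
      case False
      then have b: "b \<in> \<A>" using that by simp
      have "M * 1 \<le> M * \<bar>dot I b h\<bar>" using h(2)[OF b] M1 by (intro mult_left_mono) auto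
      then have "M \<le> \<bar>M * dot I b h\<bar>" using M1 by (simp add: abs_mult)
      then show ?thesis using dot_h'[of b] M[OF b] by linarith
    qed
    ultimately show ?thesis by blast
  qed
qed

definition switch :: "'e set \<Rightarrow> 'e \<Rightarrow> int" where
  "switch S e = (if e \<in> S then - 1 else 1)"

text \<open>
  With these bounds the flows through the orientation \<open>S\<close> take values from \<open>0\<close> to \<open>k e\<close> along the
  direction that \<open>S\<close> gives to \<open>e\<close>. All orientations are treated with the same lattice and differ only in
  the bounds.
\<close>

definition side_bounds :: "'e set \<Rightarrow> ('e \<Rightarrow> int) \<Rightarrow> 'e \<times> bool \<Rightarrow> int" where
  "side_bounds S k = (\<lambda>(e, b). if b = (e \<in> S) then k e else 0)"

lemma side_bounds_add: "side_bounds S (k + k') = side_bounds S k + side_bounds S k'"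
  by (auto simp: side_bounds_def)

lemma side_bounds_uminus: "side_bounds S (- k) = - side_bounds S k"
  by (auto simp: side_bounds_def)

lemma reorient_simps [simp]:
  "verts (reorient G S) = verts G" "arcs (reorient G S) = arcs G"
  "tail (reorient G S) e = (if e \<in> S then head G e else tail G e)"
  "head (reorient G S) e = (if e \<in> S then tail G e else head G e)"
  by (simp_all add: reorient_def)

lemma cut_vector_reorient: "cut_vector (reorient G S) X e = switch S e * cut_vector G X e"
  by (simp add: cut_vector_def switch_def)

context fin_digraph
begin

sublocale flows: unimodular_lattice sides flow_lattice lattice_rank
  by (rule unimodular_flow_lattice)

lemma wf_digraph_reorient: "wf_digraph (reorient G S)"
  by unfold_locales auto

lemma walk_circulation:
  assumes "pre_digraph.awalk (reorient G S) u p v"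
  shows "excess G (\<lambda>e. switch S e * int (count_list p e)) w = of_bool (w = v) - of_bool (w = u)"
  using assms
proof (induction p arbitrary: u)
  case Nil
  interpret D: wf_digraph "reorient G S" by (rule wf_digraph_reorient)
  show ?case using Nil by (auto simp: D.awalk_Nil_iff excess_def)
next
  case (Cons e p)
  interpret D: wf_digraph "reorient G S" by (rule wf_digraph_reorient)
  have e: "e \<in> arcs G" "u = tail (reorient G S) e" and p: "D.awalk (head (reorient G S) e) p v"
    using Cons.prems by (auto simp: D.awalk_Cons_iff)
  have "(\<lambda>i. switch S i * int (count_list (e # p) i)) =
      (\<lambda>i. switch S i * int (count_list p i)) + (if e \<in> S then - unit_vec e else unit_vec e)"
    by (auto simp: switch_def unit_vec_def)
  then have "excess G (\<lambda>i. switch S i * int (count_list (e # p) i)) w =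
      of_bool (w = v) - of_bool (w = head (reorient G S) e) + switch S e * cut_vector G {w} e"
    using Cons.IH[OF p] excess_unit[OF e(1)] by (simp add: excess_add excess_uminus switch_def)
  then show ?case using e(2) by (auto simp: cut_vector_def switch_def)
qed

lemma ex_positive_circulation:
  assumes "totally_cyclic (reorient G S)"
  shows "\<exists>x\<in>circulations G. \<forall>e\<in>arcs G. 0 < switch S e * x e"
proof -
  interpret D: wf_digraph "reorient G S" by (rule wf_digraph_reorient)
  have "\<exists>x\<in>circulations G. (\<forall>e\<in>arcs G. 0 \<le> switch S e * x e) \<and> (\<forall>e\<in>A. 0 < switch S e * x e)"
    if "finite A" "A \<subseteq> arcs G" for A
    using that
  proof (induction A rule: finite_induct)
    case empty
    then show ?case using circulation_zero by (intro bexI[of _ 0]) auto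
  next
    case (insert a A)
    then obtain x where x: "x \<in> circulations G" "\<And>e. e \<in> arcs G \<Longrightarrow> 0 \<le> switch S e * x e"
      "\<And>e. e \<in> A \<Longrightarrow> 0 < switch S e * x e" by auto
    obtain c where c: "D.cycle c" "a \<in> set c"
      using assms insert.prems by (auto simp: totally_cyclic_def)
    obtain u where u: "D.awalk u c u" using c(1) by (auto simp: D.cycle_def)
    define y where "y = (\<lambda>e. switch S e * int (count_list c e))"
    have sw: "switch S e * y e = int (count_list c e)" for e
      by (simp add: y_def switch_def)
    have "set c \<subseteq> arcs G" using u by (auto simp: D.awalk_def)
    then have y: "y \<in> circulations G"
      using walk_circulation[OF u] by (auto simp: circulations_def y_def count_list_0_iff)
    have "count_list c a \<noteq> 0" using c(2) by (simp add: count_list_0_iff)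
    then have pos: "0 < switch S a * y a" using sw[of a] by simp
    have "0 \<le> switch S e * (x + y) e" if "e \<in> arcs G" for e
      using x(2)[OF that] sw[of e] by (simp add: distrib_left)
    moreover have "0 < switch S e * (x + y) e" if "e \<in> insert a A" for e
    proof (cases "e = a")
      case True
      then show ?thesis using x(2)[of a] pos insert.prems by (simp add: distrib_left)
    next
      case False
      then show ?thesis using x(3)[of e] sw[of e] that by (simp add: distrib_left)
    qed
    ultimately show ?case using circulation_add[OF x(1) y] by blast
  qed
  from this[of "arcs G"] show ?thesis by auto
qed

text \<open>
  Otherwise the vertices reachable from the head of some arc form a set that no arc leaves and that this
  arc enters, so that the flow into the set would be positive.
\<close>

lemma totally_cyclic_if_positive_circulation:
  assumes x: "x \<in> circulations G" "\<And>e. e \<in> arcs G \<Longrightarrow> 0 < switch S e * x e"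
  shows "totally_cyclic (reorient G S)"
  unfolding totally_cyclic_def
proof
  interpret D: wf_digraph "reorient G S" by (rule wf_digraph_reorient)
  fix e assume "e \<in> arcs (reorient G S)"
  then have e: "e \<in> arcs G" by simp
  define u v where "u = tail (reorient G S) e" and "v = head (reorient G S) e"
  define X where "X = {w. reachable (reorient G S) v w}"
  have X: "X \<subseteq> verts G" by (auto simp: X_def elim: reachable_in_vertsE)
  have vX: "v \<in> X" using e by (auto simp: X_def v_def)
  have "u \<in> X"
  proof (rule ccontr)
    assume "u \<notin> X"
    have term_eq: "cut_vector G X i * x i = cut_vector (reorient G S) X i * (switch S i * x i)" for i
      unfolding cut_vector_reorient by (simp add: switch_def)
    have nonneg: "0 \<le> cut_vector (reorient G S) X i" if "i \<in> arcs G" for i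
    proof -
      have "tail (reorient G S) i \<in> X \<Longrightarrow> head (reorient G S) i \<in> X"
        unfolding X_def mem_Collect_eq
        by (erule D.reachable_adj_trans) (use that in \<open>auto simp: arcs_ends_conv\<close>)
      then show ?thesis by (auto simp: cut_vector_def)
    qed
    have "cut_vector (reorient G S) X e = 1"
      using vX \<open>u \<notin> X\<close> by (simp add: cut_vector_def u_def v_def)
    then have "0 < cut_vector G X e * x e" using x(2)[OF e] by (simp add: term_eq)
    moreover have "0 \<le> cut_vector G X i * x i" if "i \<in> arcs G" for i
      unfolding term_eq using nonneg[OF that] x(2)[OF that] by simp
    ultimately have "0 < (\<Sum>i\<in>arcs G. cut_vector G X i * x i)"
      using e by (intro sum_pos2[of _ e]) auto
    then show False using cut_zero[OF x(1) X] by simp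
  qed
  then obtain p where "D.apath v p u" unfolding X_def mem_Collect_eq D.reachable_apath by blast
  then have "D.awalk u (e # p) u" "distinct (tl (D.awalk_verts u (e # p)))"
    using e by (auto simp: D.apath_def D.awalk_Cons_iff u_def v_def)
  then have "D.cycle (e # p)" by (auto simp: D.cycle_def)
  then show "\<exists>c. D.cycle c \<and> e \<in> set c" by (intro exI[of _ "e # p"]) simp
qed

definition closed_flows :: "'b set \<Rightarrow> ('b \<Rightarrow> int) \<Rightarrow> ('b \<Rightarrow> int) set" where
  "closed_flows S k = {x \<in> circulations G. \<forall>e\<in>arcs G. 0 \<le> switch S e * x e \<and> switch S e * x e \<le> k e}"

definition open_flows :: "'b set \<Rightarrow> ('b \<Rightarrow> int) \<Rightarrow> ('b \<Rightarrow> int) set" where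
  "open_flows S k = {x \<in> circulations G. \<forall>e\<in>arcs G. 0 < switch S e * x e \<and> switch S e * x e < k e}"

lemma lattice_count_sides:
  "flows.lattice_count sides n = card {x \<in> circulations G. \<forall>e\<in>arcs G. - n (e, True) \<le> x e \<and> x e \<le> n (e, False)}"
proof -
  have "flows.lattice_count sides n = card {z \<in> flow_lattice. \<forall>j\<in>sides. 0 \<le> z j + n j}"
    unfolding flows.lattice_count_def by simp
  then show ?thesis
    unfolding flow_lattice_bounded by (simp add: card_image[OF inj_on_subset[OF inj_signed_pair]])
qed

lemma lattice_count_closed: "flows.lattice_count sides (side_bounds S k) = card (closed_flows S k)"
proof -
  have "- side_bounds S k (e, True) \<le> x e \<and> x e \<le> side_bounds S k (e, False) \<longleftrightarrow>
      0 \<le> switch S e * x e \<and> switch S e * x e \<le> k e" for x e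
    by (cases "e \<in> S") (auto simp: side_bounds_def switch_def)
  then show ?thesis unfolding lattice_count_sides closed_flows_def by simp
qed

lemma lattice_count_open:
  "flows.lattice_count sides (side_bounds S k - indic sides) = card (open_flows S k)"
proof -
  have iff: "- (side_bounds S k - indic sides) (e, True) \<le> x e \<and> x e \<le> (side_bounds S k - indic sides) (e, False) \<longleftrightarrow>
      0 < switch S e * x e \<and> switch S e * x e < k e" if "e \<in> arcs G" for x e
    using that by (cases "e \<in> S") (auto simp: side_bounds_def switch_def indic_def)
  show ?thesis
    unfolding lattice_count_sides open_flows_def
    by (rule arg_cong[where f = card], rule Collect_cong, rule conj_cong[OF refl],
        rule ball_cong[OF refl], rule iff)
qed

lemma excess_in_out: "excess G x v = (\<Sum>e\<in>in_arcs G v. x e) - (\<Sum>e\<in>out_arcs G v. x e)"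
proof -
  have "(\<Sum>e\<in>in_arcs G v. x e) = (\<Sum>e\<in>arcs G. of_bool (head G e = v) * x e)"
    unfolding in_arcs_def sum.inter_filter[OF finite_arcs] by (intro sum.cong) auto
  moreover have "(\<Sum>e\<in>out_arcs G v. x e) = (\<Sum>e\<in>arcs G. of_bool (tail G e = v) * x e)"
    unfolding out_arcs_def sum.inter_filter[OF finite_arcs] by (intro sum.cong) auto
  ultimately show ?thesis
    by (simp add: excess_def cut_vector_def left_diff_distrib sum_subtractf)
qed

lemma card_integral_flows:
  assumes "\<And>x y. (\<And>e. e \<in> arcs G \<Longrightarrow> x e = y e) \<Longrightarrow> P x = P y"
  shows "card {x. integral_flow G x \<and> P x} = card {x \<in> circulations G. P x}"
proof -
  let ?f = "\<lambda>x. restrict x (arcs G)" and ?g = "\<lambda>x e. if e \<in> arcs G then x e else (0 :: int)"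
  have excess_cong: "excess G x v = excess G y v" if "\<And>e. e \<in> arcs G \<Longrightarrow> x e = y e" for x y v
    unfolding excess_def using that by (intro sum.cong) auto
  have flow_iff: "integral_flow G x \<longleftrightarrow> x \<in> arcs G \<rightarrow>\<^sub>E UNIV \<and> (\<forall>v\<in>verts G. excess G x v = 0)" for x
    by (simp add: integral_flow_def excess_in_out)
  have "bij_betw ?f {x \<in> circulations G. P x} {x. integral_flow G x \<and> P x}"
  proof (rule bij_betw_byWitness[where f' = ?g])
    show "\<forall>x\<in>{x \<in> circulations G. P x}. ?g (?f x) = x"
      by (auto simp: circulations_def)
    show "\<forall>x\<in>{x. integral_flow G x \<and> P x}. ?f (?g x) = x"
      by (auto simp: integral_flow_def PiE_def extensional_def)
    show "?f ` {x \<in> circulations G. P x} \<subseteq> {x. integral_flow G x \<and> P x}"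
    proof (intro image_subsetI CollectI)
      fix x assume "x \<in> {x \<in> circulations G. P x}"
      then have x: "x \<in> circulations G" "P x" by simp_all
      have "P (?f x) = P x" by (rule assms) simp
      moreover have "excess G (?f x) v = excess G x v" for v by (rule excess_cong) simp
      ultimately show "integral_flow G (?f x) \<and> P (?f x)"
        using x by (simp add: flow_iff circulations_def)
    qed
    show "?g ` {x. integral_flow G x \<and> P x} \<subseteq> {x \<in> circulations G. P x}"
    proof (intro image_subsetI CollectI)
      fix x assume "x \<in> {x. integral_flow G x \<and> P x}"
      then have x: "integral_flow G x" "P x" by simp_all
      have "P (?g x) = P x" by (rule assms) simp
      moreover have "excess G (?g x) v = excess G x v" for v by (rule excess_cong) simp
      ultimately show "?g x \<in> circulations G \<and> P (?g x)"
        using x by (simp add: flow_iff circulations_def)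
    qed
  qed
  then show ?thesis by (rule bij_betw_same_card[symmetric])
qed

lemma finite_orientations: "finite (totally_cyclic_orientations G)"
  by (rule finite_subset[of _ "Pow (arcs G)"]) (auto simp: totally_cyclic_orientations_def)

lemma finite_open_flows: "finite (open_flows S k)"
  by (rule finite_subset[OF _ finite_circulations_bounded[of "\<lambda>(e, b). k e"]])
    (force simp: open_flows_def switch_def split: if_splits)

text \<open>
  A nowhere-zero flow determines the orientation along which it is positive, and that orientation is
  totally cyclic.
\<close>

lemma flow_count_eq:
  "flow_count G k = (\<Sum>S\<in>totally_cyclic_orientations G. card (open_flows S k))"
proof -
  have "flow_count G k = card {x. integral_flow G x \<and> (\<forall>e\<in>arcs G. \<bar>x e\<bar> < k e \<and> x e \<noteq> 0)}"
    unfolding flow_count_def nowhere_zero_k_flows_def k_flows_def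
    by (rule arg_cong[where f = card]) auto
  also have "\<dots> = card {x \<in> circulations G. \<forall>e\<in>arcs G. \<bar>x e\<bar> < k e \<and> x e \<noteq> 0}"
    by (rule card_integral_flows) simp
  also have "{x \<in> circulations G. \<forall>e\<in>arcs G. \<bar>x e\<bar> < k e \<and> x e \<noteq> 0} =
      (\<Union>S\<in>totally_cyclic_orientations G. open_flows S k)"
  proof (intro equalityI subsetI)
    fix x assume "x \<in> {x \<in> circulations G. \<forall>e\<in>arcs G. \<bar>x e\<bar> < k e \<and> x e \<noteq> 0}"
    then have x: "x \<in> circulations G" "\<And>e. e \<in> arcs G \<Longrightarrow> \<bar>x e\<bar> < k e \<and> x e \<noteq> 0" by auto
    define S where "S = {e \<in> arcs G. x e < 0}"
    have pos: "0 < switch S e * x e \<and> switch S e * x e < k e" if "e \<in> arcs G" for e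
      using x(2)[OF that] that by (auto simp: switch_def S_def)
    then have "totally_cyclic (reorient G S)"
      by (intro totally_cyclic_if_positive_circulation[OF x(1)]) blast
    then have "S \<in> totally_cyclic_orientations G"
      by (auto simp: totally_cyclic_orientations_def S_def)
    then show "x \<in> (\<Union>S\<in>totally_cyclic_orientations G. open_flows S k)"
      using x(1) pos by (auto simp: open_flows_def)
  next
    fix x assume "x \<in> (\<Union>S\<in>totally_cyclic_orientations G. open_flows S k)"
    then show "x \<in> {x \<in> circulations G. \<forall>e\<in>arcs G. \<bar>x e\<bar> < k e \<and> x e \<noteq> 0}"
      by (fastforce simp: open_flows_def switch_def split: if_splits)
  qed
  also have "card \<dots> = (\<Sum>S\<in>totally_cyclic_orientations G. card (open_flows S k))"
  proof (rule card_UN_disjoint[OF finite_orientations])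
    show "\<forall>S\<in>totally_cyclic_orientations G. finite (open_flows S k)"
      using finite_open_flows by blast
    show "\<forall>S\<in>totally_cyclic_orientations G. \<forall>T\<in>totally_cyclic_orientations G.
        S \<noteq> T \<longrightarrow> open_flows S k \<inter> open_flows T k = {}"
    proof (intro ballI impI)
      fix S T assume ST: "S \<in> totally_cyclic_orientations G" "T \<in> totally_cyclic_orientations G" "S \<noteq> T"
      have "S = T" if x: "x \<in> open_flows S k" "x \<in> open_flows T k" for x
      proof -
        have "e \<in> S \<longleftrightarrow> x e < 0" "e \<in> T \<longleftrightarrow> x e < 0" if "e \<in> arcs G" for e
          using x that by (fastforce simp: open_flows_def switch_def split: if_splits)+
        then show ?thesis using ST by (auto simp: totally_cyclic_orientations_def)
      qed
      then show "open_flows S k \<inter> open_flows T k = {}" using ST(3) by blast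
    qed
  qed
  finally show ?thesis .
qed

abbreviation weighted_flow_count :: "('b \<Rightarrow> int) \<Rightarrow> nat" where
  "weighted_flow_count k \<equiv> (\<Sum>x\<in>k_flows G (\<lambda>e. k e + 1).
     card {S \<in> totally_cyclic_orientations G. compatible_orientation G x S})"

lemma weighted_count_eq:
  "weighted_flow_count k = (\<Sum>S\<in>totally_cyclic_orientations G. card (closed_flows S k))"
proof -
  have closed: "{x \<in> k_flows G (\<lambda>e. k e + 1). compatible_orientation G x S} =
      {x. integral_flow G x \<and> (\<forall>e\<in>arcs G. 0 \<le> switch S e * x e \<and> switch S e * x e \<le> k e)}"
    if S: "S \<subseteq> arcs G" for S
  proof -
    have "\<bar>x e\<bar> < k e + 1 \<and> (x e < 0 \<longrightarrow> e \<in> S) \<and> (0 < x e \<longrightarrow> e \<notin> S) \<longleftrightarrow>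
        0 \<le> switch S e * x e \<and> switch S e * x e \<le> k e" for x :: "'b \<Rightarrow> int" and e
      by (cases "e \<in> S") (auto simp: switch_def)
    then show ?thesis
      using S unfolding k_flows_def compatible_orientation_def by blast
  qed
  have card_closed: "card {x \<in> k_flows G (\<lambda>e. k e + 1). compatible_orientation G x S} = card (closed_flows S k)"
    if "S \<subseteq> arcs G" for S
    unfolding closed[OF that] closed_flows_def by (rule card_integral_flows) simp
  have fin: "finite (k_flows G (\<lambda>e. k e + 1))"
  proof (rule finite_subset)
    show "k_flows G (\<lambda>e. k e + 1) \<subseteq> (\<Pi>\<^sub>E e\<in>arcs G. {- k e..k e})"
    proof
      fix x assume x: "x \<in> k_flows G (\<lambda>e. k e + 1)"
      have "x e \<in> {- k e..k e}" if "e \<in> arcs G" for e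
      proof -
        have "\<bar>x e\<bar> < k e + 1" using x that by (simp add: k_flows_def)
        then show ?thesis by auto
      qed
      then show "x \<in> (\<Pi>\<^sub>E e\<in>arcs G. {- k e..k e})"
        using x by (simp add: k_flows_def integral_flow_def PiE_iff)
    qed
    show "finite (\<Pi>\<^sub>E e\<in>arcs G. {- k e..k e})" by (intro finite_PiE) auto
  qed
  have "(\<Sum>x\<in>k_flows G (\<lambda>e. k e + 1). card {S \<in> totally_cyclic_orientations G. compatible_orientation G x S})
    = (\<Sum>S\<in>totally_cyclic_orientations G. card {x \<in> k_flows G (\<lambda>e. k e + 1). compatible_orientation G x S})"
    using sum.swap_restrict[OF fin finite_orientations, of "\<lambda>_ _. 1 :: nat" "compatible_orientation G"]
    by simp
  also have "\<dots> = (\<Sum>S\<in>totally_cyclic_orientations G. card (closed_flows S k))"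
    by (intro sum.cong refl card_closed) (auto simp: totally_cyclic_orientations_def)
  finally show ?thesis .
qed

lemma ex_flow_functionals:
  "\<exists>\<F>. finite \<F> \<and> (\<forall>l\<in>\<F>. (\<forall>z\<in>flow_lattice. dot sides l z = 0) \<and> (\<exists>j\<in>sides. l j \<noteq> 0)) \<and>
    (\<forall>B\<subseteq>sides. \<not> spans sides flow_lattice B \<longrightarrow> (\<exists>l\<in>\<F>. \<forall>j\<in>B. l j = 0))"
proof -
  let ?N = "{B. B \<subseteq> sides \<and> \<not> spans sides flow_lattice B}"
  have "\<forall>B\<in>?N. \<exists>l. (\<forall>j\<in>B. l j = 0) \<and> (\<forall>z\<in>flow_lattice. dot sides l z = 0) \<and> (\<exists>j\<in>sides. l j \<noteq> 0)"
  proof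
    fix B assume "B \<in> ?N"
    then have "B \<subseteq> sides" "\<not> connecting B" using spans_iff_connecting[of B] by auto
    then show "\<exists>l. (\<forall>j\<in>B. l j = 0) \<and> (\<forall>z\<in>flow_lattice. dot sides l z = 0) \<and> (\<exists>j\<in>sides. l j \<noteq> 0)"
      by (rule separating_functional)
  qed
  from bchoice[OF this] obtain f where
    f: "\<forall>B\<in>?N. (\<forall>j\<in>B. f B j = 0) \<and> (\<forall>z\<in>flow_lattice. dot sides (f B) z = 0) \<and> (\<exists>j\<in>sides. f B j \<noteq> 0)"
    by (rule exE)
  have "finite ?N" by (rule finite_subset[of _ "Pow sides"]) auto
  then show ?thesis using f by (intro exI[of _ "f ` ?N"]) auto
qed

text \<open>
  There are \<open>2 * card (arcs G)\<close> coordinates, so the difference of their number and the rank is the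
  cyclomatic number.
\<close>

lemma sign_lattice_rank: "(- 1 :: rat) ^ (card sides + lattice_rank) = (- 1) ^ cyclomatic_number G"
proof -
  have "card sides = 2 * card (arcs G)" by (simp add: card_cartesian_product UNIV_bool)
  moreover have "card (link_classes G (arcs G)) \<le> card (verts G)" by (rule card_link_classes_le)
  moreover have "card (verts G) \<le> card (link_classes G (arcs G)) + card (arcs G)" by (rule card_verts_le) simp
  ultimately have "card sides + lattice_rank = 2 * (card (arcs G) + card (verts G) - card (link_classes G (arcs G))) + cyclomatic_number G"
    by (simp add: lattice_rank_def cyclomatic_number_def num_components_eq)
  then show ?thesis by (simp add: power_add power_mult)
qed

lemma dot_side_bounds:
  "dot sides l (side_bounds S k) = dot (arcs G) (\<lambda>e. l (e, e \<in> S)) k"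
proof -
  have "dot sides l (side_bounds S k) = (\<Sum>e\<in>arcs G. \<Sum>b\<in>UNIV. l (e, b) * side_bounds S k (e, b))"
    unfolding dot_def by (subst sum.cartesian_product) (simp add: case_prod_unfold)
  also have "\<dots> = (\<Sum>e\<in>arcs G. l (e, e \<in> S) * k e)"
    by (intro sum.cong) (auto simp: UNIV_bool side_bounds_def)
  finally show ?thesis by (simp add: dot_def)
qed

abbreviation same_side :: "('b \<times> bool \<Rightarrow> int) set \<Rightarrow> 'b set \<Rightarrow> ('b \<Rightarrow> int) \<Rightarrow> ('b \<Rightarrow> int) \<Rightarrow> bool" where
  "same_side \<F> S w k \<equiv> \<forall>l\<in>\<F>. 0 \<le> dot sides l (side_bounds S w) * dot sides l (side_bounds S k) \<and>
     (dot sides l (side_bounds S w) = 0 \<longrightarrow> dot sides l (side_bounds S k) = 0)"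

text \<open>
  Perturb the bounds \<open>side_bounds S w\<close> by a generic vector to obtain a chamber; the perturbation decides on
  which side of those walls the chamber lies that contain all vectors \<open>side_bounds S k\<close>. The polynomial is
  the extrapolation at \<open>- side_bounds S k\<close>. At \<open>- k\<close> it is the number of flows in the closed box, and by
  reciprocity it is, up to the sign, the number of flows in the open box at \<open>k\<close>.
\<close>

lemma orientation_polynomial:
  assumes \<F>: "finite \<F>" "\<And>l z. l \<in> \<F> \<Longrightarrow> z \<in> flow_lattice \<Longrightarrow> dot sides l z = 0"
      "\<And>l. l \<in> \<F> \<Longrightarrow> \<exists>j\<in>sides. l j \<noteq> 0"
      "\<And>B. B \<subseteq> sides \<Longrightarrow> \<not> spans sides flow_lattice B \<Longrightarrow> \<exists>l\<in>\<F>. \<forall>j\<in>B. l j = 0"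
    and w: "\<And>e. e \<in> arcs G \<Longrightarrow> 0 < w e"
    and S: "totally_cyclic (reorient G S)"
  shows "\<exists>F. polynomial_function (arcs G) F \<and> (\<forall>k.
    (\<forall>e\<in>arcs G. 0 \<le> k e) \<and> same_side \<F> S w k \<longrightarrow>
    ((\<forall>e\<in>arcs G. 0 < k e) \<longrightarrow> of_nat (card (open_flows S k)) = (- 1) ^ cyclomatic_number G * F k) \<and>
    of_nat (card (closed_flows S k)) = F (- k))"
proof -
  obtain \<eta> :: "'b \<times> bool \<Rightarrow> int" where \<eta>: "\<And>j. 0 < \<eta> j" "\<And>l. l \<in> \<F> \<Longrightarrow> dot sides l \<eta> \<noteq> 0"
    using ex_generic_vector[OF \<F>(1) flows.finite_J \<F>(3)] by blast
  define M where "M = 1 + (\<Sum>l\<in>\<F>. \<bar>dot sides l \<eta>\<bar>)"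
  have M1: "1 \<le> M" by (simp add: M_def sum_nonneg)
  have M: "\<bar>dot sides l \<eta>\<bar> < M" if "l \<in> \<F>" for l
    using member_le_sum[of l \<F> "\<lambda>l. \<bar>dot sides l \<eta>\<bar>"] that \<F>(1) by (simp add: M_def)
  \<comment> \<open>The factor \<open>M\<close> lets \<open>\<eta>\<close> decide the sign only of the forms that vanish at \<open>side_bounds S w\<close>.\<close>
  define W where "W = (\<lambda>j. M * side_bounds S w j + \<eta> j)"
  have dot_W: "dot sides l W = M * dot sides l (side_bounds S w) + dot sides l \<eta>" for l
    unfolding W_def dot_add dot_scale ..
  have sgn_W: "sgn (dot sides l W) = (if dot sides l (side_bounds S w) = 0 then sgn (dot sides l \<eta>)
      else sgn (dot sides l (side_bounds S w)))" if l: "l \<in> \<F>" for l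
  proof (cases "dot sides l (side_bounds S w)" "0 :: int" rule: linorder_cases)
    case less
    then have "M * dot sides l (side_bounds S w) \<le> M * (- 1)" using M1 by (intro mult_left_mono) auto
    then show ?thesis using less M[OF l] by (simp add: dot_W)
  next
    case equal
    then show ?thesis by (simp add: dot_W)
  next
    case greater
    then have "M * 1 \<le> M * dot sides l (side_bounds S w)" using M1 by (intro mult_left_mono) auto
    then show ?thesis using greater M[OF l] by (simp add: dot_W)
  qed
  have W0: "dot sides l W \<noteq> 0" if "l \<in> \<F>" for l
    using sgn_W[OF that] \<eta>(2)[OF that] by (metis sgn_0_0)
  define \<L> where "\<L> = (\<lambda>l j. sgn (dot sides l W) * l j) ` \<F>"
  have dot_sgn: "dot sides (\<lambda>j. s * l j) n = s * dot sides l n" for s :: int and l and n :: "'b \<times> bool \<Rightarrow> int"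
    by (simp add: dot_def sum_distrib_left mult.assoc)
  interpret C: unimodular_chamber sides flow_lattice lattice_rank \<L> W
  proof
    show "finite \<L>" using \<F>(1) by (simp add: \<L>_def)
    show "dot sides l z = 0" if "l \<in> \<L>" "z \<in> flow_lattice" for l z
      using that \<F>(2) by (auto simp: \<L>_def dot_sgn)
    show "\<exists>l\<in>\<L>. \<forall>j\<in>B. l j = 0" if "B \<subseteq> sides" "\<not> spans sides flow_lattice B" for B
      using \<F>(4)[OF that] unfolding \<L>_def by fastforce
    show "0 < dot sides l W" if l: "l \<in> \<L>" for l
    proof -
      obtain l' where l': "l' \<in> \<F>" "l = (\<lambda>j. sgn (dot sides l' W) * l' j)"
        using l by (auto simp: \<L>_def)
      show ?thesis using W0[OF l'(1)] unfolding l'(2) dot_sgn by (simp add: sgn_if)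
    qed
  qed
  have W_nonneg: "0 \<le> W j" if "j \<in> sides" for j
  proof -
    have "0 \<le> side_bounds S w j"
      using that w by (cases j) (auto simp: side_bounds_def intro: less_imp_le)
    then have "0 \<le> M * side_bounds S w j" using M1 by simp
    then show ?thesis using \<eta>(1)[of j] by (simp add: W_def)
  qed
  \<comment> \<open>The minus sign makes \<open>F\<close> the polynomial of the open counts, up to the sign, and \<open>F (- k)\<close> that of the closed counts.\<close>
  define F where "F = (\<lambda>k. C.extrapolation sides (- side_bounds S k))"
  have "polynomial_function (arcs G) F"
  proof (rule polynomial_function_of_vanishing[OF finite_arcs])
    have "- side_bounds S (u + v) = - side_bounds S u + - side_bounds S v" for u v
      unfolding side_bounds_add by (rule ext) simp
    from vanishing_compose[where \<phi> = "\<lambda>k. - side_bounds S k", OF this C.vanishing_extrapolation[OF order.refl]]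
    show "vanishing UNIV {} (Suc (card sides)) F" unfolding F_def .
    show "F k = F k'" if "\<And>e. e \<in> arcs G \<Longrightarrow> k e = k' e" for k k'
      unfolding F_def using that by (intro C.extrapolation_cong) (auto simp: side_bounds_def)
  qed
  moreover have "((\<forall>e\<in>arcs G. 0 < k e) \<longrightarrow> of_nat (card (open_flows S k)) = (- 1) ^ cyclomatic_number G * F k) \<and>
    of_nat (card (closed_flows S k)) = F (- k)"
    if k: "\<And>e. e \<in> arcs G \<Longrightarrow> 0 \<le> k e"
      "\<And>l. l \<in> \<F> \<Longrightarrow> 0 \<le> dot sides l (side_bounds S w) * dot sides l (side_bounds S k)"
      "\<And>l. l \<in> \<F> \<Longrightarrow> dot sides l (side_bounds S w) = 0 \<Longrightarrow> dot sides l (side_bounds S k) = 0" for k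
  proof
    have boundary: "0 \<le> dot sides l (side_bounds S k)" if l: "l \<in> \<L>" for l
    proof -
      obtain l' where l': "l' \<in> \<F>" "l = (\<lambda>j. sgn (dot sides l' W) * l' j)"
        using l by (auto simp: \<L>_def)
      show ?thesis
        unfolding l'(2) dot_sgn sgn_W[OF l'(1)] using k(2,3)[OF l'(1)]
        by (cases "dot sides l' (side_bounds S w)" "0 :: int" rule: linorder_cases) (auto simp: zero_le_mult_iff)
    qed
    show "of_nat (card (closed_flows S k)) = F (- k)"
      using C.lattice_count_boundary[OF boundary W_nonneg]
      by (simp add: F_def side_bounds_uminus lattice_count_closed)
    show "(\<forall>e\<in>arcs G. 0 < k e) \<longrightarrow> of_nat (card (open_flows S k)) = (- 1) ^ cyclomatic_number G * F k"
    proof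
      assume pos: "\<forall>e\<in>arcs G. 0 < k e"
      obtain x where x: "x \<in> circulations G" "\<And>e. e \<in> arcs G \<Longrightarrow> 0 < switch S e * x e"
        using ex_positive_circulation[OF S] by blast
      have "of_nat (flows.lattice_count sides (side_bounds S k - indic sides)) =
          C.extrapolation sides (side_bounds S k - indic sides)"
      proof (rule C.lattice_count_interior[OF boundary])
        show "0 \<le> side_bounds S k j" if "j \<in> sides" for j
          using that k(1) by (cases j) (auto simp: side_bounds_def)
        show "signed_pair x \<in> flow_lattice" using x(1) by (simp add: flow_lattice_def)
        show "0 < signed_pair x j" if "j \<in> sides" "side_bounds S k j = 0" for j
        proof -
          obtain e b where j: "j = (e, b)" by (cases j)
          then have "e \<in> arcs G" "b \<noteq> (e \<in> S)" using that pos by (auto simp: side_bounds_def split: if_splits)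
          then show ?thesis using x(2)[of e] by (cases b) (auto simp: j signed_pair_def switch_def)
        qed
      qed
      moreover have "C.extrapolation sides (- side_bounds S k) =
          (- 1) ^ (card sides + lattice_rank) * C.extrapolation sides (- (- side_bounds S k) - indic sides)"
        by (rule C.extrapolation_reciprocity) simp
      ultimately show "of_nat (card (open_flows S k)) = (- 1) ^ cyclomatic_number G * F k"
        unfolding sign_lattice_rank F_def
        by (simp add: lattice_count_open flip: power_add mult_2)
    qed
  qed
  ultimately show ?thesis by blast
qed

abbreviation flow_polynomial :: "('b \<Rightarrow> int) set \<Rightarrow> ('b \<Rightarrow> int) \<Rightarrow> (('b \<Rightarrow> int) \<Rightarrow> rat) \<Rightarrow> bool" where
  "flow_polynomial \<A> w F \<equiv> polynomial_function (arcs G) F \<and>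
        (\<forall>k. (\<forall>e\<in>arcs G. 0 \<le> k e) \<and> (\<forall>a\<in>\<A>. 0 \<le> dot (arcs G) a w * dot (arcs G) a k) \<longrightarrow>
          ((\<forall>e\<in>arcs G. 0 < k e) \<longrightarrow> of_nat (flow_count G k) = F k) \<and>
          (- 1) ^ cyclomatic_number G * F (- k) =
            of_nat (weighted_flow_count k))"

text \<open>
  The walls of all orientations together, restricted to the vectors \<open>side_bounds S k\<close> and with the trivial
  restrictions left out, form the arrangement \<open>\<A>\<close>.
\<close>

lemma chamber_polynomials:
  "\<exists>\<A>. finite \<A> \<and> (\<forall>a\<in>\<A>. \<exists>e\<in>arcs G. a e \<noteq> 0) \<and>
    (\<forall>w. (\<forall>e\<in>arcs G. 0 < w e) \<and> (\<forall>a\<in>\<A>. dot (arcs G) a w \<noteq> 0) \<longrightarrow>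
      (\<exists>F. flow_polynomial \<A> w F))"
proof -
  obtain \<F> where \<F>: "finite \<F>" "\<And>l z. l \<in> \<F> \<Longrightarrow> z \<in> flow_lattice \<Longrightarrow> dot sides l z = 0"
      "\<And>l. l \<in> \<F> \<Longrightarrow> \<exists>j\<in>sides. l j \<noteq> 0"
      "\<And>B. B \<subseteq> sides \<Longrightarrow> \<not> spans sides flow_lattice B \<Longrightarrow> \<exists>l\<in>\<F>. \<forall>j\<in>B. l j = 0"
    using ex_flow_functionals by blast
  \<comment> \<open>The restriction of the form \<open>l\<close> to the bounds that belong to the orientation \<open>S\<close>.\<close>
  define trace where "trace = (\<lambda>(l :: 'b \<times> bool \<Rightarrow> int, S) e. l (e, e \<in> S))"
  define \<A> where "\<A> = {a \<in> trace ` (\<F> \<times> Pow (arcs G)). \<exists>e\<in>arcs G. a e \<noteq> 0}"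
  have fin: "finite \<A>" using \<F>(1) by (simp add: \<A>_def)
  have nonzero: "\<forall>a\<in>\<A>. \<exists>e\<in>arcs G. a e \<noteq> 0" by (simp add: \<A>_def)
  have generic: "\<exists>F. flow_polynomial \<A> w F"
    if w: "\<And>e. e \<in> arcs G \<Longrightarrow> 0 < w e" "\<And>a. a \<in> \<A> \<Longrightarrow> dot (arcs G) a w \<noteq> 0" for w
  proof -
    let ?C = "totally_cyclic_orientations G"
    have "\<exists>F. polynomial_function (arcs G) F \<and> (\<forall>k.
      (\<forall>e\<in>arcs G. 0 \<le> k e) \<and> same_side \<F> S w k \<longrightarrow>
      ((\<forall>e\<in>arcs G. 0 < k e) \<longrightarrow> of_nat (card (open_flows S k)) = (- 1) ^ cyclomatic_number G * F k) \<and>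
      of_nat (card (closed_flows S k)) = F (- k))" if "S \<in> ?C" for S
      by (rule orientation_polynomial[OF \<F> w(1)]) (use that in \<open>auto simp: totally_cyclic_orientations_def\<close>)
    then obtain F where F: "\<And>S. S \<in> ?C \<Longrightarrow> polynomial_function (arcs G) (F S)"
      "\<And>S k. S \<in> ?C \<Longrightarrow> (\<forall>e\<in>arcs G. 0 \<le> k e) \<Longrightarrow> same_side \<F> S w k \<Longrightarrow>
      ((\<forall>e\<in>arcs G. 0 < k e) \<longrightarrow> of_nat (card (open_flows S k)) = (- 1) ^ cyclomatic_number G * F S k) \<and>
      of_nat (card (closed_flows S k)) = F S (- k)"
      by metis
    define H where "H = (\<lambda>k. (- 1) ^ cyclomatic_number G * (\<Sum>S\<in>?C. F S k))"
    have H: "polynomial_function (arcs G) H"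
      unfolding H_def by (intro polynomial_function_scale polynomial_function_sum finite_orientations F(1))
    have vals: "((\<forall>e\<in>arcs G. 0 < k e) \<longrightarrow> of_nat (flow_count G k) = H k) \<and>
        (- 1) ^ cyclomatic_number G * H (- k) =
            of_nat (weighted_flow_count k)"
      if k: "\<forall>e\<in>arcs G. 0 \<le> k e" "\<forall>a\<in>\<A>. 0 \<le> dot (arcs G) a w * dot (arcs G) a k" for k
    proof -
      have signs: "\<forall>l\<in>\<F>. 0 \<le> dot sides l (side_bounds S w) * dot sides l (side_bounds S k) \<and>
        (dot sides l (side_bounds S w) = 0 \<longrightarrow> dot sides l (side_bounds S k) = 0)" if S: "S \<in> ?C" for S
      proof
        fix l assume l: "l \<in> \<F>"
        define a where "a = trace (l, S)"
        have dots: "dot sides l (side_bounds S k) = dot (arcs G) a k" for k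
          by (simp add: dot_side_bounds a_def trace_def)
        show "0 \<le> dot sides l (side_bounds S w) * dot sides l (side_bounds S k) \<and>
          (dot sides l (side_bounds S w) = 0 \<longrightarrow> dot sides l (side_bounds S k) = 0)"
        proof (cases "\<exists>e\<in>arcs G. a e \<noteq> 0")
          case True
          have "S \<in> Pow (arcs G)" using S by (simp add: totally_cyclic_orientations_def)
          then have "a \<in> \<A>" using True l by (auto simp: \<A>_def a_def)
          then show ?thesis using k(2) w(2) by (simp add: dots)
        next
          case False
          then have "dot (arcs G) a k = 0" for k :: "'b \<Rightarrow> int" by (simp add: dot_def)
          then show ?thesis by (simp add: dots)
        qed
      qed
      note FS = F(2)[OF _ k(1) signs]
      show ?thesis
      proof
        show "(\<forall>e\<in>arcs G. 0 < k e) \<longrightarrow> of_nat (flow_count G k) = H k"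
          using FS unfolding flow_count_eq H_def of_nat_sum sum_distrib_left by (auto intro: sum.cong)
        show "(- 1) ^ cyclomatic_number G * H (- k) =
            of_nat (weighted_flow_count k)"
          using FS unfolding weighted_count_eq H_def of_nat_sum
          by (simp flip: mult.assoc power_add mult_2)
      qed
    qed
    show ?thesis
      by (intro exI[of _ H] conjI[OF H] allI impI vals) (elim conjE, assumption)+
  qed
  show ?thesis
  proof (intro exI[of _ \<A>] conjI[OF fin] conjI[OF nonzero] allI impI)
    fix w :: "'b \<Rightarrow> int" assume "(\<forall>e\<in>arcs G. 0 < w e) \<and> (\<forall>a\<in>\<A>. dot (arcs G) a w \<noteq> 0)"
    then show "\<exists>F. flow_polynomial \<A> w F"
      by (intro generic) simp_all
  qed
qed

end


section \<open>Fans of polyhedral cones\<close>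

text \<open>
  For fixed \<open>\<beta>\<close> both sides are polynomials in \<open>\<alpha>\<close> that agree at all large integers, hence at \<open>\<alpha> = -1\<close>; there
  they are polynomials in \<open>\<beta>\<close> that agree at all positive integers, hence at \<open>\<beta> = 0\<close>.
\<close>

lemma mpoly_eval_eq_beyond_ray:
  assumes "\<And>\<alpha> \<beta> :: nat. 1 \<le> \<beta> \<Longrightarrow> M * \<beta> \<le> \<alpha> \<Longrightarrow>
    mpoly_eval p (\<lambda>e. of_nat \<alpha> * k e + of_nat \<beta> * w e) = mpoly_eval q (\<lambda>e. of_nat \<alpha> * k e + of_nat \<beta> * w e)"
  shows "mpoly_eval p (\<lambda>e. - k e) = mpoly_eval q (\<lambda>e. - k e)"
proof -
  have first: "mpoly_eval p (\<lambda>e. of_nat \<beta> * w e + (- 1) * k e) = mpoly_eval q (\<lambda>e. of_nat \<beta> * w e + (- 1) * k e)"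
    if \<beta>: "1 \<le> \<beta>" for \<beta> :: nat
  proof -
    obtain P where P: "\<And>t. mpoly_eval p (\<lambda>e. of_nat \<beta> * w e + t * k e) = poly P t"
      using mpoly_eval_line[of p "\<lambda>e. of_nat \<beta> * w e" k] by blast
    obtain Q where Q: "\<And>t. mpoly_eval q (\<lambda>e. of_nat \<beta> * w e + t * k e) = poly Q t"
      using mpoly_eval_line[of q "\<lambda>e. of_nat \<beta> * w e" k] by blast
    have "poly P (of_nat \<alpha>) = poly Q (of_nat \<alpha>)" if "M * \<beta> \<le> \<alpha>" for \<alpha>
      using assms[OF \<beta> that] unfolding P[symmetric] Q[symmetric] by (simp add: add.commute)
    then have "P = Q" by (intro poly_eqI_eventually) (auto simp: eventually_sequentially)
    then show ?thesis unfolding P Q by simp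
  qed
  obtain P where P: "\<And>t. mpoly_eval p (\<lambda>e. - k e + t * w e) = poly P t"
    using mpoly_eval_line[of p "\<lambda>e. - k e" w] by blast
  obtain Q where Q: "\<And>t. mpoly_eval q (\<lambda>e. - k e + t * w e) = poly Q t"
    using mpoly_eval_line[of q "\<lambda>e. - k e" w] by blast
  have "poly P (of_nat \<beta>) = poly Q (of_nat \<beta>)" if "1 \<le> \<beta>" for \<beta>
    using first[OF that] unfolding P[symmetric] Q[symmetric] by (simp add: add.commute)
  then have "P = Q" by (intro poly_eqI_eventually) (auto simp: eventually_sequentially)
  then show ?thesis using P[of 0] Q[of 0] by simp
qed

text \<open>
  Round the vector \<open>n\<^sup>2 x + n h\<close> with \<open>h\<close> generic and \<open>n\<close> large. The first summand decides the signs of the forms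
  that are nonzero at \<open>x\<close>, the second decides the others, and the rounding error is bounded.
\<close>

lemma ex_generic_near:
  fixes x :: "'e \<Rightarrow> real"
  assumes fin: "finite E" "finite \<A>" and nonzero: "\<forall>a\<in>\<A>. \<exists>e\<in>E. a e \<noteq> 0"
    and x: "\<forall>e\<in>E. 0 \<le> x e" and "0 < \<delta>"
  shows "\<exists>(w :: 'e \<Rightarrow> int) N :: real. 0 < N \<and> (\<forall>e\<in>E. 0 < w e \<and> \<bar>real_of_int (w e) / N - x e\<bar> < \<delta>) \<and>
    (\<forall>a\<in>\<A>. dot E a w \<noteq> 0 \<and> 0 \<le> real_of_int (dot E a w) * dot E a x)"
proof -
  obtain h :: "'e \<Rightarrow> int" where h: "\<And>e. 0 < h e" "\<And>a. a \<in> \<A> \<Longrightarrow> dot E a h \<noteq> 0"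
    using ex_generic_vector[OF fin(2,1) nonzero[rule_format]] by blast
  define b1 b2 where "b1 = (\<lambda>a. \<Sum>e\<in>E. \<bar>real_of_int (a e)\<bar>)" and "b2 = (\<lambda>a. \<bar>real_of_int (dot E a h)\<bar>)"
  \<comment> \<open>The three parts of \<open>R\<close> absorb the rounding error, make the nonzero values \<open>dot E a x\<close> decide the sign, and keep \<open>w / N\<close> within \<open>\<delta>\<close> of \<open>x\<close>.\<close>
  define R where "R = 1 + (\<Sum>a\<in>\<A>. b1 a + (b1 a + b2 a) / \<bar>dot E a x\<bar>) + (\<Sum>e\<in>E. 1 + real_of_int (h e)) / \<delta>"
  obtain n :: nat where n: "R < n" using reals_Archimedean2 by blast
  have b: "0 \<le> b1 a" "0 \<le> b2 a" for a by (auto simp: b1_def b2_def sum_nonneg)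
  have s1: "b1 a + (b1 a + b2 a) / \<bar>dot E a x\<bar> \<le> (\<Sum>a\<in>\<A>. b1 a + (b1 a + b2 a) / \<bar>dot E a x\<bar>)" if "a \<in> \<A>" for a
    using that fin b by (intro member_le_sum[where f = "\<lambda>a. b1 a + (b1 a + b2 a) / \<bar>dot E a x\<bar>"]) auto
  have s1_nonneg: "0 \<le> (\<Sum>a\<in>\<A>. b1 a + (b1 a + b2 a) / \<bar>dot E a x\<bar>)"
    using b by (intro sum_nonneg) auto
  have h0: "0 \<le> real_of_int (h e)" for e using h(1)[of e] by simp
  have s2_nonneg: "0 \<le> (\<Sum>e\<in>E. 1 + real_of_int (h e)) / \<delta>"
    using \<open>0 < \<delta>\<close> h0 by (intro divide_nonneg_nonneg sum_nonneg add_nonneg_nonneg) auto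
  have n1: "1 < real n" using n s1_nonneg s2_nonneg unfolding R_def by linarith
  have n_a: "b1 a < n \<and> (b1 a + b2 a) / \<bar>dot E a x\<bar> < n" if "a \<in> \<A>" for a
  proof -
    have "0 \<le> (b1 a + b2 a) / \<bar>dot E a x\<bar>" using b by simp
    then show ?thesis using n s1[OF that] s2_nonneg b(1)[of a] unfolding R_def by linarith
  qed
  have n_e: "(1 + real_of_int (h e)) / \<delta> < n" if "e \<in> E" for e
  proof -
    have "1 + real_of_int (h e) \<le> (\<Sum>e\<in>E. 1 + real_of_int (h e))"
      using that fin h0 by (intro member_le_sum[where f = "\<lambda>e. 1 + real_of_int (h e)"]) (auto intro: add_nonneg_nonneg)
    then have "(1 + real_of_int (h e)) / \<delta> \<le> (\<Sum>e\<in>E. 1 + real_of_int (h e)) / \<delta>"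
      using \<open>0 < \<delta>\<close> by (intro divide_right_mono) auto
    then show ?thesis using n s1_nonneg unfolding R_def by linarith
  qed
  define N where "N = real n * real n"
  define w where "w = (\<lambda>e. \<lfloor>N * x e\<rfloor> + int n * h e)"
  have N0: "0 < N" using n1 by (simp add: N_def)
  show ?thesis
  proof (intro exI[of _ w] exI[of _ N] conjI[OF N0] conjI ballI)
    fix e assume e: "e \<in> E"
    have "0 \<le> \<lfloor>N * x e\<rfloor>" using N0 x e by simp
    moreover have "0 < int n * h e" using n1 h(1)[of e] by simp
    ultimately show "0 < w e" unfolding w_def by (rule add_nonneg_pos)
    have "\<bar>real_of_int (w e) - N * x e\<bar> \<le> 1 + real n * real_of_int (h e)"
    proof -
      have "0 \<le> real n * real_of_int (h e)" using h0 by simp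
      then show ?thesis unfolding w_def of_int_add of_int_mult of_int_of_nat_eq by linarith
    qed
    also have "\<dots> \<le> real n * (1 + real_of_int (h e))" using n1 by (simp add: distrib_left)
    also have "\<dots> < real n * (n * \<delta>)"
      using n_e[OF e] n1 \<open>0 < \<delta>\<close> by (intro mult_strict_left_mono) (auto simp: field_simps)
    also have "\<dots> = N * \<delta>" by (simp add: N_def)
    finally have bound: "\<bar>real_of_int (w e) - N * x e\<bar> < N * \<delta>" .
    have "real_of_int (w e) / N - x e = (real_of_int (w e) - N * x e) / N" using N0 by (simp add: field_simps)
    then have "\<bar>real_of_int (w e) / N - x e\<bar> = \<bar>real_of_int (w e) - N * x e\<bar> / N" using N0 by (simp add: abs_div)
    also have "\<dots> < \<delta>" using bound N0 by (simp add: divide_less_eq mult.commute)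
    finally show "\<bar>real_of_int (w e) / N - x e\<bar> < \<delta>" .
  next
    fix a assume a: "a \<in> \<A>"
    define r where "r = (\<Sum>e\<in>E. real_of_int (a e) * (of_int \<lfloor>N * x e\<rfloor> - N * x e))"
    have "\<bar>r\<bar> \<le> (\<Sum>e\<in>E. \<bar>real_of_int (a e) * (of_int \<lfloor>N * x e\<rfloor> - N * x e)\<bar>)"
      unfolding r_def by (rule sum_abs)
    also have "\<dots> \<le> b1 a"
      unfolding b1_def
    proof (rule sum_mono)
      fix e
      have "\<bar>of_int \<lfloor>N * x e\<rfloor> - N * x e\<bar> \<le> 1" by linarith
      then show "\<bar>real_of_int (a e) * (of_int \<lfloor>N * x e\<rfloor> - N * x e)\<bar> \<le> \<bar>real_of_int (a e)\<bar>"
        unfolding abs_mult using mult_left_mono[of _ 1 "\<bar>real_of_int (a e)\<bar>"] by simp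
    qed
    finally have r: "\<bar>r\<bar> \<le> b1 a" .
    have dot_w: "real_of_int (dot E a w) = N * dot E a x + r + real n * real_of_int (dot E a h)"
      unfolding dot_of_int[symmetric] w_def r_def
      by (simp add: dot_def algebra_simps sum.distrib sum_subtractf sum_distrib_left)
    have nh: "\<bar>real n * real_of_int (dot E a h)\<bar> = real n * b2 a" by (simp add: b2_def abs_mult)
    have "dot E a w \<noteq> 0 \<and> 0 \<le> real_of_int (dot E a w) * dot E a x"
    proof (cases "dot E a x = 0")
      case True
      have "1 \<le> b2 a" using h(2)[OF a] by (simp add: b2_def)
      then have "real n * 1 \<le> real n * b2 a" by (intro mult_left_mono) auto
      then have "b1 a < real n * b2 a" using n_a[OF a] by linarith
      then have "0 < \<bar>real_of_int (dot E a w)\<bar>" using dot_w[unfolded True] r nh by linarith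
      then show ?thesis using True by simp
    next
      case False
      have "b1 a + b2 a < n * \<bar>dot E a x\<bar>" using n_a[OF a] False by (simp add: divide_less_eq)
      then have "real n * (b1 a + b2 a) < real n * (n * \<bar>dot E a x\<bar>)" using n1 by simp
      moreover have "1 * b1 a \<le> real n * b1 a" using n1 b(1) by (intro mult_right_mono) auto
      ultimately have big: "b1 a + real n * b2 a < N * \<bar>dot E a x\<bar>" by (simp add: N_def algebra_simps)
      show ?thesis
      proof (cases "0 < dot E a x")
        case True
        then have "0 < real_of_int (dot E a w)" using dot_w big r nh by simp
        then show ?thesis using True by simp
      next
        case neg: False
        then have "real_of_int (dot E a w) < 0" using dot_w big r nh by simp
        then show ?thesis using neg by (simp add: mult_nonpos_nonpos)
      qed
    qed
    then show "dot E a w \<noteq> 0" "0 \<le> real_of_int (dot E a w) * dot E a x" by simp_all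
  qed
qed

definition sign_cone :: "'e set \<Rightarrow> ('e \<Rightarrow> int) set \<Rightarrow> ('e \<Rightarrow> int) \<Rightarrow> ('e \<Rightarrow> real) set" where
  "sign_cone E \<A> w = {x \<in> E \<rightarrow>\<^sub>E UNIV. (\<forall>e\<in>E. 0 \<le> x e) \<and> (\<forall>a\<in>\<A>. 0 \<le> real_of_int (dot E a w) * dot E a x)}"

lemma rational_polyhedral_sign_cone:
  assumes "finite E" "finite \<A>"
  shows "rational_polyhedral_cone E (sign_cone E \<A> w)"
proof -
  define A :: "('a \<Rightarrow> rat) set" where
    "A = (\<lambda>e i. of_int (unit_vec e i)) ` E \<union> (\<lambda>a i. of_int (dot E a w * a i)) ` \<A>"
  have coord: "(\<Sum>i\<in>E. of_rat (of_int (unit_vec e i)) * x i) = x e" if "e \<in> E" for e and x :: "'a \<Rightarrow> real"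
  proof -
    have "(\<Sum>i\<in>E. of_rat (of_int (unit_vec e i)) * x i) = (\<Sum>i\<in>E. if i = e then x e else 0)"
      by (intro sum.cong) (auto simp: unit_vec_def)
    then show ?thesis using that assms(1) by simp
  qed
  have wall: "(\<Sum>i\<in>E. of_rat (of_int (dot E a w * a i)) * x i) = real_of_int (dot E a w) * dot E a x"
    for a and x :: "'a \<Rightarrow> real"
    by (simp only: of_rat_of_int_eq of_rat_mult of_int_mult dot_def[of E a x] sum_distrib_left mult.assoc)
  have "(\<forall>a\<in>A. 0 \<le> (\<Sum>e\<in>E. of_rat (a e) * x e)) \<longleftrightarrow>
      (\<forall>e\<in>E. 0 \<le> x e) \<and> (\<forall>a\<in>\<A>. 0 \<le> real_of_int (dot E a w) * dot E a x)" for x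
  proof -
    have "(\<forall>a\<in>A. Q a) \<longleftrightarrow> (\<forall>e\<in>E. Q (\<lambda>i. of_int (unit_vec e i))) \<and> (\<forall>a\<in>\<A>. Q (\<lambda>i. of_int (dot E a w * a i)))"
      for Q unfolding A_def by blast
    then show ?thesis by (simp only: wall coord cong: ball_cong)
  qed
  then have "sign_cone E \<A> w = {x \<in> E \<rightarrow>\<^sub>E UNIV. \<forall>a\<in>A. 0 \<le> (\<Sum>e\<in>E. of_rat (a e) * x e)}"
    unfolding sign_cone_def by (simp only:)
  moreover have "finite A" using assms by (simp add: A_def)
  ultimately show ?thesis unfolding rational_polyhedral_cone_def by blast
qed

lemma full_dimensional_sign_cone:
  assumes fin: "finite E" "finite \<A>" and w: "\<And>e. e \<in> E \<Longrightarrow> 0 < w e" "\<And>a. a \<in> \<A> \<Longrightarrow> dot E a w \<noteq> 0"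
  shows "full_dimensional E (sign_cone E \<A> w)"
proof -
  define D where "D = 1 + (\<Sum>a\<in>\<A>. \<Sum>e\<in>E. \<bar>real_of_int (a e)\<bar>)"
  have D1: "1 \<le> D" by (simp add: D_def sum_nonneg)
  have D: "(\<Sum>e\<in>E. \<bar>real_of_int (a e)\<bar>) < D" if "a \<in> \<A>" for a
    using member_le_sum[of a \<A> "\<lambda>a. \<Sum>e\<in>E. \<bar>real_of_int (a e)\<bar>"] fin(2) that by (simp add: D_def sum_nonneg)
  define U where "U = (\<Pi>\<^sub>E e\<in>E. {real_of_int (w e) - 1 / D <..< real_of_int (w e) + 1 / D})"
  have "U \<subseteq> sign_cone E \<A> w"
  proof
    fix x assume x: "x \<in> U"
    have close: "\<bar>x e - real_of_int (w e)\<bar> < 1 / D" if "e \<in> E" for e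
      using PiE_mem[OF x[unfolded U_def] that] by (auto simp: abs_less_iff)
    have "0 \<le> x e" if "e \<in> E" for e
    proof -
      have "1 / D \<le> 1" using D1 by simp
      moreover have "1 \<le> real_of_int (w e)" using w(1)[OF that] by simp
      ultimately show ?thesis using close[OF that] by linarith
    qed
    moreover have "0 \<le> real_of_int (dot E a w) * dot E a x" if a: "a \<in> \<A>" for a
    proof -
      have "\<bar>dot E a x - real_of_int (dot E a w)\<bar> = \<bar>\<Sum>e\<in>E. real_of_int (a e) * (x e - real_of_int (w e))\<bar>"
        by (simp add: dot_def algebra_simps sum_subtractf)
      also have "\<dots> \<le> (\<Sum>e\<in>E. \<bar>real_of_int (a e) * (x e - real_of_int (w e))\<bar>)" by (rule sum_abs)
      also have "\<dots> \<le> (\<Sum>e\<in>E. \<bar>real_of_int (a e)\<bar> * (1 / D))"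
      proof (rule sum_mono)
        fix e assume "e \<in> E"
        from less_imp_le[OF close[OF this]]
        show "\<bar>real_of_int (a e) * (x e - real_of_int (w e))\<bar> \<le> \<bar>real_of_int (a e)\<bar> * (1 / D)"
          unfolding abs_mult by (rule mult_left_mono) simp
      qed
      also have "\<dots> = (\<Sum>e\<in>E. \<bar>real_of_int (a e)\<bar>) / D" by (simp add: sum_divide_distrib)
      also have "\<dots> < 1" using D[OF a] D1 by simp
      finally have close: "\<bar>dot E a x - real_of_int (dot E a w)\<bar> < 1" .
      have "1 \<le> \<bar>real_of_int (dot E a w)\<bar>" using w(2)[OF a] by simp
      then show ?thesis using close by (cases "0 < dot E a w") (auto simp: zero_le_mult_iff)
    qed
    ultimately show "x \<in> sign_cone E \<A> w" using x by (auto simp: sign_cone_def U_def PiE_iff)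
  qed
  moreover have "openin (powertop_real E) U"
    unfolding U_def using fin(1) by (simp add: openin_PiE)
  moreover have "restrict (\<lambda>e. real_of_int (w e)) E \<in> U"
    using D1 by (auto simp: U_def)
  ultimately show ?thesis
    unfolding full_dimensional_def using interior_of_maximal[of U "sign_cone E \<A> w" "powertop_real E"] by auto
qed

text \<open>
  Basic open sets of the product topology are boxes, and \<open>E\<close> is finite.
\<close>

lemma full_dimensional_box:
  assumes "finite E" "full_dimensional E C"
  shows "\<exists>y \<delta>. 0 < \<delta> \<and> y \<in> C \<and> (\<forall>x\<in>E \<rightarrow>\<^sub>E UNIV. (\<forall>e\<in>E. \<bar>x e - y e\<bar> < \<delta>) \<longrightarrow> x \<in> C)"
proof -
  obtain y where y: "y \<in> powertop_real E interior_of C" using assms(2) unfolding full_dimensional_def by blast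
  have yC: "y \<in> C" using interior_of_subset y by (rule subsetD)
  have "openin (powertop_real E) (powertop_real E interior_of C)" by simp
  from this[unfolded openin_product_topology_alt, rule_format, OF y]
  obtain U where "\<forall>e\<in>E. openin euclideanreal (U e)"
    and yU: "y \<in> Pi\<^sub>E E U" "Pi\<^sub>E E U \<subseteq> powertop_real E interior_of C"
    by (elim exE conjE)
  then have U: "\<And>e. e \<in> E \<Longrightarrow> open (U e)" "y \<in> Pi\<^sub>E E U" "Pi\<^sub>E E U \<subseteq> powertop_real E interior_of C"
    by auto
  have "\<exists>d>0. \<forall>t. \<bar>t - y e\<bar> < d \<longrightarrow> t \<in> U e" if "e \<in> E" for e
  proof -
    have "y e \<in> U e" using U(2) that by blast
    then show ?thesis using U(1)[OF that] by (auto simp: open_dist dist_real_def)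
  qed
  then obtain d where d: "\<And>e. e \<in> E \<Longrightarrow> 0 < d e" "\<And>e t. e \<in> E \<Longrightarrow> \<bar>t - y e\<bar> < d e \<Longrightarrow> t \<in> U e"
    by metis
  define \<delta> where "\<delta> = Min (insert 1 (d ` E))"
  have "0 < \<delta>" using assms(1) d(1) by (simp add: \<delta>_def)
  have \<delta>_le: "\<delta> \<le> d e" if "e \<in> E" for e using assms(1) that by (simp add: \<delta>_def)
  show ?thesis
  proof (intro exI conjI ballI impI)
    show "0 < \<delta>" by (rule \<open>0 < \<delta>\<close>)
    show "y \<in> C" by (rule yC)
    fix x assume x: "x \<in> E \<rightarrow>\<^sub>E UNIV" "\<forall>e\<in>E. \<bar>x e - y e\<bar> < \<delta>"
    have "x e \<in> U e" if e: "e \<in> E" for e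
      by (rule d(2)[OF e]) (rule less_le_trans[OF bspec[OF x(2) e] \<delta>_le[OF e]])
    then have "x \<in> Pi\<^sub>E E U" using x(1) by (auto simp: PiE_iff)
    then have "x \<in> powertop_real E interior_of C" by (rule subsetD[OF U(3)])
    then show "x \<in> C" by (rule subsetD[OF interior_of_subset])
  qed
qed

lemma rational_polyhedral_cone_combination:
  assumes "rational_polyhedral_cone E C" "x \<in> C" "y \<in> C" "0 \<le> s" "0 \<le> t"
  shows "(\<lambda>e\<in>E. s * x e + t * y e) \<in> C"
proof -
  obtain A :: "('a \<Rightarrow> rat) set" where C: "C = {x \<in> E \<rightarrow>\<^sub>E UNIV. \<forall>a\<in>A. 0 \<le> (\<Sum>e\<in>E. of_rat (a e) * x e)}"
    using assms(1) by (auto simp: rational_polyhedral_cone_def)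
  have "0 \<le> (\<Sum>e\<in>E. of_rat (a e) * (\<lambda>e\<in>E. s * x e + t * y e) e)" if "a \<in> A" for a
  proof -
    have "(\<Sum>e\<in>E. of_rat (a e) * (\<lambda>e\<in>E. s * x e + t * y e) e) =
        s * (\<Sum>e\<in>E. of_rat (a e) * x e) + t * (\<Sum>e\<in>E. of_rat (a e) * y e)"
      by (simp add: sum_distrib_left algebra_simps sum.distrib)
    then show ?thesis using assms that by (auto simp: C)
  qed
  then show ?thesis by (simp add: C)
qed

text \<open>
  There are only finitely many sign patterns, and each point of the orthant lies in the closed cone of a
  generic integer vector nearby.
\<close>

lemma piecewise_polynomial_of_sign_cones:
  fixes f :: "('e \<Rightarrow> int) \<Rightarrow> nat"
  assumes fin: "finite E" "finite \<A>" and nonzero: "\<forall>a\<in>\<A>. \<exists>e\<in>E. a e \<noteq> 0"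
    and poly: "\<And>w. \<forall>e\<in>E. 0 < w e \<Longrightarrow> \<forall>a\<in>\<A>. dot E a w \<noteq> 0 \<Longrightarrow>
      \<exists>p. mpoly_vars p \<subseteq> E \<and> (\<forall>k. (\<forall>e\<in>E. 0 < k e) \<and> (\<forall>a\<in>\<A>. 0 \<le> dot E a w * dot E a k) \<longrightarrow>
        of_nat (f k) = mpoly_eval p (\<lambda>e. of_int (k e)))"
  shows "\<exists>m C p. piecewise_polynomial E f m C p"
proof -
  define \<G> :: "('e \<Rightarrow> int) set" where "\<G> = {w. (\<forall>e\<in>E. 0 < w e) \<and> (\<forall>a\<in>\<A>. dot E a w \<noteq> 0)}"
  define pattern where "pattern = (\<lambda>w :: 'e \<Rightarrow> int. \<lambda>a\<in>\<A>. sgn (dot E a w))"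
  have "finite (pattern ` \<G>)"
  proof (rule finite_subset)
    have sgn: "sgn t \<in> {- 1, 0, 1}" for t :: int by (simp add: sgn_if)
    show "pattern ` \<G> \<subseteq> (\<Pi>\<^sub>E a\<in>\<A>. {- 1, 0, 1})"
      unfolding pattern_def by (intro image_subsetI restrict_PiE_iff[THEN iffD2] ballI sgn)
    show "finite (\<Pi>\<^sub>E a\<in>\<A>. {- 1, 0, 1 :: int})" using fin(2) by (intro finite_PiE) auto
  qed
  then obtain m :: nat and g where g: "pattern ` \<G> = g ` {i. i < m}"
    unfolding finite_conv_nat_seg_image by blast
  have "\<exists>w p. w \<in> \<G> \<and> pattern w = g i \<and> mpoly_vars p \<subseteq> E \<and>
      (\<forall>k. (\<forall>e\<in>E. 0 < k e) \<and> (\<forall>a\<in>\<A>. 0 \<le> dot E a w * dot E a k) \<longrightarrow>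
        of_nat (f k) = mpoly_eval p (\<lambda>e. of_int (k e)))" if "i < m" for i
  proof -
    have "g i \<in> pattern ` \<G>" using that g by blast
    then obtain w where w: "w \<in> \<G>" "pattern w = g i" by auto
    then show ?thesis using poly[of w] by (auto simp: \<G>_def)
  qed
  then obtain W p where W: "\<And>i. i < m \<Longrightarrow> W i \<in> \<G>" "\<And>i. i < m \<Longrightarrow> pattern (W i) = g i"
    and p: "\<And>i. i < m \<Longrightarrow> mpoly_vars (p i) \<subseteq> E"
      "\<And>i k. i < m \<Longrightarrow> (\<forall>e\<in>E. 0 < k e) \<Longrightarrow> (\<forall>a\<in>\<A>. 0 \<le> dot E a (W i) * dot E a k) \<Longrightarrow>
        of_nat (f k) = mpoly_eval (p i) (\<lambda>e. of_int (k e))"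
    by metis
  have "piecewise_polynomial E f m (\<lambda>i. sign_cone E \<A> (W i)) p"
    unfolding piecewise_polynomial_def
  proof (intro conjI allI impI ballI)
    fix i assume i: "i < m"
    show "rational_polyhedral_cone E (sign_cone E \<A> (W i))"
      by (rule rational_polyhedral_sign_cone[OF fin])
    show "full_dimensional E (sign_cone E \<A> (W i))"
      using W(1)[OF i] by (intro full_dimensional_sign_cone[OF fin]) (auto simp: \<G>_def)
    show "mpoly_vars (p i) \<subseteq> E" by (rule p(1)[OF i])
    fix k assume k: "k \<in> E \<rightarrow>\<^sub>E {0 :: int<..}" "(\<lambda>e\<in>E. real_of_int (k e)) \<in> sign_cone E \<A> (W i)"
    have "0 \<le> dot E a (W i) * dot E a k" if "a \<in> \<A>" for a
    proof -
      have "dot E a (\<lambda>e\<in>E. real_of_int (k e)) = real_of_int (dot E a k)" by (simp add: dot_def)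
      then have "0 \<le> real_of_int (dot E a (W i) * dot E a k)"
        using k(2) that by (auto simp: sign_cone_def)
      then show ?thesis by (simp only: of_int_0_le_iff)
    qed
    then show "of_nat (f k) = mpoly_eval (p i) (\<lambda>e. of_int (k e))"
      using k(1) by (intro p(2)[OF i]) auto
  next
    show "(\<Union>i<m. sign_cone E \<A> (W i)) = E \<rightarrow>\<^sub>E {0..}"
    proof (intro equalityI subsetI)
      fix x assume "x \<in> (\<Union>i<m. sign_cone E \<A> (W i))"
      then show "x \<in> E \<rightarrow>\<^sub>E {0..}" by (auto simp: sign_cone_def PiE_iff)
    next
      fix x :: "'e \<Rightarrow> real" assume x: "x \<in> E \<rightarrow>\<^sub>E {0..}"
      have "\<forall>e\<in>E. 0 \<le> x e" using x by (auto simp: PiE_iff)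
      from ex_generic_near[OF fin nonzero this zero_less_one]
      obtain w :: "'e \<Rightarrow> int" where w: "\<And>e. e \<in> E \<Longrightarrow> 0 < w e" "\<And>a. a \<in> \<A> \<Longrightarrow> dot E a w \<noteq> 0"
        "\<And>a. a \<in> \<A> \<Longrightarrow> 0 \<le> real_of_int (dot E a w) * dot E a x" by blast
      then have "pattern w \<in> g ` {i. i < m}" unfolding g[symmetric] by (auto simp: \<G>_def)
      then obtain i where i: "i < m" "pattern w = g i" by auto
      have "0 \<le> real_of_int (dot E a (W i)) * dot E a x" if a: "a \<in> \<A>" for a
      proof -
        have "pattern (W i) a = pattern w a" using W(2)[OF i(1)] i(2) by simp
        then have "sgn (dot E a (W i)) = sgn (dot E a w)" using a by (simp add: pattern_def)
        then show ?thesis using w(3)[OF a] by (auto simp: zero_le_mult_iff sgn_if split: if_splits)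
      qed
      then have "x \<in> sign_cone E \<A> (W i)" using x by (auto simp: sign_cone_def PiE_iff)
      then show "x \<in> (\<Union>i<m. sign_cone E \<A> (W i))" using i(1) by blast
    qed
  qed
  then show ?thesis by blast
qed

text \<open>
  A cone of the given decomposition may cross several chambers of \<open>\<A>\<close>. For given \<open>k\<close>, take a generic integer
  vector \<open>w\<close> in the interior of the cone and perturb \<open>k\<close> towards it: the chamber of \<open>M k + w\<close> contains all \<open>\<alpha> k + \<beta> w\<close>
  with \<open>\<alpha> \<ge> M \<beta>\<close>, and these points also lie in the cone. So the polynomial of the cone and that of the chamber
  agree there, hence also at \<open>- k\<close>.
\<close>

lemma piecewise_polynomial_reflection:
  fixes f :: "('e \<Rightarrow> int) \<Rightarrow> nat" and v :: "('e \<Rightarrow> int) \<Rightarrow> rat"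
  assumes fin: "finite E" "finite \<A>" and nonzero: "\<forall>a\<in>\<A>. \<exists>e\<in>E. a e \<noteq> 0"
    and poly: "\<And>w. \<forall>e\<in>E. 0 < w e \<Longrightarrow> \<forall>a\<in>\<A>. dot E a w \<noteq> 0 \<Longrightarrow>
      \<exists>p. mpoly_vars p \<subseteq> E \<and>
        (\<forall>k. (\<forall>e\<in>E. 0 < k e) \<and> (\<forall>a\<in>\<A>. 0 \<le> dot E a w * dot E a k) \<longrightarrow>
          of_nat (f k) = mpoly_eval p (\<lambda>e. of_int (k e))) \<and>
        (\<forall>k. (\<forall>e\<in>E. 0 \<le> k e) \<and> (\<forall>a\<in>\<A>. 0 \<le> dot E a w * dot E a k) \<longrightarrow>
          v k = mpoly_eval p (\<lambda>e. - of_int (k e)))"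
    and pw: "piecewise_polynomial E f m C p" and i: "i < m"
    and k: "k \<in> E \<rightarrow>\<^sub>E {0..}" "(\<lambda>e\<in>E. real_of_int (k e)) \<in> C i"
  shows "mpoly_eval (p i) (\<lambda>e. - of_int (k e)) = v k"
proof -
  have cone: "rational_polyhedral_cone E (C i)" and full: "full_dimensional E (C i)"
    and vars: "mpoly_vars (p i) \<subseteq> E"
    and nonneg: "C i \<subseteq> E \<rightarrow>\<^sub>E {0..}"
    and p: "\<And>k. k \<in> E \<rightarrow>\<^sub>E {0<..} \<Longrightarrow> (\<lambda>e\<in>E. real_of_int (k e)) \<in> C i \<Longrightarrow>
        of_nat (f k) = mpoly_eval (p i) (\<lambda>e. of_int (k e))"
    using pw i unfolding piecewise_polynomial_def by blast+
  obtain y \<delta> where y: "0 < \<delta>" "y \<in> C i"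
    "\<And>x. x \<in> E \<rightarrow>\<^sub>E UNIV \<Longrightarrow> \<forall>e\<in>E. \<bar>x e - y e\<bar> < \<delta> \<Longrightarrow> x \<in> C i"
    using full_dimensional_box[OF fin(1) full] by blast
  have y0: "\<forall>e\<in>E. 0 \<le> y e" using subsetD[OF nonneg y(2)] by (auto simp: PiE_iff)
  from ex_generic_near[OF fin nonzero y0 y(1)]
  obtain w :: "'e \<Rightarrow> int" and N :: real where N: "0 < N" and w: "\<And>e. e \<in> E \<Longrightarrow> 0 < w e"
    "\<And>e. e \<in> E \<Longrightarrow> \<bar>real_of_int (w e) / N - y e\<bar> < \<delta>" "\<And>a. a \<in> \<A> \<Longrightarrow> dot E a w \<noteq> 0"
    by blast
  have w_scaled: "(\<lambda>e\<in>E. real_of_int (w e) / N) \<in> C i" using w(2) by (intro y(3)) auto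
  have w_cone: "(\<lambda>e\<in>E. real_of_int (w e)) \<in> C i"
  proof -
    have "(\<lambda>e\<in>E. N * (\<lambda>e\<in>E. real_of_int (w e) / N) e + 0 * (\<lambda>e\<in>E. real_of_int (w e) / N) e) \<in> C i"
      using N by (intro rational_polyhedral_cone_combination[OF cone w_scaled w_scaled]) auto
    also have "(\<lambda>e\<in>E. N * (\<lambda>e\<in>E. real_of_int (w e) / N) e + 0 * (\<lambda>e\<in>E. real_of_int (w e) / N) e) = (\<lambda>e\<in>E. real_of_int (w e))"
      using N by (intro ext) simp
    finally show ?thesis .
  qed
  define M where "M = nat (1 + (\<Sum>a\<in>\<A>. \<bar>dot E a w\<bar>))"
  have M: "\<bar>dot E a w\<bar> < int M" if "a \<in> \<A>" for a
    using member_le_sum[of a \<A> "\<lambda>a. \<bar>dot E a w\<bar>"] fin(2) that by (simp add: M_def)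
  \<comment> \<open>The factor \<open>M\<close> lets \<open>w\<close> decide the sign only of the forms that vanish at \<open>k\<close>.\<close>
  define W where "W = (\<lambda>e. int M * k e + w e)"
  have k0: "0 \<le> k e" if "e \<in> E" for e using k(1) that by (auto simp: PiE_iff)
  have W_pos: "0 < W e" if "e \<in> E" for e
    using k0[OF that] w(1)[OF that] by (simp add: W_def add_nonneg_pos)
  have dot_W: "dot E a W = int M * dot E a k + dot E a w" for a
    unfolding W_def dot_add dot_scale ..
  have W_signs: "dot E a W \<noteq> 0 \<and> 0 \<le> dot E a W * dot E a k" if a: "a \<in> \<A>" for a
  proof (cases "dot E a k" "0 :: int" rule: linorder_cases)
    case less
    then have "int M * dot E a k \<le> int M * (- 1)" by (intro mult_left_mono) auto
    then have "dot E a W < 0" using M[OF a] by (simp add: dot_W)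
    then show ?thesis using less by (simp add: mult_nonpos_nonpos)
  next
    case equal
    then show ?thesis using w(3)[OF a] by (simp add: dot_W)
  next
    case greater
    then have "int M * 1 \<le> int M * dot E a k" by (intro mult_left_mono) auto
    then have "0 < dot E a W" using M[OF a] by (simp add: dot_W)
    then show ?thesis using greater by simp
  qed
  have "\<forall>e\<in>E. 0 < W e" "\<forall>a\<in>\<A>. dot E a W \<noteq> 0" using W_pos W_signs by auto
  from poly[OF this]
  obtain q where vars_q: "mpoly_vars q \<subseteq> E"
    and q_inside: "\<forall>k. (\<forall>e\<in>E. 0 < k e) \<and> (\<forall>a\<in>\<A>. 0 \<le> dot E a W * dot E a k) \<longrightarrow>
          of_nat (f k) = mpoly_eval q (\<lambda>e. of_int (k e))"
    and q_reflected: "\<forall>k. (\<forall>e\<in>E. 0 \<le> k e) \<and> (\<forall>a\<in>\<A>. 0 \<le> dot E a W * dot E a k) \<longrightarrow>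
          v k = mpoly_eval q (\<lambda>e. - of_int (k e))"
    by (elim exE conjE)
  have "mpoly_eval (p i) (\<lambda>e. - of_int (k e)) = mpoly_eval q (\<lambda>e. - of_int (k e))"
  proof (rule mpoly_eval_eq_beyond_ray)
    fix \<alpha> \<beta> :: nat assume \<beta>: "1 \<le> \<beta>" and \<alpha>: "M * \<beta> \<le> \<alpha>"
    define u where "u = (\<lambda>e\<in>E. int \<alpha> * k e + int \<beta> * w e)"
    have u_pos: "0 < u e" if "e \<in> E" for e
      using that k0[OF that] w(1)[OF that] \<beta> by (simp add: u_def add_nonneg_pos)
    have "(\<lambda>e\<in>E. real \<alpha> * (\<lambda>e\<in>E. real_of_int (k e)) e + real \<beta> * (\<lambda>e\<in>E. real_of_int (w e)) e) \<in> C i"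
      by (rule rational_polyhedral_cone_combination[OF cone k(2) w_cone]) auto
    also have "(\<lambda>e\<in>E. real \<alpha> * (\<lambda>e\<in>E. real_of_int (k e)) e + real \<beta> * (\<lambda>e\<in>E. real_of_int (w e)) e)
        = (\<lambda>e\<in>E. real_of_int (u e))"
      by (intro ext) (simp add: u_def)
    finally have u_cone: "(\<lambda>e\<in>E. real_of_int (u e)) \<in> C i" .
    have "0 \<le> dot E a W * dot E a u" if a: "a \<in> \<A>" for a
    proof -
      have "dot E a u = dot E a (\<lambda>e. int \<alpha> * k e + int \<beta> * w e)" by (simp add: dot_def u_def)
      also have "\<dots> = (int \<alpha> - int M * int \<beta>) * dot E a k + int \<beta> * dot E a W"
        unfolding dot_add dot_scale dot_W by (simp add: algebra_simps)
      finally have "dot E a W * dot E a u =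
          dot E a W * ((int \<alpha> - int M * int \<beta>) * dot E a k + int \<beta> * dot E a W)"
        by simp
      also have "\<dots> = (int \<alpha> - int M * int \<beta>) * (dot E a W * dot E a k) + int \<beta> * (dot E a W * dot E a W)"
        by (simp add: algebra_simps)
      finally have "dot E a W * dot E a u =
          (int \<alpha> - int M * int \<beta>) * (dot E a W * dot E a k) + int \<beta> * (dot E a W * dot E a W)" .
      moreover have "0 \<le> int \<alpha> - int M * int \<beta>" using \<alpha> by (simp flip: of_nat_mult)
      ultimately show ?thesis using W_signs[OF a] by simp
    qed
    then have "of_nat (f u) = mpoly_eval q (\<lambda>e. of_int (u e))"
      using u_pos by (intro q_inside[rule_format] conjI ballI) auto
    moreover have "of_nat (f u) = mpoly_eval (p i) (\<lambda>e. of_int (u e))"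
      using u_pos u_cone by (intro p) (auto simp: u_def)
    moreover have "mpoly_eval r (\<lambda>e. of_int (u e)) = mpoly_eval r (\<lambda>e. of_nat \<alpha> * of_int (k e) + of_nat \<beta> * of_int (w e))"
      if "mpoly_vars r \<subseteq> E" for r
      using that by (intro mpoly_eval_cong) (auto simp: u_def)
    ultimately show "mpoly_eval (p i) (\<lambda>e. of_nat \<alpha> * of_int (k e) + of_nat \<beta> * of_int (w e)) =
        mpoly_eval q (\<lambda>e. of_nat \<alpha> * of_int (k e) + of_nat \<beta> * of_int (w e))"
      using vars vars_q by metis
  qed
  also have "\<dots> = v k"
    using k0 W_signs by (intro q_reflected[rule_format, symmetric] conjI ballI) auto
  finally show ?thesis .
qed

section \<open>Reciprocity for the multivariate flow counting function\<close>

theorem theorem2: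
  fixes G :: "('v, 'e) pre_digraph"
  assumes "fin_digraph G" and "bridgeless G"
  shows "(\<exists>m C p. piecewise_polynomial (arcs G) (flow_count G) m C p) \<and>
    (\<forall>m C p. piecewise_polynomial (arcs G) (flow_count G) m C p \<longrightarrow>
      (\<forall>i<m. \<forall>k \<in> arcs G \<rightarrow>\<^sub>E {0..}. (\<lambda>e\<in>arcs G. real_of_int (k e)) \<in> C i \<longrightarrow>
        (-1) ^ cyclomatic_number G * mpoly_eval (p i) (\<lambda>e. - of_int (k e)) =
        of_nat (\<Sum>x\<in>k_flows G (\<lambda>e. k e + 1).
          card {S \<in> totally_cyclic_orientations G. compatible_orientation G x S})) \<and>
      (\<forall>i<m. (-1) ^ cyclomatic_number G * mpoly_eval (p i) (\<lambda>e. 0) =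
        of_nat (card (totally_cyclic_orientations G))))"
proof -
  interpret fin_digraph G by (rule assms(1))
  let ?E = "arcs G" and ?s = "(- 1 :: rat) ^ cyclomatic_number G"
  have sign: "?s * (?s * x) = x" for x by (simp flip: mult.assoc power_add mult_2)
  obtain \<A> where finite_\<A>: "finite \<A>" and nonzero: "\<forall>a\<in>\<A>. \<exists>e\<in>?E. a e \<noteq> 0"
    and F: "\<forall>w :: 'e \<Rightarrow> int. (\<forall>e\<in>?E. 0 < w e) \<and> (\<forall>a\<in>\<A>. dot ?E a w \<noteq> 0) \<longrightarrow>
      (\<exists>F. flow_polynomial \<A> w F)"
    using chamber_polynomials by (elim exE conjE) (rule that)
  note \<A> = finite_\<A> nonzero
  have poly: "\<exists>p. mpoly_vars p \<subseteq> ?E \<and>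
        (\<forall>k. (\<forall>e\<in>?E. 0 < k e) \<and> (\<forall>a\<in>\<A>. 0 \<le> dot ?E a w * dot ?E a k) \<longrightarrow>
          of_nat (flow_count G k) = mpoly_eval p (\<lambda>e. of_int (k e))) \<and>
        (\<forall>k. (\<forall>e\<in>?E. 0 \<le> k e) \<and> (\<forall>a\<in>\<A>. 0 \<le> dot ?E a w * dot ?E a k) \<longrightarrow>
          ?s * of_nat (weighted_flow_count k) = mpoly_eval p (\<lambda>e. - of_int (k e)))"
    if w: "\<forall>e\<in>?E. 0 < w e" "\<forall>a\<in>\<A>. dot ?E a w \<noteq> 0" for w
  proof -
    have "(\<forall>e\<in>?E. 0 < w e) \<and> (\<forall>a\<in>\<A>. dot ?E a w \<noteq> 0)" using w by blast
    from F[rule_format, OF this] obtain H where poly_H: "polynomial_function ?E H"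
      and "\<forall>k. (\<forall>e\<in>?E. 0 \<le> k e) \<and> (\<forall>a\<in>\<A>. 0 \<le> dot ?E a w * dot ?E a k) \<longrightarrow>
          ((\<forall>e\<in>?E. 0 < k e) \<longrightarrow> of_nat (flow_count G k) = H k) \<and> ?s * H (- k) = of_nat (weighted_flow_count k)"
      by (elim exE conjE)
    note H = poly_H this(2)[rule_format]
    obtain p where p: "mpoly_vars p \<subseteq> ?E" "\<And>k. H k = mpoly_eval p (\<lambda>e. of_int (k e))"
      using H(1) unfolding polynomial_function_def by blast
    show ?thesis
    proof (intro exI[of _ p] conjI[OF p(1)] conjI allI impI; elim conjE)
      fix k assume k: "\<forall>e\<in>?E. 0 < k e" "\<forall>a\<in>\<A>. 0 \<le> dot ?E a w * dot ?E a k"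
      then have "\<forall>e\<in>?E. 0 \<le> k e" by (auto intro: less_imp_le)
      then show "of_nat (flow_count G k) = mpoly_eval p (\<lambda>e. of_int (k e))"
        using H(2)[of k] k p(2) by simp
    next
      fix k assume k: "\<forall>e\<in>?E. 0 \<le> k e" "\<forall>a\<in>\<A>. 0 \<le> dot ?E a w * dot ?E a k"
      then have "?s * (?s * H (- k)) = ?s * of_nat (weighted_flow_count k)" using H(2)[of k] by simp
      then show "?s * of_nat (weighted_flow_count k) = mpoly_eval p (\<lambda>e. - of_int (k e))"
        unfolding sign using p(2)[of "- k"] by simp
    qed
  qed
  have reciprocity: "?s * mpoly_eval (p i) (\<lambda>e. - of_int (k e)) = of_nat (weighted_flow_count k)"
    if "piecewise_polynomial ?E (flow_count G) m C p" "i < m" "k \<in> ?E \<rightarrow>\<^sub>E {0..}"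
      "(\<lambda>e\<in>?E. real_of_int (k e)) \<in> C i" for m C p i k
  proof -
    have "mpoly_eval (p i) (\<lambda>e. - of_int (k e)) = ?s * of_nat (weighted_flow_count k)"
      by (rule piecewise_polynomial_reflection[where v = "\<lambda>k. ?s * of_nat (weighted_flow_count k)", OF finite_arcs \<A> poly that])
    then show ?thesis by (simp only: sign)
  qed
  show ?thesis
  proof (intro conjI allI impI ballI)
    show "\<exists>m C p. piecewise_polynomial ?E (flow_count G) m C p"
    proof (rule piecewise_polynomial_of_sign_cones[OF finite_arcs \<A>])
      fix w :: "'e \<Rightarrow> int" assume "\<forall>e\<in>?E. 0 < w e" "\<forall>a\<in>\<A>. dot ?E a w \<noteq> 0"
      from poly[OF this] show "\<exists>p. mpoly_vars p \<subseteq> ?E \<and>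
          (\<forall>k. (\<forall>e\<in>?E. 0 < k e) \<and> (\<forall>a\<in>\<A>. 0 \<le> dot ?E a w * dot ?E a k) \<longrightarrow>
            of_nat (flow_count G k) = mpoly_eval p (\<lambda>e. of_int (k e)))" by blast
    qed
  next
    fix m C p i k assume pw: "piecewise_polynomial ?E (flow_count G) m C p" and i: "i < m"
      and k: "k \<in> ?E \<rightarrow>\<^sub>E {0..}" "(\<lambda>e\<in>?E. real_of_int (k e)) \<in> C i"
    show "?s * mpoly_eval (p i) (\<lambda>e. - of_int (k e)) =
        of_nat (\<Sum>x\<in>k_flows G (\<lambda>e. k e + 1).
          card {S \<in> totally_cyclic_orientations G. compatible_orientation G x S})"
      by (rule reciprocity[OF pw i k])
  next
    fix m C p i assume pw: "piecewise_polynomial ?E (flow_count G) m C p" and i: "i < m"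
    define k :: "'e \<Rightarrow> int" where "k = (\<lambda>e\<in>?E. 0)"
    have cone: "rational_polyhedral_cone ?E (C i)" and vars: "mpoly_vars (p i) \<subseteq> ?E"
      using pw i by (auto simp: piecewise_polynomial_def)
    have "(\<lambda>e\<in>?E. real_of_int (k e)) \<in> C i"
      using cone by (auto simp: rational_polyhedral_cone_def k_def)
    then have "?s * mpoly_eval (p i) (\<lambda>e. - of_int (k e)) = of_nat (weighted_flow_count k)"
      by (intro reciprocity[OF pw i]) (auto simp: k_def)
    moreover have "mpoly_eval (p i) (\<lambda>e. - of_int (k e)) = mpoly_eval (p i) (\<lambda>e. 0)"
      using vars by (intro mpoly_eval_cong) (auto simp: k_def)
    moreover have "weighted_flow_count k = card (totally_cyclic_orientations G)"
    proof -
      have "closed_flows S k = {0}" for S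
      proof (intro equalityI subsetI)
        fix x assume x: "x \<in> closed_flows S k"
        have "x e = 0" for e
        proof (cases "e \<in> ?E")
          case True
          then have "0 \<le> switch S e * x e" "switch S e * x e \<le> 0" using x by (auto simp: closed_flows_def k_def)
          then show ?thesis by (simp add: switch_def split: if_splits)
        next
          case False
          then show ?thesis using x by (simp add: closed_flows_def circulations_def)
        qed
        then show "x \<in> {0}" by (simp add: fun_eq_iff)
      next
        fix x :: "'e \<Rightarrow> int" assume "x \<in> {0}"
        then show "x \<in> closed_flows S k" using circulation_zero by (simp add: closed_flows_def k_def)
      qed
      then show ?thesis unfolding weighted_count_eq by simp
    qed
    ultimately show "?s * mpoly_eval (p i) (\<lambda>e. 0) = of_nat (card (totally_cyclic_orientations G))"
      by simp
  qed
qed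

end
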